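(* Let $\delta\ge0$, $c>0$, $\epsilon\in(0,1/2)$, and let $\beta_j=c/j^{1+\epsilon}$ for $j\ge1$, with $\sum_{j=1}^\infty\beta_j<1$. Let $g$ be the kernel on $S=\{-1,+1\}$ of the (one-sided) long range $1$-dimensional Ising model with these parameters, $$g(a\underline x)=\phi\Big(a\sum_{n\ge1}\beta_nx_{-n}+a\delta\Big),\qquad \phi(r)=\frac{e^{r}}{e^{-r}+e^{r}}.$$ Then there is a unique $g$-measure and it is weak Bernoulli, although $g$ exhibits dynamic phase transition.
   Context: $S=\{-1,+1\}$, $\mathcal X=S^{\mathbb Z}$, $\mathcal X^-=S^{\{-1,-2,\dots\}}$. Sequences are written with the past to the right: $x_{-\infty}^i=(x_i,x_{i-1},\dots)$, $\underline x=x_{-\infty}^{-1}$; concatenations are read in the same order, sequences indexed by a left half-line of $\mathbb Z$ being identified by shifting indices. For $I\subset\mathbb R$, $\mathcal F_I$ is the $\sigma$-algebra on $\mathcal X$ generated by the coordinates with index in $I\cap\mathbb Z$; $\mathcal F=\mathcal F_{\mathbb R}$, $\mathcal F^-=\mathcal F_{(-\infty,-1]}$ and $\mathcal T^+=\bigcap_{n\ge1}\mathcal F_{[n,\infty)}$. A $g$-measure is a stationary (shift-invariant) probability measure $P$ on $(\mathcal X,\mathcal F)$, with canonical process $(X_j)_{j\in\mathbb Z}$, such that $P[X_0=a\mid X_{-\infty}^{-1}=\underline x]=g(a\underline x)$ for every $a\in S$ and $P$-a.e. $x$. For $\underline x\in\mathcal X^-$, $P^{\underline x}$ is the probability measure on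 $(\mathcal X,\mathcal F)$ under which $X_{-\infty}^{-1}=\underline x$ almost surely and, for $j\ge0$, $P^{\underline x}[X_j=a\mid X_{-\infty}^{j-1}=y_{-\infty}^{j-1}]=g(ay_{-\infty}^{j-1})$. $g$ exhibits dynamic uniqueness if $P^{\underline x}[A]=P^{\underline y}[A]$ for all $A\in\mathcal T^+$ and all $\underline x,\underline y\in\mathcal X^-$; otherwise it exhibits dynamic phase transition. A stationary measure $\mu$ on $(\mathcal X,\mathcal F)$ is weak Bernoulli (equivalently absolutely regular, $\beta$-mixing) if $\lim_{n\to\infty}d_{TV}\big(\mu|_{\mathcal F^-}\otimes\mu|_{\mathcal F_{[n,\infty)}},\ \mu|_{\mathcal F^-\otimes\mathcal F_{[n,\infty)}}\big)=0$, where $d_{TV}(\mu,\nu)=2\sup_A|\mu(A)-\nu(A)|$, $\mathcal F^-\otimes\mathcal F_{[n,\infty)}$ is the sub-$\sigma$-algebra of $\mathcal F$ generated by the rectangles $A\times B$ (the joint events "$A$ and $B$") with $A\in\mathcal F^-$, $B\in\mathcal F_{[n,\infty)}$, $\mu|_{\mathcal F^-}\otimes\mu|_{\mathcal F_{[n,\infty)}}$ is the product measure of the two restrictions, and $\mu|_{\mathcal F^-\otimes\mathcal F_{[n,\infty)}}$ is the restriction of $\mu$. *)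

theory Defs
  imports "HOL-Probability.Probability"
begin

definition spins :: "real set" where
  "spins = {-1, 1}"

definition configs :: "(int \<Rightarrow> real) set" where
  "configs = (UNIV \<rightarrow>\<^sub>E spins)"

text \<open>
  A sequence indexed by a left half-line of the integers is stored, most recent value first,
  as a function on the naturals.  In this encoding sequences that differ by a shift of the
  index are equal, and the concatenation of a symbol \<open>a\<close> with a past \<open>w\<close> is \<open>case_nat a w\<close>.
\<close>

definition pasts :: "(nat \<Rightarrow> real) set" where
  "pasts = (UNIV \<rightarrow>\<^sub>E spins)"

definition past_upto :: "int \<Rightarrow> (int \<Rightarrow> real) \<Rightarrow> (nat \<Rightarrow> real)" where
  "past_upto i x = (\<lambda>k. x (i - int k))"

text \<open>Only \<open>space\<close> and \<open>sets\<close> of the following carry information; it is used as a sub-sigma-algebra.\<close>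

definition coord_algebra :: "int set \<Rightarrow> (int \<Rightarrow> real) measure" where
  "coord_algebra I = sigma configs {{x \<in> configs. x i \<in> B} | i B. i \<in> I \<and> B \<subseteq> spins}"

definition future_tail :: "(int \<Rightarrow> real) set set" where
  "future_tail = (\<Inter>n\<in>{1..}. sets (coord_algebra {n..}))"

definition prob_on_configs :: "(int \<Rightarrow> real) measure \<Rightarrow> bool" where
  "prob_on_configs P \<longleftrightarrow> prob_space P \<and> space P = configs \<and> sets P = sets (coord_algebra UNIV)"

definition stationary :: "(int \<Rightarrow> real) measure \<Rightarrow> bool" where
  "stationary P \<longleftrightarrow> prob_on_configs P \<and> distr P P (\<lambda>x i. x (i + 1)) = P"

text \<open>
  \<open>has_cond_prob g P j\<close>: the conditional probability under \<open>P\<close> that the value at time \<open>j\<close> is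
  \<open>a\<close>, given the coordinates up to time \<open>j - 1\<close>, is given by \<open>g\<close>.
\<close>

definition has_cond_prob :: "((nat \<Rightarrow> real) \<Rightarrow> real) \<Rightarrow> (int \<Rightarrow> real) measure \<Rightarrow> int \<Rightarrow> bool" where
  "has_cond_prob g P j \<longleftrightarrow>
     (\<forall>a\<in>spins. AE x in P.
        real_cond_exp P (coord_algebra {..j - 1}) (indicator {y \<in> configs. y j = a}) x
          = g (case_nat a (past_upto (j - 1) x)))"

definition g_measure :: "((nat \<Rightarrow> real) \<Rightarrow> real) \<Rightarrow> (int \<Rightarrow> real) measure \<Rightarrow> bool" where
  "g_measure g P \<longleftrightarrow> stationary P \<and> has_cond_prob g P 0"

definition started_from :: "((nat \<Rightarrow> real) \<Rightarrow> real) \<Rightarrow> (nat \<Rightarrow> real) \<Rightarrow> (int \<Rightarrow> real) measure" where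
  "started_from g w =
     (THE P. prob_on_configs P \<and> (AE x in P. past_upto (-1) x = w) \<and> (\<forall>j\<ge>0. has_cond_prob g P j))"

definition dynamic_uniqueness :: "((nat \<Rightarrow> real) \<Rightarrow> real) \<Rightarrow> bool" where
  "dynamic_uniqueness g \<longleftrightarrow>
     (\<forall>A\<in>future_tail. \<forall>w\<in>pasts. \<forall>w'\<in>pasts.
        measure (started_from g w) A = measure (started_from g w') A)"

definition dynamic_phase_transition :: "((nat \<Rightarrow> real) \<Rightarrow> real) \<Rightarrow> bool" where
  "dynamic_phase_transition g \<longleftrightarrow> \<not> dynamic_uniqueness g"

definition tv_dist :: "'a measure \<Rightarrow> 'a measure \<Rightarrow> real" where
  "tv_dist M N = 2 * (SUP A\<in>sets M. \<bar>measure M A - measure N A\<bar>)"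

definition rect_algebra :: "int \<Rightarrow> (int \<Rightarrow> real) measure" where
  "rect_algebra n =
     sigma configs {A \<inter> B | A B. A \<in> sets (coord_algebra {..-1}) \<and> B \<in> sets (coord_algebra {n..})}"

text \<open>
  The product of the two restrictions lives on pairs of configurations.  It is transported to
  \<open>rect_algebra n\<close> by joining the past of the first component to the future of the second, so
  that the rectangle \<open>A \<times> B\<close> becomes the joint event \<open>A \<inter> B\<close>; see \<open>emeasure_prod_restr\<close> below.
\<close>

definition join_past_future :: "(int \<Rightarrow> real) \<times> (int \<Rightarrow> real) \<Rightarrow> (int \<Rightarrow> real)" where
  "join_past_future p = (\<lambda>i. if i < 0 then fst p i else snd p i)"

definition prod_restr :: "(int \<Rightarrow> real) measure \<Rightarrow> int \<Rightarrow> (int \<Rightarrow> real) measure" where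
  "prod_restr M n =
     distr (restr_to_subalg M (coord_algebra {..-1}) \<Otimes>\<^sub>M restr_to_subalg M (coord_algebra {n..}))
       (rect_algebra n) join_past_future"

definition weak_bernoulli :: "(int \<Rightarrow> real) measure \<Rightarrow> bool" where
  "weak_bernoulli M \<longleftrightarrow> stationary M \<and>
     (\<lambda>n. tv_dist (prod_restr M (int n)) (restr_to_subalg M (rect_algebra (int n)))) \<longlonglongrightarrow> 0"

definition logistic_phi :: "real \<Rightarrow> real" where
  "logistic_phi r = exp r / (exp (- r) + exp r)"

text \<open>Here \<open>z = case_nat a w\<close>, so that \<open>z 0 = a\<close>, and \<open>z n\<close> is the value \<open>n\<close> steps in the past.\<close>

definition ising_kernel :: "(nat \<Rightarrow> real) \<Rightarrow> real \<Rightarrow> (nat \<Rightarrow> real) \<Rightarrow> real" where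
  "ising_kernel \<beta> \<delta> z = logistic_phi (z 0 * (\<Sum>n. \<beta> (Suc n) * z (Suc n)) + z 0 * \<delta>)"


lemma space_coord_algebra [simp]: "space (coord_algebra I) = configs"
  unfolding coord_algebra_def by (rule space_measure_of) auto

lemma sets_coord_algebra:
  "sets (coord_algebra I) = sigma_sets configs {{x \<in> configs. x i \<in> B} | i B. i \<in> I \<and> B \<subseteq> spins}"
  unfolding coord_algebra_def by (rule sets_measure_of) auto

lemma sets_coord_algebra_UNIV:
  "sets (coord_algebra UNIV) = sets (PiM UNIV (\<lambda>_. count_space spins))"
  unfolding sets_coord_algebra sets_PiM_single configs_def by auto

lemma coord_algebra_mono: "I \<subseteq> J \<Longrightarrow> sets (coord_algebra I) \<subseteq> sets (coord_algebra J)"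
  unfolding sets_coord_algebra by (rule sigma_sets_mono') auto

lemma subalgebra_coord:
  assumes "prob_on_configs M" shows "subalgebra M (coord_algebra I)"
  using assms coord_algebra_mono[of I UNIV] by (auto simp: subalgebra_def prob_on_configs_def)

lemma coord_algebra_cong:
  assumes "A \<in> sets (coord_algebra I)" "x \<in> configs" "y \<in> configs" "\<And>i. i \<in> I \<Longrightarrow> x i = y i"
  shows "x \<in> A \<longleftrightarrow> y \<in> A"
  using assms(1) unfolding sets_coord_algebra
proof (induction rule: sigma_sets.induct)
  case (Basic a)
  then obtain i B where "a = {x \<in> configs. x i \<in> B}" "i \<in> I" by blast
  then show ?case using assms(2-4) by simp
next
  case (Compl a)
  then show ?case using assms(2,3) by blast
qed blast+

lemma join_past_future_configs:
  "p \<in> configs \<times> configs \<Longrightarrow> join_past_future p \<in> configs"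
  by (cases p) (simp add: configs_def join_past_future_def PiE_iff extensional_def)

lemma join_past_future_rect:
  assumes "A \<in> sets (coord_algebra {..-1})" "B \<in> sets (coord_algebra {n..})" "0 \<le> n"
  shows "join_past_future -` (A \<inter> B) \<inter> (configs \<times> configs) = A \<times> B"
proof -
  have sub: "A \<subseteq> configs" "B \<subseteq> configs"
    using sets.sets_into_space[OF assms(1)] sets.sets_into_space[OF assms(2)] by simp_all
  have "join_past_future p \<in> A \<longleftrightarrow> fst p \<in> A" if "p \<in> configs \<times> configs" for p
    by (rule coord_algebra_cong[OF assms(1) join_past_future_configs[OF that]])
      (use that in \<open>auto simp: join_past_future_def\<close>)
  moreover have "join_past_future p \<in> B \<longleftrightarrow> snd p \<in> B" if "p \<in> configs \<times> configs" for p
    by (rule coord_algebra_cong[OF assms(2) join_past_future_configs[OF that]])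
      (use that assms(3) in \<open>auto simp: join_past_future_def\<close>)
  ultimately have "p \<in> join_past_future -` (A \<inter> B) \<inter> (configs \<times> configs) \<longleftrightarrow> p \<in> A \<times> B" for p
    using sub unfolding mem_Times_iff Int_iff vimage_eq by blast
  then show ?thesis by blast
qed

lemma emeasure_prod_restr:
  assumes M: "prob_on_configs M" and n: "0 \<le> n"
    and A: "A \<in> sets (coord_algebra {..-1})" and B: "B \<in> sets (coord_algebra {n..})"
  shows "emeasure (prod_restr M n) (A \<inter> B) = emeasure M A * emeasure M B"
proof -
  let ?P = "restr_to_subalg M (coord_algebra {..-1})" and ?Q = "restr_to_subalg M (coord_algebra {n..})"
  let ?G = "{A \<inter> B | A B. A \<in> sets (coord_algebra {..-1}) \<and> B \<in> sets (coord_algebra {n..})}"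
  note sub = subalgebra_coord[OF M]
  interpret prob_space M
    using M by (simp add: prob_on_configs_def)
  interpret Q: prob_space ?Q by (rule prob_space_restr_to_subalg[OF sub prob_space_axioms])
  have sp: "space (?P \<Otimes>\<^sub>M ?Q) = configs \<times> configs"
    using M by (simp add: space_pair_measure space_restr_to_subalg prob_on_configs_def)
  have G: "?G \<subseteq> Pow configs"
    using sets.sets_into_space[of _ "coord_algebra {..-1}"] unfolding space_coord_algebra by blast
  have meas: "join_past_future \<in> measurable (?P \<Otimes>\<^sub>M ?Q) (rect_algebra n)"
    unfolding rect_algebra_def
  proof (rule measurable_measure_of[OF G])
    show "join_past_future \<in> space (?P \<Otimes>\<^sub>M ?Q) \<rightarrow> configs"
      unfolding sp using join_past_future_configs by blast
    fix y assume "y \<in> ?G"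
    then obtain A B where y: "y = A \<inter> B" "A \<in> sets (coord_algebra {..-1})" "B \<in> sets (coord_algebra {n..})"
      by blast
    show "join_past_future -` y \<inter> space (?P \<Otimes>\<^sub>M ?Q) \<in> sets (?P \<Otimes>\<^sub>M ?Q)"
      unfolding sp y(1) join_past_future_rect[OF y(2,3) n]
      using y(2,3) by (intro pair_measureI) (simp_all add: sets_restr_to_subalg[OF sub])
  qed
  have AB: "A \<inter> B \<in> sets (rect_algebra n)"
    unfolding rect_algebra_def sets_measure_of[OF G] using A B by (intro sigma_sets.Basic) blast
  have "emeasure (prod_restr M n) (A \<inter> B) = emeasure (?P \<Otimes>\<^sub>M ?Q) (A \<times> B)"
    unfolding prod_restr_def emeasure_distr[OF meas AB] sp join_past_future_rect[OF A B n] ..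
  also have "\<dots> = emeasure ?P A * emeasure ?Q B"
    using A B by (intro Q.emeasure_pair_measure_Times) (simp_all add: sets_restr_to_subalg[OF sub])
  also have "\<dots> = emeasure M A * emeasure M B"
    using A B by (simp add: emeasure_restr_to_subalg[OF sub])
  finally show ?thesis .
qed

end

theory Submission imports Defs begin

text \<open>
  Let \<open>T f v\<close> be the expectation of \<open>f\<close> after one more symbol has been drawn from the past \<open>v\<close>.
  Say that \<open>f\<close> has weights \<open>c\<close> if changing the symbol \<open>n\<close> steps back changes \<open>f\<close> by at most
  \<open>c n\<close>.  As \<open>logistic_phi\<close> has slope at most \<open>1/2\<close>, \<open>T f\<close> has the weights
  \<open>c (n + 1) + c 0 * \<beta> (n + 1)\<close>, and since the \<open>\<beta>\<close> sum to less than \<open>1\<close> the total weight of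
  \<open>T^n f\<close> tends to \<open>0\<close>.  So \<open>T^n f\<close> converges to a constant, which is the integral of \<open>f\<close> under
  the only \<open>g\<close>-measure.  The same weights show that linear functionals of the past have variance
  bounded by the sum of the squares of their coefficients.

  Weak Bernoulli: two pasts \<open>v\<close>, \<open>w\<close> followed by the same symbols produce, at time \<open>j\<close>, fields whose
  difference \<open>S j v - S j w\<close> is deterministic, and for independent typical pasts these differences
  are square summable in the mean.  A chi-square bound therefore makes the influence of \<open>v\<close>, \<open>w\<close>
  on the symbols after time \<open>k\<close> small, while the influence of the first \<open>k\<close> symbols on the distant
  future vanishes because a single symbol has finite total influence.

  Phase transition: let \<open>D j\<close> be \<open>X j\<close> minus its conditional mean as predicted from the all-plus
  past, and let \<open>t j\<close> be the total weight \<open>\<beta>\<close> gives to the past at time \<open>j\<close>, which is of order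
  \<open>j\<close> to the power \<open>-\<epsilon>\<close>.  The sum of \<open>t j * D j\<close> over \<open>j < N\<close>, divided by the sum \<open>V N\<close> of
  \<open>(t j)^2\<close>, tends to \<open>0\<close> along a subsequence when the past is all plus, and stays below a
  negative constant when it is all minus; \<open>V N\<close> diverges because \<open>\<epsilon> < 1/2\<close>.  Changing finitely many
  symbols changes the sum by a bounded amount, so this is a tail event.
\<close>

section \<open>The transfer operator\<close>

text \<open>A unique mixing \<open>g\<close>-measure and a dynamic phase transition coexist because
  the influence of the past has two sizes. The all-plus and all-minus pasts, followed by the same
  symbols, keep shifting the field at time \<open>j\<close> by \<open>2 * t j\<close>, which is not
  square summable. Under the \<open>g\<close>-measure the contribution \<open>S j\<close> of the
  past fluctuates about its mean only on the scale of the square root of \<open>q j\<close>, the sum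
  of \<open>(b (n + j))^2\<close> over \<open>n\<close>, and \<open>q j \<le> B * b j\<close> is
  summable because \<open>b\<close> decreases. The chi-square bound involves squares of field
  differences, and their sum has finite mean for two independent typical pasts.

  The condition \<open>B < 1\<close> acts three times: it makes the total weight shrink, it keeps
  the total influence of one symbol finite, and it makes the renewal equation of the weights
  contract for squares. The shrinking is not by a fixed factor per step: weight sitting far back is
  untouched until it has travelled to position 0. Loss of memory therefore comes from a tightness
  argument.\<close>

lemma logistic_phi_tanh: "logistic_phi r = (1 + tanh r) / 2"
proof -
  have "exp (- r) + exp r \<noteq> 0"
    by (smt (verit) exp_gt_zero)
  then show ?thesis
    by (simp add: logistic_phi_def tanh_def sinh_def cosh_def field_simps)
qed

lemma tanh_deriv: "(tanh has_real_derivative 1 - (tanh x)\<^sup>2) (at x)" for x :: real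
  by (auto intro!: derivative_eq_intros)

lemma tanh_diff_le: "s \<le> r \<Longrightarrow> tanh r - tanh s \<le> r - (s :: real)"
proof -
  assume sr: "s \<le> r"
  have "s - tanh s \<le> r - tanh r"
  proof (rule DERIV_nonneg_imp_nondecreasing[OF sr])
    fix x :: real
    have "((\<lambda>x. x - tanh x) has_real_derivative 1 - (1 - (tanh x)\<^sup>2)) (at x)"
      by (intro DERIV_diff tanh_deriv DERIV_ident)
    then show "\<exists>y. ((\<lambda>x. x - tanh x) has_real_derivative y) (at x) \<and> 0 \<le> y"
      by (intro exI[of _ "1 - (1 - (tanh x)\<^sup>2)"]) auto
  qed
  then show ?thesis by linarith
qed

text \<open>On \<open>[-R, R]\<close> the slope \<open>1 - (tanh x)^2\<close> is smallest at the
  endpoints. This lower bound makes a change of the past detectable in the phase transition; the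
  contraction uses the upper bound 1.\<close>

lemma tanh_diff_ge:
  assumes "s \<le> r" "- R \<le> s" "r \<le> (R :: real)"
  shows "(1 - (tanh R)\<^sup>2) * (r - s) \<le> tanh r - tanh s"
proof -
  let ?k = "1 - (tanh R)\<^sup>2"
  have "tanh s - ?k * s \<le> tanh r - ?k * r"
  proof (rule DERIV_nonneg_imp_nondecreasing[OF assms(1)])
    fix x assume x: "s \<le> x" "x \<le> r"
    have "((\<lambda>x. tanh x - ?k * x) has_real_derivative (1 - (tanh x)\<^sup>2) - ?k * 1) (at x)"
      by (intro DERIV_diff tanh_deriv DERIV_cmult DERIV_ident)
    moreover have "(tanh x)\<^sup>2 \<le> (tanh R)\<^sup>2"
    proof (rule power2_le_iff_abs_le[THEN iffD2])
      have "\<bar>x\<bar> \<le> R" using x assms by simp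
      then have "tanh \<bar>x\<bar> \<le> tanh R" by (simp only: tanh_real_le_iff)
      then show "\<bar>tanh x\<bar> \<le> tanh R" by (simp only: tanh_real_abs)
      show "0 \<le> tanh R" using x assms by simp
    qed
    ultimately show "\<exists>y. ((\<lambda>x. tanh x - ?k * x) has_real_derivative y) (at x) \<and> 0 \<le> y"
      by (intro exI[of _ "(1 - (tanh x)\<^sup>2) - ?k * 1"]) auto
  qed
  then show ?thesis by (simp add: algebra_simps)
qed

lemma one_minus_tanh_square_pos: "0 < 1 - (tanh R)\<^sup>2" for R :: real
  using tanh_real_bounds[of R] abs_square_less_1[of "tanh R"] by auto

lemma logistic_phi_pos: "0 < logistic_phi r"
  using tanh_real_gt_neg1[of r] by (simp add: logistic_phi_tanh)

lemma logistic_phi_minus: "logistic_phi (- r) = 1 - logistic_phi r"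
  by (simp add: logistic_phi_tanh field_simps)

lemma logistic_phi_lt_1: "logistic_phi r < 1"
  using tanh_real_lt_1[of r] by (simp add: logistic_phi_tanh)

lemma logistic_phi_diff: "\<bar>logistic_phi r - logistic_phi s\<bar> \<le> \<bar>r - s\<bar> / 2"
proof -
  have *: "\<bar>tanh r - tanh s\<bar> \<le> \<bar>r - s\<bar>" if "s \<le> r" for r s :: real
    using tanh_diff_le[OF that] that by simp
  have "\<bar>tanh r - tanh s\<bar> \<le> \<bar>r - s\<bar>"
    using *[of s r] *[of r s] by linarith
  then show ?thesis
    by (simp add: logistic_phi_tanh diff_divide_distrib[symmetric])
qed

section \<open>Pasts and functions with summable weights\<close>

lemma pasts_iff: "v \<in> pasts \<longleftrightarrow> (\<forall>n. v n = 1 \<or> v n = -1)"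
  by (auto simp: pasts_def spins_def PiE_iff)

lemma configs_iff: "x \<in> configs \<longleftrightarrow> (\<forall>i. x i = 1 \<or> x i = -1)"
  by (auto simp: configs_def spins_def PiE_iff)

abbreviation push :: "real \<Rightarrow> (nat \<Rightarrow> real) \<Rightarrow> nat \<Rightarrow> real" where
  "push a v \<equiv> case_nat a v"

lemma push_in_pasts: "v \<in> pasts \<Longrightarrow> a = 1 \<or> a = -1 \<Longrightarrow> push a v \<in> pasts"
  by (auto simp: pasts_iff split: nat.split)

definition differ :: "(nat \<Rightarrow> real) \<Rightarrow> (nat \<Rightarrow> real) \<Rightarrow> nat \<Rightarrow> real" where
  "differ v w n = of_bool (v n \<noteq> w n)"

lemma differ_bounds: "0 \<le> differ v w n" "differ v w n \<le> 1"
  by (auto simp: differ_def)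

lemma summable_mult_differ:
  assumes "\<And>n. 0 \<le> c n" "summable c"
  shows "summable (\<lambda>n. c n * differ v w n)"
  using assms by (intro summable_comparison_test'[OF assms(2), of 0]) (auto simp: differ_def)

text \<open>The bound is required for all pairs of pasts, also for pairs that differ at infinitely
  many places. Oscillations under single changes would say nothing about functions of the remote
  past; the series form forces continuity.\<close>

definition lip :: "(nat \<Rightarrow> real) \<Rightarrow> ((nat \<Rightarrow> real) \<Rightarrow> real) \<Rightarrow> bool" where
  "lip c f \<longleftrightarrow> (\<forall>n. 0 \<le> c n) \<and> summable c \<and>
     (\<forall>v\<in>pasts. \<forall>w\<in>pasts. \<bar>f v - f w\<bar> \<le> (\<Sum>n. c n * differ v w n))"

lemma lipD:
  assumes "lip c f"
  shows "0 \<le> c n" "summable c"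
    "v \<in> pasts \<Longrightarrow> w \<in> pasts \<Longrightarrow> \<bar>f v - f w\<bar> \<le> (\<Sum>n. c n * differ v w n)"
  using assms by (auto simp: lip_def)

lemma lip_push:
  assumes "lip c f" "a = 1 \<or> a = -1" shows "lip (\<lambda>n. c (Suc n)) (\<lambda>v. f (push a v))"
proof -
  note c = lipD(1,2)[OF assms(1)]
  have "\<bar>f (push a v) - f (push a w)\<bar> \<le> (\<Sum>n. c (Suc n) * differ v w n)" if "v \<in> pasts" "w \<in> pasts" for v w
  proof -
    let ?d = "\<lambda>n. c n * differ (push a v) (push a w) n"
    have s: "summable ?d" by (rule summable_mult_differ[OF c])
    have "\<bar>f (push a v) - f (push a w)\<bar> \<le> suminf ?d"
      by (intro lipD(3)[OF assms(1)] push_in_pasts that assms(2))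
    also have "\<dots> = (\<Sum>n. ?d (Suc n)) + ?d 0" using suminf_split_head[OF s] by simp
    also have "\<dots> = (\<Sum>n. c (Suc n) * differ v w n)" by (simp add: differ_def)
    finally show ?thesis .
  qed
  then show ?thesis using c by (auto simp: lip_def summable_Suc_iff)
qed

lemma lip_osc:
  assumes "lip c f" "v \<in> pasts" "w \<in> pasts"
  shows "\<bar>f v - f w\<bar> \<le> suminf c"
proof -
  have "(\<Sum>n. c n * differ v w n) \<le> suminf c"
    using lipD(1,2)[OF assms(1)]
    by (intro suminf_le summable_mult_differ) (auto simp: differ_def)
  then show ?thesis using lipD(3)[OF assms] by linarith
qed

lemma pasts_ne: "(\<lambda>_. 1) \<in> pasts"
  by (simp add: pasts_iff)

text \<open>Of the power law the locale keeps the sign, the summability, the mass below 1 and the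
  monotonicity. The exponent returns in the final theorem, through the divergence of the sum of
  \<open>(t j)^2\<close>.\<close>

locale ising =
  fixes \<beta> :: "nat \<Rightarrow> real" and \<delta> :: real
  assumes beta_nonneg: "0 \<le> \<beta> (Suc n)"
    and beta_summable: "summable (\<lambda>n. \<beta> (Suc n))"
    and beta_sum: "(\<Sum>n. \<beta> (Suc n)) < 1"
    and beta_antimono: "\<beta> (Suc (Suc n)) \<le> \<beta> (Suc n)"
begin

definition b :: "nat \<Rightarrow> real" where "b n = \<beta> (Suc n)"

definition B :: real where "B = suminf b"

definition field :: "(nat \<Rightarrow> real) \<Rightarrow> real" where
  "field v = (\<Sum>n. b n * v n) + \<delta>"

definition T :: "((nat \<Rightarrow> real) \<Rightarrow> real) \<Rightarrow> (nat \<Rightarrow> real) \<Rightarrow> real" where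
  "T f v = logistic_phi (field v) * f (push 1 v) + logistic_phi (- field v) * f (push (-1) v)"

definition step :: "(nat \<Rightarrow> real) \<Rightarrow> nat \<Rightarrow> real" where
  "step c m = c (Suc m) + c 0 * b m"

lemma b_nonneg: "0 \<le> b n" and b_summable: "summable b" and B_lt_1: "B < 1"
  and b_Suc_le: "b (Suc n) \<le> b n"
  unfolding B_def b_def using beta_nonneg beta_summable beta_sum beta_antimono
  by (auto intro!: suminf_nonneg)

lemma kernel_push: "ising_kernel \<beta> \<delta> (push a v) = logistic_phi (a * field v)"
  by (simp add: ising_kernel_def field_def b_def algebra_simps)

lemma summable_b_mult:
  assumes "v \<in> pasts" shows "summable (\<lambda>n. b (n + j) * v n)"
proof (rule summable_comparison_test'[of "\<lambda>n. b (n + j)" 0])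
  show "summable (\<lambda>n. b (n + j))" by (rule summable_ignore_initial_segment[OF b_summable])
  fix n show "norm (b (n + j) * v n) \<le> b (n + j)"
    using assms b_nonneg[of "n + j"] by (cases "v n = 1") (auto simp: pasts_iff abs_mult)
qed

lemma field_bound: "v \<in> pasts \<Longrightarrow> \<bar>field v\<bar> \<le> 1 + \<bar>\<delta>\<bar>"
proof -
  assume v: "v \<in> pasts"
  have "norm (b n * v n) \<le> b n" for n
    using v b_nonneg[of n] by (auto simp: pasts_iff abs_mult dest: spec[of _ n])
  from norm_suminf_le[OF this b_summable]
  have "\<bar>\<Sum>n. b n * v n\<bar> \<le> B" by (simp add: B_def)
  then show ?thesis unfolding field_def using B_lt_1 by linarith
qed

lemma field_diff:
  assumes "v \<in> pasts" "w \<in> pasts"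
  shows "\<bar>field v - field w\<bar> \<le> 2 * (\<Sum>n. b n * differ v w n)"
proof -
  note s = summable_b_mult[OF assms(1), of 0, simplified] summable_b_mult[OF assms(2), of 0, simplified]
  have d: "summable (\<lambda>n. b n * differ v w n)"
    by (intro summable_mult_differ b_nonneg b_summable)
  have 1: "norm (b n * v n - b n * w n) \<le> 2 * (b n * differ v w n)" for n
    using assms b_nonneg[of n]
    by (auto simp: pasts_iff differ_def right_diff_distrib[symmetric] abs_mult dest!: spec[of _ n])
  have "field v - field w = (\<Sum>n. b n * v n - b n * w n)"
    unfolding field_def by (simp add: suminf_diff[OF s])
  also have "\<bar>\<dots>\<bar> \<le> (\<Sum>n. 2 * (b n * differ v w n))"
    using norm_suminf_le[OF 1 summable_mult[OF d]] by simp
  also have "\<dots> = 2 * (\<Sum>n. b n * differ v w n)" by (rule suminf_mult[OF d])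
  finally show ?thesis .
qed

lemma T_le:
  assumes "\<And>a. a = 1 \<or> a = -1 \<Longrightarrow> f (push a v) \<le> M" shows "T f v \<le> M"
proof -
  let ?p = "logistic_phi (field v)"
  have "?p * f (push 1 v) + (1 - ?p) * f (push (-1) v) \<le> ?p * M + (1 - ?p) * M"
    using logistic_phi_pos[of "field v"] logistic_phi_lt_1[of "field v"]
    by (intro add_mono mult_left_mono assms) auto
  then show ?thesis by (simp add: T_def logistic_phi_minus algebra_simps)
qed

lemma T_const: "T (\<lambda>_. c) v = c"
  by (simp add: T_def logistic_phi_minus algebra_simps)

lemma T_add: "T (\<lambda>u. f u + h u) v = T f v + T h v"
  by (simp add: T_def algebra_simps)

lemma T_cmult: "T (\<lambda>u. c * f u) v = c * T f v"
  by (simp add: T_def algebra_simps)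

lemma T_diff: "T (\<lambda>u. f u - h u) v = T f v - T h v"
  by (simp add: T_def algebra_simps)

lemma T_cong: "v \<in> pasts \<Longrightarrow> (\<And>u. u \<in> pasts \<Longrightarrow> f u = h u) \<Longrightarrow> T f v = T h v"
  by (simp add: T_def push_in_pasts)

lemma T_mono: "v \<in> pasts \<Longrightarrow> (\<And>u. u \<in> pasts \<Longrightarrow> f u \<le> h u) \<Longrightarrow> T f v \<le> T h v"
  unfolding T_def using logistic_phi_pos[of "field v"] logistic_phi_pos[of "- field v"]
  by (intro add_mono mult_left_mono) (auto simp: push_in_pasts)

lemma Tn_add: "(T ^^ n) (\<lambda>u. f u + h u) v = (T ^^ n) f v + (T ^^ n) h v"
proof (induction n arbitrary: v)
  case (Suc n)
  have "(T ^^ n) (\<lambda>u. f u + h u) = (\<lambda>u. (T ^^ n) f u + (T ^^ n) h u)" using Suc by auto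
  then show ?case by (simp add: T_add)
qed simp

lemma Tn_diff: "(T ^^ n) (\<lambda>u. f u - h u) v = (T ^^ n) f v - (T ^^ n) h v"
proof (induction n arbitrary: v)
  case (Suc n)
  have "(T ^^ n) (\<lambda>u. f u - h u) = (\<lambda>u. (T ^^ n) f u - (T ^^ n) h u)" using Suc by auto
  then show ?case by (simp add: T_diff)
qed simp

lemma Tn_const: "(T ^^ n) (\<lambda>_. c) = (\<lambda>_. c)"
  by (induction n) (auto simp: T_const)

lemma Tn_cong: "v \<in> pasts \<Longrightarrow> (\<And>u. u \<in> pasts \<Longrightarrow> f u = h u) \<Longrightarrow> (T ^^ n) f v = (T ^^ n) h v"
  by (induction n arbitrary: v) (auto intro!: T_cong)

text \<open>\<open>(T ^^ n) f v\<close> averages \<open>f\<close> over the pasts obtained from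
  \<open>v\<close> by adding \<open>n\<close> symbols, so the bound is asked only of pasts that
  agree with \<open>v\<close> behind their first \<open>n\<close> entries.\<close>

lemma Tn_le:
  assumes "v \<in> pasts" "\<And>u. u \<in> pasts \<Longrightarrow> (\<And>i. u (i + n) = v i) \<Longrightarrow> f u \<le> M"
  shows "(T ^^ n) f v \<le> M"
  using assms
proof (induction n arbitrary: v)
  case (Suc n)
  show ?case unfolding funpow.simps o_apply
  proof (rule T_le)
    fix a :: real assume a: "a = 1 \<or> a = -1"
    show "(T ^^ n) f (push a v) \<le> M"
    proof (rule Suc.IH[OF push_in_pasts[OF Suc.prems(1) a]])
      fix u assume u: "u \<in> pasts" "\<And>i. u (i + n) = push a v i"
      show "f u \<le> M" by (rule Suc.prems(2)[OF u(1)]) (use u(2)[of "Suc _"] in auto)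
    qed
  qed
qed auto

lemma Tn_uminus: "(T ^^ n) (\<lambda>u. - f u) v = - (T ^^ n) f v"
  using Tn_diff[of n "\<lambda>_. 0" f v] by (simp add: Tn_const)

lemma Tn_ge:
  assumes "v \<in> pasts" "\<And>u. u \<in> pasts \<Longrightarrow> (\<And>i. u (i + n) = v i) \<Longrightarrow> M \<le> f u"
  shows "M \<le> (T ^^ n) f v"
  using Tn_le[of v n "\<lambda>u. - f u" "- M"] assms by (simp add: Tn_uminus)

lemma Tn_unique_shift:
  assumes "v \<in> pasts" "\<And>u. u \<in> pasts \<Longrightarrow> (\<And>i. u (i + n) = v i) \<Longrightarrow> f u = M"
  shows "(T ^^ n) f v = M"
  using Tn_le[OF assms(1), of n f M] Tn_ge[OF assms(1), of n M f] assms(2) by force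

text \<open>Both values are averages over continuations, so the worst pair of continuations bounds
  the difference and no coupling of the two laws has to be constructed.\<close>

lemma Tn_pair:
  assumes v: "v \<in> pasts" "w \<in> pasts"
    and D: "\<And>u u'. u \<in> pasts \<Longrightarrow> u' \<in> pasts \<Longrightarrow> (\<And>i. u (i + n) = v i) \<Longrightarrow> (\<And>i. u' (i + n) = w i)
      \<Longrightarrow> \<bar>f u - f u'\<bar> \<le> D"
  shows "\<bar>(T ^^ n) f v - (T ^^ n) f w\<bar> \<le> D"
proof -
  \<comment> \<open>The continuation \<open>u\<close> of \<open>v\<close> is held fixed while those
    of \<open>w\<close> are averaged; averaging over \<open>u\<close> comes second.\<close>
  have 1: "f u - D \<le> (T ^^ n) f w \<and> (T ^^ n) f w \<le> f u + D"
    if u: "u \<in> pasts" "\<And>i. u (i + n) = v i" for u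
  proof -
    have "f u - D \<le> f u' \<and> f u' \<le> f u + D" if "u' \<in> pasts" "\<And>i. u' (i + n) = w i" for u'
      using D[OF u(1) that(1) u(2) that(2)] by (simp add: abs_le_iff)
    then show ?thesis
      using Tn_ge[OF v(2), of n "f u - D" f] Tn_le[OF v(2), of n f "f u + D"] by blast
  qed
  have "f u \<le> (T ^^ n) f w + D" "(T ^^ n) f w - D \<le> f u"
    if u: "u \<in> pasts" "\<And>i. u (i + n) = v i" for u
    using 1[OF that] by simp_all
  then have "(T ^^ n) f v \<le> (T ^^ n) f w + D" "(T ^^ n) f w - D \<le> (T ^^ n) f v"
    using Tn_ge[OF v(1), of n "(T ^^ n) f w - D" f] Tn_le[OF v(1), of n f "(T ^^ n) f w + D"] by blast+
  then show ?thesis by linarith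
qed

end

section \<open>Loss of memory\<close>

lemma tail_tendsto_0:
  fixes c :: "nat \<Rightarrow> real" assumes "summable c" shows "(\<lambda>K. \<Sum>n. c (n + K)) \<longlonglongrightarrow> 0"
proof -
  have "(\<lambda>K. suminf c - (\<Sum>i<K. c i)) \<longlonglongrightarrow> suminf c - suminf c"
    by (intro tendsto_intros summable_LIMSEQ assms)
  then show ?thesis by (simp add: suminf_minus_initial_segment[OF assms])
qed

context ising begin

section \<open>Evolution of the weights\<close>

definition weights :: "(nat \<Rightarrow> real) \<Rightarrow> bool" where
  "weights c \<longleftrightarrow> (\<forall>n. 0 \<le> c n) \<and> summable c"

lemma weights_step: "weights c \<Longrightarrow> weights (step c)"
  unfolding weights_def step_def
  by (auto intro!: add_nonneg_nonneg mult_nonneg_nonneg b_nonneg summable_add summable_mult b_summable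
      simp: summable_Suc_iff)

lemma weights_stepn: "weights c \<Longrightarrow> weights ((step ^^ n) c)"
  by (induction n) (auto intro: weights_step)

lemma lip_weights: "lip c f \<Longrightarrow> weights c"
  by (simp add: lip_def weights_def)

lemma lip_push_diff:
  assumes "lip c f" "v \<in> pasts" shows "\<bar>f (push 1 v) - f (push (-1) v)\<bar> \<le> c 0"
proof -
  have "\<bar>f (push 1 v) - f (push (-1) v)\<bar> \<le> (\<Sum>n. c n * differ (push 1 v) (push (-1) v) n)"
    by (intro lipD(3)[OF assms(1)] push_in_pasts assms(2)) auto
  also have "(\<lambda>n. c n * differ (push 1 v) (push (-1) v) n) = (\<lambda>n. if n = 0 then c 0 else 0)"
    by (auto simp: differ_def fun_eq_iff split: nat.split)
  also have "suminf \<dots> = c 0"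
    using suminf_finite[of "{0}" "\<lambda>n. if n = 0 then c 0 else 0"] by simp
  finally show ?thesis .
qed

lemma lip_T:
  assumes "lip c f" shows "lip (step c) (T f)"
proof -
  note c = lipD(1,2)[OF assms]
  have cS: "summable (\<lambda>n. c (Suc n))" using c(2) by (simp add: summable_Suc_iff)
  have "\<bar>T f v - T f w\<bar> \<le> (\<Sum>n. step c n * differ v w n)" if v: "v \<in> pasts" and w: "w \<in> pasts" for v w
  proof -
    define X where "X = (\<Sum>n. c (Suc n) * differ v w n)"
    define Y where "Y = (\<Sum>n. b n * differ v w n)"
    define p where "p = logistic_phi (field v)"
    define q where "q = logistic_phi (field w)"
    have p: "0 < p" "p < 1" unfolding p_def by (rule logistic_phi_pos logistic_phi_lt_1)+
    have sX: "summable (\<lambda>n. c (Suc n) * differ v w n)" and sY: "summable (\<lambda>n. b n * differ v w n)"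
      by (intro summable_mult_differ c cS b_nonneg b_summable)+
    have push: "\<bar>f (push a v) - f (push a w)\<bar> \<le> X" if "a = 1 \<or> a = -1" for a
      unfolding X_def by (rule lipD(3)[OF lip_push[OF assms that] v w])
    have pq: "\<bar>p - q\<bar> \<le> Y"
      using logistic_phi_diff[of "field v" "field w"] field_diff[OF v w] by (simp add: p_def q_def Y_def)
    \<comment> \<open>With the same symbol added on both sides only older symbols matter, which
      gives \<open>X\<close>. The mismatch \<open>p - q\<close> multiplies the effect of the new
      symbol, at most \<open>c 0\<close>; it is itself at most \<open>Y\<close>, as the slope
      \<open>1/2\<close> of the logistic function cancels the factor 2 of
      \<open>field_diff\<close>.\<close>
    have "T f v - T f w = p * (f (push 1 v) - f (push 1 w)) + (1 - p) * (f (push (-1) v) - f (push (-1) w))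
        + (p - q) * (f (push 1 w) - f (push (-1) w))"
      by (simp add: T_def logistic_phi_minus p_def q_def algebra_simps)
    also have "\<bar>\<dots>\<bar> \<le> p * X + (1 - p) * X + Y * c 0"
    proof (intro order_trans[OF abs_triangle_ineq] add_mono)
      show "\<bar>(p - q) * (f (push 1 w) - f (push (-1) w))\<bar> \<le> Y * c 0"
        unfolding abs_mult using pq lip_push_diff[OF assms w] by (intro mult_mono) auto
      show "\<bar>p * (f (push 1 v) - f (push 1 w))\<bar> \<le> p * X"
        unfolding abs_mult using p push[of 1] by (intro mult_mono) auto
      show "\<bar>(1 - p) * (f (push (-1) v) - f (push (-1) w))\<bar> \<le> (1 - p) * X"
        unfolding abs_mult using p push[of "-1"] by (intro mult_mono) auto
    qed
    also have "\<dots> = X + c 0 * Y" by (simp add: algebra_simps)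
    also have "\<dots> = (\<Sum>n. c (Suc n) * differ v w n + c 0 * (b n * differ v w n))"
      unfolding X_def Y_def suminf_mult[OF sY, symmetric] by (rule suminf_add[OF sX summable_mult[OF sY]])
    also have "\<dots> = (\<Sum>n. step c n * differ v w n)" by (simp add: step_def algebra_simps)
    finally show ?thesis .
  qed
  moreover have "weights (step c)" by (intro weights_step lip_weights[OF assms])
  ultimately show ?thesis by (auto simp: lip_def weights_def)
qed

lemma lip_Tn: "lip c f \<Longrightarrow> lip ((step ^^ n) c) ((T ^^ n) f)"
  by (induction n) (auto intro: lip_T)

text \<open>The weight at position 0 disappears when its symbol is integrated out and returns as
  \<open>c 0 * b\<close>, of mass \<open>B * c 0\<close>; all other weights only move.\<close>

lemma suminf_step:
  assumes "weights c" shows "suminf (step c) = suminf c - (1 - B) * c 0"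
proof -
  have "suminf (step c) = (\<Sum>n. c (Suc n)) + c 0 * B"
    unfolding step_def B_def using assms suminf_mult[OF b_summable, of "c 0"]
    by (subst suminf_add[symmetric]) (auto simp: weights_def summable_Suc_iff intro: summable_mult b_summable)
  then show ?thesis using suminf_split_head[of c] assms by (simp add: weights_def algebra_simps)
qed

text \<open>Each step destroys the mass \<open>1 - B\<close> times the current entry at position 0,
  and only \<open>suminf c\<close> is available in total.\<close>

lemma entry_summable:
  assumes "weights c" shows "summable (\<lambda>i. (step ^^ i) c 0)"
proof -
  have e0: "0 \<le> (step ^^ i) c 0" for i using weights_stepn[OF assms] by (simp add: weights_def)
  have 1: "(\<Sum>i<N. (step ^^ i) c 0) * (1 - B) = suminf c - suminf ((step ^^ N) c)" for N
    by (induction N) (auto simp: algebra_simps suminf_step weights_stepn[OF assms])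
  have "0 \<le> suminf ((step ^^ N) c)" for N
    using weights_stepn[OF assms, of N] by (auto simp: weights_def intro: suminf_nonneg)
  then have "(\<Sum>i<N. (step ^^ i) c 0) * (1 - B) \<le> suminf c" for N unfolding 1 by simp
  then have "(\<Sum>i<N. (step ^^ i) c 0) \<le> suminf c / (1 - B)" for N
    using B_lt_1 by (simp add: pos_le_divide_eq)
  then have "\<forall>N. (\<Sum>i<N. norm ((step ^^ i) c 0)) \<le> suminf c / (1 - B)" using e0 by simp
  then show ?thesis using bounded_imp_summable[of "\<lambda>i. (step ^^ i) c 0" "suminf c / (1 - B)"] e0
    by (metis (no_types, lifting) lessThan_Suc_atMost abs_of_nonneg real_norm_def sum.cong)
qed

text \<open>A weight moves towards position 0 and can only gain on the way, so an entry further back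
  is dominated by what arrives later.\<close>

lemma stepn_le_entry: "weights c \<Longrightarrow> (step ^^ N) c (i + j) \<le> (step ^^ (N + i)) c j"
proof (induction i arbitrary: j)
  case (Suc i)
  have "(step ^^ N) c (Suc i + j) \<le> (step ^^ (N + i)) c (Suc j)" using Suc(1)[of "Suc j"] Suc(2) by simp
  also have "\<dots> \<le> step ((step ^^ (N + i)) c) j"
    using weights_stepn[OF Suc(2), of "N + i"] b_nonneg[of j] by (simp add: step_def weights_def)
  finally show ?case by simp
qed simp

text \<open>Tightness: moving towards 0 cannot increase the mass beyond \<open>K\<close>, so that
  mass grows only by the tails of the reinjected multiples of \<open>b\<close>. Their total factor
  stays bounded in \<open>N\<close> by \<open>entry_summable\<close>.\<close>

lemma stepn_tail:
  assumes "weights c"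
  shows "(\<Sum>n. (step ^^ N) c (n + K)) \<le> (\<Sum>n. c (n + K)) + (\<Sum>i<N. (step ^^ i) c 0) * (\<Sum>n. b (n + K))"
proof (induction N)
  case (Suc N)
  let ?c = "(step ^^ N) c"
  have w: "weights ?c" by (rule weights_stepn[OF assms])
  have s: "summable (\<lambda>n. ?c (n + K))" "summable (\<lambda>n. b (n + K))"
    using w by (auto simp: weights_def intro!: summable_ignore_initial_segment b_summable)
  have sS: "summable (\<lambda>n. ?c (Suc (n + K)))" using s(1) summable_Suc_iff[of "\<lambda>n. ?c (n + K)"] by simp
  have "(\<Sum>n. step ?c (n + K)) = (\<Sum>n. ?c (Suc (n + K))) + ?c 0 * (\<Sum>n. b (n + K))"
    unfolding step_def[of ?c] suminf_mult[OF s(2), symmetric]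
    by (rule suminf_add[symmetric, OF sS summable_mult[OF s(2)]])
  moreover have "(\<Sum>n. ?c (Suc (n + K))) \<le> (\<Sum>n. ?c (n + K))"
    using suminf_split_head[OF s(1)] w by (simp add: weights_def)
  ultimately show ?case using Suc by (simp add: algebra_simps)
qed simp

text \<open>The mass beyond \<open>K\<close> is small uniformly in \<open>N\<close> by
  \<open>stepn_tail\<close>. Each of the remaining \<open>K\<close> entries vanishes in the limit,
  being dominated by a later entry at position 0, and those entries are summable.\<close>

lemma mass_tendsto_0:
  assumes "weights c" shows "(\<lambda>N. suminf ((step ^^ N) c)) \<longlonglongrightarrow> 0"
proof (rule LIMSEQ_I)
  fix e :: real assume e: "0 < e"
  let ?E = "\<Sum>i. (step ^^ i) c 0"
  have nn: "0 \<le> (step ^^ N) c i" and sm: "summable ((step ^^ N) c)" for N i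
    using weights_stepn[OF assms, of N] by (auto simp: weights_def)
  have "(\<lambda>K. (\<Sum>n. c (n + K)) + ?E * (\<Sum>n. b (n + K))) \<longlonglongrightarrow> 0 + ?E * 0"
    using assms by (intro tendsto_intros tail_tendsto_0 b_summable) (simp add: weights_def)
  then have "\<forall>\<^sub>F K in sequentially. (\<Sum>n. c (n + K)) + ?E * (\<Sum>n. b (n + K)) < e / 2"
    using e by (intro order_tendstoD(2)) auto
  then obtain K where K: "(\<Sum>n. c (n + K)) + ?E * (\<Sum>n. b (n + K)) < e / 2"
    by (auto simp: eventually_sequentially)
  have tail: "(\<Sum>n. (step ^^ N) c (n + K)) < e / 2" for N
  proof -
    have "(\<Sum>i<N. (step ^^ i) c 0) * (\<Sum>n. b (n + K)) \<le> ?E * (\<Sum>n. b (n + K))"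
      by (intro mult_right_mono sum_le_suminf entry_summable assms)
        (auto simp: nn intro!: suminf_nonneg summable_ignore_initial_segment b_summable b_nonneg)
    then show ?thesis using stepn_tail[OF assms, of N K] K by linarith
  qed
  have "(\<lambda>N. (step ^^ N) c i) \<longlonglongrightarrow> 0" for i
  proof (rule tendsto_sandwich[OF always_eventually always_eventually tendsto_const])
    show "\<forall>N. 0 \<le> (step ^^ N) c i" using nn by simp
    show "\<forall>N. (step ^^ N) c i \<le> (step ^^ (N + i)) c 0" using stepn_le_entry[OF assms, of _ i 0] by simp
    show "(\<lambda>N. (step ^^ (N + i)) c 0) \<longlonglongrightarrow> 0"
      by (rule LIMSEQ_ignore_initial_segment[OF summable_LIMSEQ_zero[OF entry_summable[OF assms]]])
  qed
  then have "(\<lambda>N. \<Sum>i<K. (step ^^ N) c i) \<longlonglongrightarrow> (\<Sum>i<K. 0)" by (intro tendsto_sum)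
  then have "\<forall>\<^sub>F N in sequentially. (\<Sum>i<K. (step ^^ N) c i) < e / 2"
    using e by (intro order_tendstoD(2)) auto
  then obtain N0 where "\<And>N. N \<ge> N0 \<Longrightarrow> (\<Sum>i<K. (step ^^ N) c i) < e / 2"
    by (auto simp: eventually_sequentially)
  then have "norm (suminf ((step ^^ N) c) - 0) < e" if "N \<ge> N0" for N
    using that tail[of N] suminf_split_initial_segment[OF sm, of N K] suminf_nonneg[OF sm nn, of N] by fastforce
  then show "\<exists>no. \<forall>n\<ge>no. norm (suminf ((step ^^ n) c) - 0) < e" by blast
qed

lemma Tn_osc:
  assumes "lip c f" "v \<in> pasts" "w \<in> pasts"
  shows "\<bar>(T ^^ n) f v - (T ^^ n) f w\<bar> \<le> suminf ((step ^^ n) c)"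
  by (rule lip_osc[OF lip_Tn[OF assms(1)] assms(2,3)])

section \<open>Variance and energy\<close>

lemma T_variance:
  assumes "lip c f" "v \<in> pasts"
  shows "T (\<lambda>u. (f u)\<^sup>2) v - (T f v)\<^sup>2 \<le> (c 0)\<^sup>2 / 4"
proof -
  define p where "p = logistic_phi (field v)"
  have p: "0 < p" "p < 1" unfolding p_def by (rule logistic_phi_pos logistic_phi_lt_1)+
  have "T (\<lambda>u. (f u)\<^sup>2) v - (T f v)\<^sup>2 = p * (1 - p) * (f (push 1 v) - f (push (-1) v))\<^sup>2"
    by (simp add: T_def logistic_phi_minus p_def[symmetric] power2_eq_square algebra_simps)
  also have "\<dots> \<le> 1 / 4 * (c 0)\<^sup>2"
  proof (intro mult_mono)
    have "0 \<le> (p - 1/2)\<^sup>2" by simp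
    then show "p * (1 - p) \<le> 1 / 4" by (simp add: power2_eq_square algebra_simps)
    show "(f (push 1 v) - f (push (-1) v))\<^sup>2 \<le> (c 0)\<^sup>2"
      using lip_push_diff[OF assms] abs_le_square_iff[of "f (push 1 v) - f (push (-1) v)" "c 0"] by fastforce
  qed auto
  finally show ?thesis by simp
qed

text \<open>Law of total variance: each step draws a two-point variable, whose variance is at most a
  quarter of its squared spread, and that spread is at most the current entry at position 0.\<close>

lemma Tn_variance:
  assumes "lip c f" "v \<in> pasts"
  shows "(T ^^ n) (\<lambda>u. (f u)\<^sup>2) v - ((T ^^ n) f v)\<^sup>2 \<le> (\<Sum>i<n. ((step ^^ i) c 0)\<^sup>2) / 4"
  using assms(2)
proof (induction n arbitrary: v)
  case (Suc n)
  let ?S = "\<lambda>n. (\<Sum>i<n. ((step ^^ i) c 0)\<^sup>2) / 4"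
  have "T ((T ^^ n) (\<lambda>u. (f u)\<^sup>2)) v \<le> T (\<lambda>u. ((T ^^ n) f u)\<^sup>2 + ?S n) v"
  proof (rule T_mono[OF Suc.prems])
    fix u assume "u \<in> pasts"
    from Suc.IH[OF this] show "(T ^^ n) (\<lambda>u. (f u)\<^sup>2) u \<le> ((T ^^ n) f u)\<^sup>2 + ?S n" by linarith
  qed
  also have "\<dots> = T (\<lambda>u. ((T ^^ n) f u)\<^sup>2) v + ?S n" by (simp add: T_add T_const)
  finally show ?case
    using T_variance[OF lip_Tn[OF assms(1), of n] Suc.prems] by (simp add: add_divide_distrib)
qed simp

text \<open>For \<open>m = 0\<close> this is a renewal equation with kernel \<open>b\<close>: the
  current entry is the original weight that has just arrived plus the returns of all earlier
  entries.\<close>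

lemma stepn_closed:
  "(step ^^ i) c m = c (m + i) + (\<Sum>l<i. (step ^^ l) c 0 * b (m + i - 1 - l))"
proof (induction i arbitrary: m)
  case (Suc i)
  have "(step ^^ Suc i) c m = (step ^^ i) c (Suc m) + (step ^^ i) c 0 * b m" by (simp add: step_def)
  then show ?case using Suc[of "Suc m"] by simp
qed simp

lemma sum_b_le: "(\<Sum>i<n. if l < i then b (i - 1 - l) else 0) \<le> B"
proof -
  have "(\<Sum>i<n. if l < i then b (i - 1 - l) else 0) = (\<Sum>k<n - 1 - l. b k)"
  proof (induction n)
    case (Suc n)
    show ?case
    proof (cases "l < n")
      case True
      then have "Suc n - 1 - l = Suc (n - 1 - l)" by simp
      then show ?thesis using Suc True by simp
    qed (use Suc in simp)
  qed simp
  also have "\<dots> \<le> B" unfolding B_def by (intro sum_le_suminf b_summable) (auto simp: b_nonneg)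
  finally show ?thesis .
qed

text \<open>Convexity turns the renewal equation for the entries into one for their squares.\<close>

lemma energy_bound:
  "(1 - B)\<^sup>2 * (\<Sum>i<n. ((step ^^ i) c 0)\<^sup>2) \<le> (\<Sum>i<n. (c i)\<^sup>2)"
proof -
  define e where "e i = (step ^^ i) c 0" for i
  have B: "0 < 1 - B" using B_lt_1 by simp
  have e_sq: "(e i)\<^sup>2 \<le> (c i)\<^sup>2 / (1 - B) + (\<Sum>l<i. b (i - 1 - l) * (e l)\<^sup>2)" for i
  proof -
    define W where "W = (\<Sum>l<i. b (i - 1 - l))"
    have W: "W \<le> B"
    proof -
      have "W = (\<Sum>l<i. b l)" unfolding W_def by (simp add: sum.nat_diff_reindex flip: diff_Suc_eq_diff_pred)
      also have "\<dots> \<le> B" unfolding B_def by (intro sum_le_suminf b_summable) (auto simp: b_nonneg)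
      finally show ?thesis .
    qed
    have ei: "e i = c i + (\<Sum>l<i. b (i - 1 - l) * e l)"
      using stepn_closed[of i c 0] by (simp add: e_def mult.commute)
    have x_eq: "x * (2 * e i * (c i / x) - (e i)\<^sup>2) = 2 * e i * c i - x * (e i)\<^sup>2"
      "x * (c i / x)\<^sup>2 = (c i)\<^sup>2 / x" if "x \<noteq> 0" for x
      using that by (simp_all add: power2_eq_square right_diff_distrib)
    \<comment> \<open>Used under the weights \<open>b (i - 1 - l)\<close> with
      \<open>y = e l\<close>, and under the weight \<open>1 - B\<close> with
      \<open>y = c i / (1 - B)\<close>. These weights total at most 1, which is the convexity;
      giving the source term the leftover weight costs a factor \<open>1 / (1 - B)\<close>.\<close>
    have young: "2 * e i * y - (e i)\<^sup>2 \<le> y\<^sup>2" for y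
      using zero_le_power2[of "y - e i"] by (simp add: power2_diff algebra_simps)
    have "(\<Sum>l<i. b (i - 1 - l) * (2 * e i * e l - (e i)\<^sup>2)) \<le> (\<Sum>l<i. b (i - 1 - l) * (e l)\<^sup>2)"
      by (intro sum_mono mult_left_mono young b_nonneg)
    moreover have "(\<Sum>l<i. b (i - 1 - l) * (2 * e i * e l - (e i)\<^sup>2)) = 2 * e i * (e i - c i) - W * (e i)\<^sup>2"
      unfolding ei[THEN arg_cong[where f="\<lambda>z. z - c i"], simplified] W_def
      by (simp add: sum_distrib_left sum_distrib_right algebra_simps sum_subtractf)
    moreover have "(1 - B) * (2 * e i * (c i / (1 - B)) - (e i)\<^sup>2) \<le> (1 - B) * (c i / (1 - B))\<^sup>2"
      using B by (intro mult_left_mono young) auto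
    moreover have "(1 - B) * (2 * e i * (c i / (1 - B)) - (e i)\<^sup>2) = 2 * e i * c i - (1 - B) * (e i)\<^sup>2"
      "(1 - B) * (c i / (1 - B))\<^sup>2 = (c i)\<^sup>2 / (1 - B)"
      using x_eq[of "1 - B"] B by simp_all
    moreover have "W * (e i)\<^sup>2 \<le> B * (e i)\<^sup>2" using W by (intro mult_right_mono) auto
    moreover have "(1 - B) * (e i)\<^sup>2 = (e i)\<^sup>2 - B * (e i)\<^sup>2" "2 * e i * (e i - c i) = 2 * (e i)\<^sup>2 - 2 * e i * c i"
      by (simp_all add: algebra_simps power2_eq_square)
    ultimately show ?thesis by linarith
  qed
  \<comment> \<open>Exchanging the sums leaves each \<open>(e l)^2\<close> with a coefficient at
    most \<open>B\<close>, which the left side absorbs; this produces the second factor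
    \<open>1 - B\<close>.\<close>
  have "(\<Sum>i<n. \<Sum>l<i. b (i - 1 - l) * (e l)\<^sup>2) = (\<Sum>i<n. \<Sum>l<n. (if l < i then b (i - 1 - l) else 0) * (e l)\<^sup>2)"
  proof (rule sum.cong[OF refl])
    fix i assume "i \<in> {..<n}"
    then show "(\<Sum>l<i. b (i - 1 - l) * (e l)\<^sup>2) = (\<Sum>l<n. (if l < i then b (i - 1 - l) else 0) * (e l)\<^sup>2)"
      by (intro sum.mono_neutral_cong_left) auto
  qed
  also have "\<dots> = (\<Sum>l<n. (\<Sum>i<n. if l < i then b (i - 1 - l) else 0) * (e l)\<^sup>2)"
    by (subst sum.swap) (simp add: sum_distrib_right)
  also have "\<dots> \<le> (\<Sum>l<n. B * (e l)\<^sup>2)" by (intro sum_mono mult_right_mono sum_b_le) auto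
  finally have conv: "(\<Sum>i<n. \<Sum>l<i. b (i - 1 - l) * (e l)\<^sup>2) \<le> B * (\<Sum>l<n. (e l)\<^sup>2)"
    by (simp add: sum_distrib_left)
  have "(\<Sum>i<n. (e i)\<^sup>2) \<le> (\<Sum>i<n. (c i)\<^sup>2 / (1 - B) + (\<Sum>l<i. b (i - 1 - l) * (e l)\<^sup>2))"
    by (intro sum_mono e_sq)
  also have "\<dots> \<le> (\<Sum>i<n. (c i)\<^sup>2) / (1 - B) + B * (\<Sum>l<n. (e l)\<^sup>2)"
    using conv by (simp add: sum.distrib sum_divide_distrib)
  finally have "(1 - B) * (\<Sum>i<n. (e i)\<^sup>2) \<le> (\<Sum>i<n. (c i)\<^sup>2) / (1 - B)" by (simp add: algebra_simps)
  then have "(1 - B) * ((1 - B) * (\<Sum>i<n. (e i)\<^sup>2)) \<le> (\<Sum>i<n. (c i)\<^sup>2)"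
    using B by (simp add: pos_le_divide_eq mult.commute)
  then show ?thesis by (simp add: e_def power2_eq_square mult.assoc)
qed

end

section \<open>Comparison of two pasts\<close>

definition local_fun :: "nat \<Rightarrow> ((nat \<Rightarrow> real) \<Rightarrow> real) \<Rightarrow> bool" where
  "local_fun r f \<longleftrightarrow> (\<forall>v\<in>pasts. \<forall>w\<in>pasts. (\<forall>i<r. v i = w i) \<longrightarrow> f v = f w)"

context ising begin

text \<open>The difference of the fields after \<open>j\<close> common symbols have been added to
  \<open>u\<close> and \<open>w\<close>. The common symbols cancel, so it does not depend on which
  ones were drawn.\<close>

definition gap :: "nat \<Rightarrow> (nat \<Rightarrow> real) \<Rightarrow> (nat \<Rightarrow> real) \<Rightarrow> real" where
  "gap j u w = (\<Sum>n. b (n + j) * (u n - w n))"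

text \<open>Reciprocal of a lower bound for the slope of \<open>tanh\<close> over all values of the
  field. It bounds \<open>1 / (4 * (q * (1 - q)))\<close> for a conditional probability
  \<open>q\<close>, and in the phase transition it turns differences of fields into differences of
  conditional means.\<close>

definition K :: real where "K = 1 / (1 - (tanh (1 + \<bar>\<delta>\<bar>))\<^sup>2)"

lemma K_pos: "0 < K"
  unfolding K_def using one_minus_tanh_square_pos by simp

lemma summable_gap:
  assumes "u \<in> pasts" "w \<in> pasts" shows "summable (\<lambda>n. b (n + j) * (u n - w n))"
  using summable_diff[OF summable_b_mult[OF assms(1)] summable_b_mult[OF assms(2)], of j j]
  by (simp add: right_diff_distrib)

lemma field_gap: "u \<in> pasts \<Longrightarrow> w \<in> pasts \<Longrightarrow> field u - field w = gap 0 u w"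
  unfolding field_def gap_def
  using suminf_diff[OF summable_b_mult[of u 0] summable_b_mult[of w 0]] by (simp add: right_diff_distrib)

lemma gap_push:
  assumes "u \<in> pasts" "w \<in> pasts" "a = 1 \<or> a = -1"
  shows "gap j (push a u) (push a w) = gap (Suc j) u w"
  unfolding gap_def
  using suminf_split_head[OF summable_gap[OF push_in_pasts push_in_pasts, OF assms(1,3,2,3), of j]] by simp

text \<open>The left side is one plus the chi-square divergence
  \<open>(p - q)^2 / (q * (1 - q))\<close> of two two-point laws. In exponential form the factors of
  successive symbols multiply to the exponential of a sum.\<close>

lemma chi_square_step:
  assumes "u \<in> pasts" "w \<in> pasts"
  defines "p \<equiv> logistic_phi (field u)" and "q \<equiv> logistic_phi (field w)"
  shows "p\<^sup>2 / q + (1 - p)\<^sup>2 / (1 - q) \<le> exp (K * (gap 0 u w)\<^sup>2)"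
proof -
  define R where "R = 1 + \<bar>\<delta>\<bar>"
  have q: "0 < q" "q < 1" unfolding q_def by (rule logistic_phi_pos logistic_phi_lt_1)+
  have th: "(tanh (field w))\<^sup>2 \<le> (tanh R)\<^sup>2"
  proof (rule power2_le_iff_abs_le[THEN iffD2])
    have "tanh \<bar>field w\<bar> \<le> tanh R" using field_bound[OF assms(2)] by (simp only: tanh_real_le_iff R_def)
    then show "\<bar>tanh (field w)\<bar> \<le> tanh R" by (simp only: tanh_real_abs)
    show "0 \<le> tanh R" by (simp add: R_def)
  qed
  have qq: "4 * (q * (1 - q)) = 1 - (tanh (field w))\<^sup>2"
    by (simp add: q_def logistic_phi_tanh power2_eq_square field_simps)
  have Kq: "1 / (4 * (q * (1 - q))) \<le> K"
    unfolding qq K_def R_def[symmetric] using th one_minus_tanh_square_pos by (intro divide_left_mono) auto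
  have pq: "(p - q)\<^sup>2 \<le> (gap 0 u w)\<^sup>2 / 4"
    using logistic_phi_diff[of "field u" "field w"] abs_le_square_iff[of "p - q" "gap 0 u w / 2"]
    by (simp add: p_def q_def field_gap[OF assms(1,2)] power_divide)
  have "p\<^sup>2 / q + (1 - p)\<^sup>2 / (1 - q) = 1 + (p - q)\<^sup>2 / (q * (1 - q))"
    using q by (simp add: field_simps power2_eq_square)
  also have "(p - q)\<^sup>2 / (q * (1 - q)) \<le> (gap 0 u w)\<^sup>2 / 4 / (q * (1 - q))"
    using pq q by (intro divide_right_mono) auto
  also have "\<dots> = 1 / (4 * (q * (1 - q))) * (gap 0 u w)\<^sup>2" by simp
  also have "\<dots> \<le> K * (gap 0 u w)\<^sup>2" using Kq by (rule mult_right_mono) auto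
  finally show ?thesis using exp_ge_add_one_self[of "K * (gap 0 u w)\<^sup>2"] by linarith
qed

text \<open>
  With \<open>t = 1\<close> this bounds the total variation between the laws of the next \<open>N\<close> symbols by their
  chi-square divergence; the free factor \<open>t\<close> carries the likelihood ratio of the symbols
  already drawn, which makes the induction work.
\<close>

lemma Tn_chi_square:
  assumes "u \<in> pasts" "w \<in> pasts" "0 < \<eta>"
    and "\<And>v. v \<in> pasts \<Longrightarrow> \<bar>f v\<bar> \<le> 1"
    and "\<And>v v'. v \<in> pasts \<Longrightarrow> v' \<in> pasts \<Longrightarrow> (\<And>i. i < N \<Longrightarrow> v i = v' i) \<Longrightarrow> (\<And>i. v (i + N) = u i)
      \<Longrightarrow> (\<And>i. v' (i + N) = w i) \<Longrightarrow> f v = f v'"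
  shows "t * (T ^^ N) f u - (T ^^ N) f w \<le>
    \<eta> / 2 + (t\<^sup>2 * exp (K * (\<Sum>j<N. (gap j u w)\<^sup>2)) - 2 * t + 1) / (2 * \<eta>)"
  using assms(1,2,5)
proof (induction N arbitrary: u w t)
  case 0
  have "f u = f w" using 0 by auto
  then have "t * f u - f w = (t - 1) * f u" by (simp add: algebra_simps)
  also have "\<dots> \<le> \<bar>t - 1\<bar>"
    using mult_left_mono[OF assms(4)[OF 0(1)], of "\<bar>t - 1\<bar>"] abs_ge_self[of "(t - 1) * f u"]
    by (simp add: abs_mult)
  \<comment> \<open>Young's inequality replaces the absolute value by a quadratic in
    \<open>t\<close>, and a quadratic can be carried through the induction.\<close>
  also have "\<dots> \<le> \<eta> / 2 + (t - 1)\<^sup>2 / (2 * \<eta>)"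
  proof -
    have "0 \<le> (\<bar>t - 1\<bar> - \<eta>)\<^sup>2" by simp
    then have "2 * \<eta> * \<bar>t - 1\<bar> \<le> \<eta>\<^sup>2 + (t - 1)\<^sup>2" by (simp add: power2_diff algebra_simps)
    then have "\<bar>t - 1\<bar> \<le> (\<eta>\<^sup>2 + (t - 1)\<^sup>2) / (2 * \<eta>)" using assms(3) by (simp add: field_simps)
    also have "\<dots> = \<eta> / 2 + (t - 1)\<^sup>2 / (2 * \<eta>)" using assms(3) by (simp add: field_simps power2_eq_square)
    finally show ?thesis .
  qed
  also have "(t - 1)\<^sup>2 = t\<^sup>2 - 2 * t + 1" by (simp add: power2_diff)
  finally show ?case by simp
next
  case (Suc N)
  define p where "p = logistic_phi (field u)"
  define q where "q = logistic_phi (field w)"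
  have q: "0 < q" "q < 1" unfolding q_def by (rule logistic_phi_pos logistic_phi_lt_1)+
  define E where "E = exp (K * (\<Sum>j<N. (gap (Suc j) u w)\<^sup>2))"
  define X where "X s = \<eta> / 2 + (s\<^sup>2 * E - 2 * s + 1) / (2 * \<eta>)" for s
  have IH: "s * (T ^^ N) f (push a u) - (T ^^ N) f (push a w) \<le> X s" if a: "a = 1 \<or> a = -1" for a s
    unfolding X_def E_def gap_push[OF Suc.prems(1,2) a, symmetric]
  proof (rule Suc.IH)
    fix v v' assume v: "v \<in> pasts" "v' \<in> pasts" "\<And>i. i < N \<Longrightarrow> v i = v' i"
      and vu: "\<And>i. v (i + N) = push a u i" and vw: "\<And>i. v' (i + N) = push a w i"
    show "f v = f v'"
    proof (rule Suc.prems(3)[OF v(1,2)])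
      fix i assume "i < Suc N"
      \<comment> \<open>The entry at position \<open>N\<close> is the common symbol
        \<open>a\<close>, which supplies the additional agreement.\<close>
      then show "v i = v' i" using v(3)[of i] vu[of 0] vw[of 0] by (cases "i = N") auto
    next
      fix i show "v (i + Suc N) = u i" "v' (i + Suc N) = w i" using vu[of "Suc i"] vw[of "Suc i"] by simp_all
    qed
  qed (use a Suc.prems in \<open>auto intro: push_in_pasts\<close>)
  let ?P = "(T ^^ N) f (push 1 u)" and ?M = "(T ^^ N) f (push (-1) u)"
  let ?P' = "(T ^^ N) f (push 1 w)" and ?M' = "(T ^^ N) f (push (-1) w)"
  have "t * (T ^^ Suc N) f u - (T ^^ Suc N) f w
      = q * (t * p / q * ?P - ?P') + (1 - q) * (t * (1 - p) / (1 - q) * ?M - ?M')"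
    using q by (simp add: T_def p_def[symmetric] q_def[symmetric] logistic_phi_minus field_simps)
  also have "\<dots> \<le> q * X (t * p / q) + (1 - q) * X (t * (1 - p) / (1 - q))"
    using q IH[of 1 "t * p / q"] IH[of "-1" "t * (1 - p) / (1 - q)"] by (intro add_mono mult_left_mono) auto
  also have "\<dots> = \<eta> / 2 + (q * ((t * p / q)\<^sup>2 * E - 2 * (t * p / q) + 1)
       + (1 - q) * ((t * (1 - p) / (1 - q))\<^sup>2 * E - 2 * (t * (1 - p) / (1 - q)) + 1)) / (2 * \<eta>)"
    using assms(3) by (simp add: X_def field_simps)
  \<comment> \<open>The likelihood ratio becomes \<open>t * p / q\<close> or
    \<open>t * (1 - p) / (1 - q)\<close>. Its mean under the law with parameter \<open>q\<close> is
    again \<open>t\<close>, so the linear term is unchanged and only the second moment gains a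
    factor.\<close>
  also have "q * ((t * p / q)\<^sup>2 * E - 2 * (t * p / q) + 1)
       + (1 - q) * ((t * (1 - p) / (1 - q))\<^sup>2 * E - 2 * (t * (1 - p) / (1 - q)) + 1)
      = t\<^sup>2 * ((p\<^sup>2 / q + (1 - p)\<^sup>2 / (1 - q)) * E) - 2 * t + 1"
    using q by (simp add: power2_eq_square divide_simps) (simp add: algebra_simps)
  also have "(p\<^sup>2 / q + (1 - p)\<^sup>2 / (1 - q)) * E \<le> exp (K * (\<Sum>j<Suc N. (gap j u w)\<^sup>2))"
  proof -
    have "(p\<^sup>2 / q + (1 - p)\<^sup>2 / (1 - q)) * E \<le> exp (K * (gap 0 u w)\<^sup>2) * E"
      using chi_square_step[OF Suc.prems(1,2)] by (intro mult_right_mono) (auto simp: p_def q_def E_def)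
    also have "\<dots> = exp (K * (\<Sum>j<Suc N. (gap j u w)\<^sup>2))"
      unfolding E_def exp_add[symmetric] sum.lessThan_Suc_shift by (simp add: algebra_simps)
    finally show ?thesis .
  qed
  finally show ?case using assms(3) by (simp add: divide_right_mono mult_left_mono)
qed

section \<open>Influence of finitely many symbols on the distant future\<close>

definition impulse :: "nat \<Rightarrow> nat \<Rightarrow> real" where "impulse l i = of_bool (i = l)"

definition block :: "nat \<Rightarrow> nat \<Rightarrow> real" where "block r i = of_bool (i < r)"

text \<open>The renewal sequence of the kernel \<open>b\<close>: it starts with 1, and each later
  term convolves \<open>b\<close> with the earlier ones. It bounds the influence of a symbol on the
  one drawn \<open>n\<close> steps later.\<close>

definition \<rho> :: "nat \<Rightarrow> real" where "\<rho> n = (step ^^ n) (impulse 0) 0"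

lemma weights_impulse: "weights (impulse l)"
  unfolding weights_def impulse_def
  by (auto intro!: summable_finite[of "{l}"])

lemma weights_block: "weights (block r)"
  unfolding weights_def block_def
  by (auto intro!: summable_finite[of "{..<r}"])

lemma \<rho>_nonneg: "0 \<le> \<rho> n" and \<rho>_summable: "summable \<rho>"
  unfolding \<rho>_def using weights_stepn[OF weights_impulse] entry_summable[OF weights_impulse]
  by (auto simp: weights_def)

lemma step_add: "(step ^^ n) (\<lambda>i. c i + d i) = (\<lambda>i. (step ^^ n) c i + (step ^^ n) d i)"
  by (induction n) (auto simp: step_def algebra_simps fun_eq_iff)

text \<open>Because \<open>b\<close> decreases, a decreasing weight sequence stays decreasing, so
  its entry at position 0 dominates the others.\<close>

lemma stepn_impulse: "(step ^^ n) (impulse 0) i \<le> \<rho> n"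
proof -
  have "(step ^^ n) (impulse 0) (Suc i) \<le> (step ^^ n) (impulse 0) i" for i
  proof (induction n arbitrary: i)
    case 0 then show ?case by (simp add: impulse_def)
  next
    case (Suc n)
    have "0 \<le> (step ^^ n) (impulse 0) 0" using weights_stepn[OF weights_impulse] by (simp add: weights_def)
    then show ?case unfolding funpow.simps o_apply step_def[of "(step ^^ n) (impulse 0)"]
      by (intro add_mono Suc mult_left_mono b_Suc_le)
  qed
  then have "decseq ((step ^^ n) (impulse 0))" by (intro decseq_SucI)
  then show ?thesis unfolding \<rho>_def by (auto dest: decseqD)
qed

lemma step_impulse: "(step ^^ l) (impulse l) = impulse 0"
proof (induction l)
  case (Suc l)
  have "step (impulse (Suc l)) = impulse l" by (auto simp: step_def impulse_def)
  then show ?case using Suc by (simp add: funpow_swap1)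
qed simp

text \<open>The block is split into single symbols. The weight at position \<open>l\<close> needs
  \<open>l\<close> steps to reach position 0, which leaves \<open>r + N - l\<close> steps of
  renewal, that is, the indices from \<open>N + 1\<close> to \<open>N + r\<close>.\<close>

lemma stepn_block: "(step ^^ (r + N)) (block r) i \<le> (\<Sum>k<r. \<rho> (N + 1 + k))"
proof (induction r arbitrary: N)
  case 0
  have "(step ^^ N) (\<lambda>_. 0) = (\<lambda>_. 0)" for N by (induction N) (auto simp: step_def)
  then show ?case by (simp add: block_def[abs_def])
next
  case (Suc r)
  have "block (Suc r) = (\<lambda>i. block r i + impulse r i)" by (auto simp: block_def impulse_def)
  then have "(step ^^ (Suc r + N)) (block (Suc r)) i
      = (step ^^ (r + Suc N)) (block r) i + (step ^^ (Suc N + r)) (impulse r) i"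
    by (simp only: step_add) (simp add: add.commute)
  also have "(step ^^ (Suc N + r)) (impulse r) i \<le> \<rho> (Suc N)"
    unfolding funpow_add o_apply step_impulse by (rule stepn_impulse)
  also have "(step ^^ (r + Suc N)) (block r) i \<le> (\<Sum>k<r. \<rho> (Suc N + 1 + k))" by (rule Suc)
  finally show ?case by (simp add: sum.lessThan_Suc_shift del: sum.lessThan_Suc)
qed

text \<open>The summed influence of one symbol on everything more than \<open>N\<close> steps later.
  It bounds the block weights uniformly in the length \<open>r\<close> of the observed
  future.\<close>

definition \<tau> :: "nat \<Rightarrow> real" where "\<tau> N = (\<Sum>k. \<rho> (k + (N + 1)))"

lemma \<tau>_nonneg: "0 \<le> \<tau> N"
  unfolding \<tau>_def by (intro suminf_nonneg summable_ignore_initial_segment \<rho>_summable \<rho>_nonneg)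

lemma \<tau>_tendsto: "\<tau> \<longlonglongrightarrow> 0"
  unfolding \<tau>_def using LIMSEQ_ignore_initial_segment[OF tail_tendsto_0[OF \<rho>_summable], of 1] by simp

lemma stepn_block_le: "(step ^^ (r + N)) (block r) i \<le> \<tau> N"
proof -
  have "(\<Sum>k<r. \<rho> (N + 1 + k)) = (\<Sum>k<r. \<rho> (k + (N + 1)))" by (simp add: add.commute)
  also have "\<dots> \<le> \<tau> N"
    unfolding \<tau>_def by (intro sum_le_suminf summable_ignore_initial_segment \<rho>_summable) (auto simp: \<rho>_nonneg)
  finally show ?thesis using stepn_block[of r N i] by linarith
qed

lemma lip_local:
  assumes "local_fun r f" "\<And>v. v \<in> pasts \<Longrightarrow> 0 \<le> f v" "\<And>v. v \<in> pasts \<Longrightarrow> f v \<le> 1"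
  shows "lip (block r) f"
proof -
  have "\<bar>f v - f w\<bar> \<le> (\<Sum>n. block r n * differ v w n)" if v: "v \<in> pasts" "w \<in> pasts" for v w
  proof (cases "\<forall>i<r. v i = w i")
    case True
    then have "f v = f w" using assms(1) v unfolding local_fun_def by blast
    moreover have "block r n * differ v w n = 0" for n
      using spec[OF True, of n] by (cases "n < r") (simp_all add: block_def differ_def)
    then have "(\<lambda>n. block r n * differ v w n) = (\<lambda>_. 0)" by (rule ext)
    ultimately show ?thesis by (simp only:) simp
  next
    case False
    then obtain i where i: "i < r" "v i \<noteq> w i" by auto
    have "\<bar>f v - f w\<bar> \<le> 1" using assms(2,3)[OF v(1)] assms(2,3)[OF v(2)] by linarith
    also have "1 = (\<Sum>n\<in>{i}. block r n * differ v w n)" using i by (simp add: block_def differ_def)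
    also have "\<dots> \<le> (\<Sum>n. block r n * differ v w n)"
      by (rule sum_le_suminf[OF summable_mult_differ]) (use weights_block[of r] in \<open>simp_all add: weights_def differ_def\<close>)
    finally show ?thesis .
  qed
  then show ?thesis using weights_block by (auto simp: lip_def weights_def)
qed

text \<open>Up to 1 the exponential has a linear bound, and beyond 1 the trivial bound
  \<open>d \<le> 1\<close> suffices. Linearity in \<open>x\<close> matters because the later
  estimate concerns the mean of the squared gaps and not that of their exponential.\<close>

lemma exp_min_bound:
  assumes "0 < \<eta>" "\<eta> \<le> 1" "0 \<le> x" "d \<le> 1" "d \<le> \<eta> / 2 + (exp x - 1) / (2 * \<eta>)"
  shows "d \<le> \<eta> / 2 + x / (\<eta> :: real)"
proof (cases "x \<le> 1")
  case True
  have "exp x \<le> 1 + x + x\<^sup>2" using True assms(3) by (intro exp_bound) auto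
  also have "x\<^sup>2 \<le> x" using True assms(3) by (simp add: power2_eq_square mult_left_le)
  finally have "(exp x - 1) / (2 * \<eta>) \<le> (2 * x) / (2 * \<eta>)" using assms(1) by (intro divide_right_mono) auto
  then show ?thesis using assms(1,5) by simp
next
  case False
  have "1 \<le> x / \<eta>" using False assms(1,2) by (simp add: pos_le_divide_eq)
  then show ?thesis using assms(1,4) by linarith
qed

lemma mixing_bound:
  assumes f: "local_fun r f" "\<And>v. v \<in> pasts \<Longrightarrow> 0 \<le> f v" "\<And>v. v \<in> pasts \<Longrightarrow> f v \<le> 1"
    and v: "v \<in> pasts" and w: "w \<in> pasts" and \<eta>: "0 < \<eta>" "\<eta> \<le> 1"
  shows "\<bar>(T ^^ (k + (r + N))) f v - (T ^^ (k + (r + N))) f w\<bar>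
    \<le> \<eta> / 2 + K * (\<Sum>j<r + N. (gap (j + k) v w)\<^sup>2) / \<eta> + real k * \<tau> N"
  unfolding funpow_add[of k "r + N"] o_apply
proof (rule Tn_pair[OF v w])
  fix u u' assume u: "u \<in> pasts" "u' \<in> pasts" and uv: "\<And>i. u (i + k) = v i" and uw: "\<And>i. u' (i + k) = w i"
  let ?G = "(T ^^ (r + N)) f"
  \<comment> \<open>The intermediate past takes its \<open>k\<close> newest symbols from
    \<open>u\<close> and the rest from \<open>u'\<close>. It shares the new symbols with
    \<open>u\<close>, so the chi-square bound compares these two; from \<open>u'\<close> it differs
    in at most \<open>k\<close> symbols, each of influence at most \<open>\<tau> N\<close>.\<close>
  define z where "z i = (if i < k then u i else u' i)" for i
  have z: "z \<in> pasts" using u by (auto simp: z_def pasts_iff)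
  have gap: "gap j u z = gap (j + k) v w" for j
  proof -
    have "gap j u z = (\<Sum>n. b (n + k + j) * (u (n + k) - z (n + k))) + (\<Sum>n<k. b (n + j) * (u n - z n))"
      unfolding gap_def by (rule suminf_split_initial_segment[OF summable_gap[OF u(1) z]])
    also have "(\<Sum>n<k. b (n + j) * (u n - z n)) = 0" by (simp add: z_def)
    finally show ?thesis by (simp add: gap_def uv uw z_def add_ac)
  qed
  have range: "0 \<le> ?G x" "?G x \<le> 1" if "x \<in> pasts" for x
    using that f by (auto intro: Tn_ge Tn_le)
  have half: "(T ^^ (r + N)) h u - (T ^^ (r + N)) h z \<le>
      \<eta> / 2 + (exp (K * (\<Sum>j<r + N. (gap (j + k) v w)\<^sup>2)) - 1) / (2 * \<eta>)"
    if h: "\<And>v. v \<in> pasts \<Longrightarrow> \<bar>h v\<bar> \<le> 1" "local_fun r h" for h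
  proof -
    have "1 * (T ^^ (r + N)) h u - (T ^^ (r + N)) h z \<le>
      \<eta> / 2 + (1\<^sup>2 * exp (K * (\<Sum>j<r + N. (gap j u z)\<^sup>2)) - 2 * 1 + 1) / (2 * \<eta>)"
    proof (rule Tn_chi_square[OF u(1) z \<eta>(1) h(1)])
      fix x y assume "x \<in> pasts" "y \<in> pasts" and eq: "\<And>i. i < r + N \<Longrightarrow> x i = y i"
      moreover have "\<forall>i<r. x i = y i" using eq by simp
      ultimately show "h x = h y" using h(2) unfolding local_fun_def by blast
    qed
    then show ?thesis by (simp add: gap)
  qed
  have f_abs: "\<bar>f x\<bar> \<le> 1" if "x \<in> pasts" for x
    using f(2,3)[OF that] by simp
  have "?G u - ?G z \<le> \<eta> / 2 + (exp (K * (\<Sum>j<r + N. (gap (j + k) v w)\<^sup>2)) - 1) / (2 * \<eta>)"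
    by (intro half f_abs f(1))
  moreover have "?G z - ?G u \<le> \<eta> / 2 + (exp (K * (\<Sum>j<r + N. (gap (j + k) v w)\<^sup>2)) - 1) / (2 * \<eta>)"
  proof -
    have "local_fun r (\<lambda>x. - f x)" using f(1) unfolding local_fun_def neg_equal_iff_equal .
    from half[OF _ this] f_abs show ?thesis by (simp add: Tn_uminus)
  qed
  ultimately have "\<bar>?G u - ?G z\<bar> \<le> \<eta> / 2 + K * (\<Sum>j<r + N. (gap (j + k) v w)\<^sup>2) / \<eta>"
    using range[OF u(1)] range[OF z] K_pos \<eta>
    by (intro exp_min_bound) (auto intro!: mult_nonneg_nonneg sum_nonneg)
  moreover have "\<bar>?G z - ?G u'\<bar> \<le> real k * \<tau> N"
  proof -
    have "\<bar>?G z - ?G u'\<bar> \<le> (\<Sum>n. (step ^^ (r + N)) (block r) n * differ z u' n)"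
      by (rule lipD(3)[OF lip_Tn[OF lip_local[OF f]] z u(2)])
    also have "\<dots> = (\<Sum>n<k. (step ^^ (r + N)) (block r) n * differ z u' n)"
      by (rule suminf_finite) (auto simp: differ_def z_def)
    also have "\<dots> \<le> (\<Sum>n<k. \<tau> N * 1)"
      by (intro sum_mono mult_mono stepn_block_le differ_bounds \<tau>_nonneg)
    finally show ?thesis by simp
  qed
  ultimately show "\<bar>?G u - ?G u'\<bar> \<le> \<eta> / 2 + K * (\<Sum>j<r + N. (gap (j + k) v w)\<^sup>2) / \<eta> + real k * \<tau> N"
    by linarith
qed

end

section \<open>Measures on configurations\<close>

definition depends_on :: "(int \<Rightarrow> real) set \<Rightarrow> int set \<Rightarrow> bool" where
  "depends_on C J \<longleftrightarrow> C \<subseteq> configs \<and> (\<forall>x\<in>configs. \<forall>y\<in>configs. (\<forall>i\<in>J. x i = y i) \<longrightarrow> x \<in> C \<longrightarrow> y \<in> C)"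

text \<open>Arbitrary events of finitely many coordinates rather than single cylinders: they form an
  algebra, as the extension theorem and the approximation of measurable sets require.\<close>

definition window_sets :: "int set \<Rightarrow> (int \<Rightarrow> real) set set" where
  "window_sets I = {C. \<exists>J. finite J \<and> J \<subseteq> I \<and> depends_on C J}"

lemma depends_onD:
  assumes "depends_on C J"
  shows "C \<subseteq> configs"
    "x \<in> configs \<Longrightarrow> y \<in> configs \<Longrightarrow> (\<And>i. i \<in> J \<Longrightarrow> x i = y i) \<Longrightarrow> x \<in> C \<Longrightarrow> y \<in> C"
  using assms unfolding depends_on_def by meson+

lemma window_setsI:
  assumes "C \<subseteq> configs" "finite J" "J \<subseteq> I"
    "\<And>x y. x \<in> configs \<Longrightarrow> y \<in> configs \<Longrightarrow> (\<And>i. i \<in> J \<Longrightarrow> x i = y i) \<Longrightarrow> x \<in> C \<Longrightarrow> y \<in> C"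
  shows "C \<in> window_sets I"
proof -
  have "depends_on C J"
    unfolding depends_on_def using assms(1,4) by (intro conjI ballI impI) metis+
  then show ?thesis using assms(2,3) unfolding window_sets_def by blast
qed

lemma window_setsE:
  assumes "C \<in> window_sets I" obtains J where "finite J" "J \<subseteq> I" "depends_on C J"
  using assms unfolding window_sets_def by blast

lemma window_sets_mono: "I \<subseteq> J \<Longrightarrow> window_sets I \<subseteq> window_sets J"
  unfolding window_sets_def by blast

lemma window_subset_Pow: "window_sets I \<subseteq> Pow configs"
  unfolding window_sets_def depends_on_def by blast

lemma window_empty: "{} \<in> window_sets I"
  by (rule window_setsI[of _ "{}"]) auto

lemma window_Un:
  assumes "C \<in> window_sets I" "D \<in> window_sets I" shows "C \<union> D \<in> window_sets I"
proof -
  obtain J where "finite J" "J \<subseteq> I" "depends_on C J"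
    using window_setsE[OF assms(1)] .
  note J = depends_onD(1)[OF this(3)] this(1,2) depends_onD(2)[OF this(3)]
  obtain J' where "finite J'" "J' \<subseteq> I" "depends_on D J'"
    using window_setsE[OF assms(2)] .
  note J' = depends_onD(1)[OF this(3)] this(1,2) depends_onD(2)[OF this(3)]
  show ?thesis
  proof (rule window_setsI[of _ "J \<union> J'"])
    fix x y assume "x \<in> configs" "y \<in> configs" "\<And>i. i \<in> J \<union> J' \<Longrightarrow> x i = y i" "x \<in> C \<union> D"
    then show "y \<in> C \<union> D" using J(4)[of x y] J'(4)[of x y] by blast
  qed (use J J' in auto)
qed

lemma window_Compl:
  assumes "C \<in> window_sets I" shows "configs - C \<in> window_sets I"
proof -
  obtain J where "finite J" "J \<subseteq> I" "depends_on C J"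
    using window_setsE[OF assms(1)] .
  note J = depends_onD(1)[OF this(3)] this(1,2) depends_onD(2)[OF this(3)]
  show ?thesis
  proof (rule window_setsI[of _ J])
    fix x y assume "x \<in> configs" "y \<in> configs" "\<And>i. i \<in> J \<Longrightarrow> x i = y i" "x \<in> configs - C"
    then show "y \<in> configs - C" using J(4)[of y x] by auto
  qed (use J in auto)
qed

lemma window_algebra: "algebra configs (window_sets I)"
  by (subst algebra_iff_Un) (intro conjI window_subset_Pow ballI window_empty window_Un window_Compl)

lemma window_configs: "configs \<in> window_sets I"
  using window_Compl[OF window_empty] by simp

lemma window_Int: "C \<in> window_sets I \<Longrightarrow> D \<in> window_sets I \<Longrightarrow> C \<inter> D \<in> window_sets I"
proof -
  interpret algebra configs "window_sets I" by (rule window_algebra)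
  show "C \<in> window_sets I \<Longrightarrow> D \<in> window_sets I \<Longrightarrow> C \<inter> D \<in> window_sets I" by (rule Int)
qed

lemma Int_stable_window: "Int_stable (window_sets I)"
  by (auto intro!: Int_stableI window_Int)

lemma cylinder_window:
  assumes "finite J" "J \<subseteq> I" shows "{x \<in> configs. \<forall>i\<in>J. P i (x i)} \<in> window_sets I"
  by (rule window_setsI[of _ J]) (use assms in auto)

lemma finite_restrict_configs: "finite J \<Longrightarrow> finite ((\<lambda>x. restrict x J) ` configs)"
proof -
  assume "finite J"
  then have "finite (PiE J (\<lambda>_. spins))" by (intro finite_PiE) (auto simp: spins_def)
  then show ?thesis by (rule rev_finite_subset) (auto simp: configs_def PiE_iff)
qed

lemma window_decomp:
  assumes "C \<subseteq> configs"
    "\<And>x y. x \<in> configs \<Longrightarrow> y \<in> configs \<Longrightarrow> (\<And>i. i \<in> J \<Longrightarrow> x i = y i) \<Longrightarrow> x \<in> C \<Longrightarrow> y \<in> C"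
  shows "C = (\<Union>y\<in>(\<lambda>x. restrict x J) ` C. {x \<in> configs. \<forall>i\<in>J. x i = y i})"
proof (intro set_eqI iffI)
  fix x assume "x \<in> C"
  then show "x \<in> (\<Union>y\<in>(\<lambda>x. restrict x J) ` C. {x \<in> configs. \<forall>i\<in>J. x i = y i})"
    using assms(1) by (intro UN_I[of "restrict x J"]) auto
next
  fix x assume "x \<in> (\<Union>y\<in>(\<lambda>x. restrict x J) ` C. {x \<in> configs. \<forall>i\<in>J. x i = y i})"
  then obtain z where "z \<in> C" "x \<in> configs" "\<forall>i\<in>J. x i = restrict z J i" by auto
  then show "x \<in> C" using assms(1) by (intro assms(2)[of z x]) auto
qed

lemma window_in_coord:
  assumes "C \<in> window_sets I" shows "C \<in> sets (coord_algebra I)"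
proof -
  obtain J where "finite J" "J \<subseteq> I" "depends_on C J"
    using window_setsE[OF assms] .
  note J = depends_onD(1)[OF this(3)] this(1,2) depends_onD(2)[OF this(3)]
  have "finite ((\<lambda>x. restrict x J) ` C)"
    using finite_subset[OF image_mono[OF J(1)] finite_restrict_configs[OF J(2)]] .
  moreover have "{x \<in> configs. \<forall>i\<in>J. x i = y i} \<in> sets (coord_algebra I)" for y
  proof -
    have "{x \<in> space (coord_algebra I). \<forall>i\<in>J. x i = y i} \<in> sets (coord_algebra I)"
    proof (rule sets.sets_Collect_finite_All[OF _ J(2)])
      fix i assume i: "i \<in> J"
      have "{x \<in> configs. x i = y i} = {x \<in> configs. x i \<in> {y i} \<inter> spins}"
        by (auto simp: configs_def)
      also have "\<dots> \<in> sets (coord_algebra I)"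
        unfolding sets_coord_algebra using i J(3) by (intro sigma_sets.Basic) blast
      finally show "{x \<in> space (coord_algebra I). x i = y i} \<in> sets (coord_algebra I)" by simp
    qed
    then show ?thesis by simp
  qed
  ultimately have "(\<Union>y\<in>(\<lambda>x. restrict x J) ` C. {x \<in> configs. \<forall>i\<in>J. x i = y i}) \<in> sets (coord_algebra I)"
    by (rule sets.finite_UN)
  also have "(\<Union>y\<in>(\<lambda>x. restrict x J) ` C. {x \<in> configs. \<forall>i\<in>J. x i = y i}) = C"
    by (rule window_decomp[symmetric, OF J(1)]) (rule J(4))
  finally show ?thesis .
qed

lemma sets_coord_window: "sets (coord_algebra I) = sigma_sets configs (window_sets I)"
proof (intro antisym)
  show "sets (coord_algebra I) \<subseteq> sigma_sets configs (window_sets I)"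
    unfolding sets_coord_algebra
  proof (rule sigma_sets_mono', safe)
    fix i B assume "i \<in> I"
    then show "{x \<in> configs. x i \<in> B} \<in> window_sets I"
      using cylinder_window[of "{i}" I "\<lambda>_ z. z \<in> B"] by simp
  qed
  have "sigma_sets (space (coord_algebra I)) (window_sets I) \<subseteq> sets (coord_algebra I)"
    by (rule sets.sigma_sets_subset) (auto intro: window_in_coord)
  then show "sigma_sets configs (window_sets I) \<subseteq> sets (coord_algebra I)" by simp
qed

text \<open>Makes total variation testable on window events: intersecting with the whole space puts
  each single coordinate event among the rectangles.\<close>

lemma sets_rect_algebra: "sets (rect_algebra n) = sets (coord_algebra ({..-1} \<union> {n..}))"
proof -
  let ?G = "{A \<inter> B | A B. A \<in> sets (coord_algebra {..-1}) \<and> B \<in> sets (coord_algebra {n..})}"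
  have top: "configs \<in> sets (coord_algebra I)" for I using sets.top[of "coord_algebra I"] by simp
  have G: "?G \<subseteq> Pow configs"
    using sets.sets_into_space[of _ "coord_algebra {..-1}"] unfolding space_coord_algebra by blast
  have eq: "sets (rect_algebra n) = sigma_sets configs ?G"
    unfolding rect_algebra_def by (rule sets_measure_of[OF G])
  have "sigma_sets configs ?G \<subseteq> sets (coord_algebra ({..-1} \<union> {n..}))"
    using sets.sigma_sets_subset[of ?G "coord_algebra ({..-1} \<union> {n..})"]
      coord_algebra_mono[of "{..-1}" "{..-1} \<union> {n..}"] coord_algebra_mono[of "{n..}" "{..-1} \<union> {n..}"]
    unfolding space_coord_algebra by blast
  moreover have "sets (coord_algebra ({..-1} \<union> {n..})) \<subseteq> sigma_sets configs ?G"
    unfolding sets_coord_algebra[of "{..-1} \<union> {n..}"]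
  proof (rule sigma_sets_mono, safe)
    fix i :: int and B :: "real set" assume "i \<le> -1" "B \<subseteq> spins"
    then have "{x \<in> configs. x i \<in> B} \<in> sets (coord_algebra {..-1})"
      unfolding sets_coord_algebra by (intro sigma_sets.Basic) auto
    then have "{x \<in> configs. x i \<in> B} \<inter> configs \<in> ?G" using top[of "{n..}"] by blast
    moreover have "{x \<in> configs. x i \<in> B} \<inter> configs = {x \<in> configs. x i \<in> B}" by blast
    ultimately show "{x \<in> configs. x i \<in> B} \<in> sigma_sets configs ?G"
      by (simp only:) (rule sigma_sets.Basic)
  next
    fix i :: int and B :: "real set" assume "n \<le> i" "B \<subseteq> spins"
    then have "{x \<in> configs. x i \<in> B} \<in> sets (coord_algebra {n..})"
      unfolding sets_coord_algebra by (intro sigma_sets.Basic) auto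
    then have "configs \<inter> {x \<in> configs. x i \<in> B} \<in> ?G" using top[of "{..-1}"] by blast
    moreover have "configs \<inter> {x \<in> configs. x i \<in> B} = {x \<in> configs. x i \<in> B}" by blast
    ultimately show "{x \<in> configs. x i \<in> B} \<in> sigma_sets configs ?G"
      by (simp only:) (rule sigma_sets.Basic)
  qed
  ultimately show ?thesis using eq by blast
qed

section \<open>Extension from window events to a measure\<close>

lemma compact_configs: "compact configs"
proof -
  have "compactin (product_topology (\<lambda>_. euclidean) UNIV) (PiE UNIV (\<lambda>_ :: int. spins))"
    by (subst compactin_PiE) (auto simp: spins_def intro!: finite_imp_compactin)
  then show ?thesis by (simp add: euclidean_product_topology configs_def)
qed

lemma closed_window:
  assumes "C \<in> window_sets I" shows "closed C"
proof -
  obtain J where "finite J" "J \<subseteq> I" "depends_on C J"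
    using window_setsE[OF assms] .
  note J = depends_onD(1)[OF this(3)] this(1,2) depends_onD(2)[OF this(3)]
  have fin: "finite ((\<lambda>x. restrict x J) ` C)"
    using finite_subset[OF image_mono[OF J(1)] finite_restrict_configs[OF J(2)]] .
  have proj: "continuous_on UNIV (\<lambda>x :: int \<Rightarrow> real. x i)" for i
    by (rule continuous_on_product_coordinates)
  have eq: "configs = (\<Inter>i. {x. x i = 1} \<union> {x. x i = -1})" by (auto simp: configs_iff)
  have cc: "closed configs"
    unfolding eq by (intro closed_INT ballI closed_Un closed_Collect_eq proj continuous_on_const)
  have "closed {x \<in> configs. \<forall>i\<in>J. x i = y i}" for y :: "int \<Rightarrow> real"
  proof -
    have eq: "{x \<in> configs. \<forall>i\<in>J. x i = y i} = configs \<inter> (\<Inter>i\<in>J. {x. x i = y i})" by auto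
    show ?thesis
      unfolding eq by (intro closed_Int cc closed_INT ballI closed_Collect_eq proj continuous_on_const)
  qed
  then have "closed (\<Union>y\<in>(\<lambda>x. restrict x J) ` C. {x \<in> configs. \<forall>i\<in>J. x i = y i})"
    by (intro closed_UN fin ballI)
  also have "(\<Union>y\<in>(\<lambda>x. restrict x J) ` C. {x \<in> configs. \<forall>i\<in>J. x i = y i}) = C"
    by (rule window_decomp[symmetric, OF J(1)]) (rule J(4))
  finally show ?thesis .
qed

text \<open>Kolmogorov extension through compactness. Window events are closed in a compact space,
  so a decreasing sequence of them with empty intersection is eventually empty, and continuity at
  the empty set is automatic.\<close>

lemma ex_measure_on_windows:
  assumes nonneg: "\<And>C. C \<in> window_sets UNIV \<Longrightarrow> 0 \<le> L C" and total: "L configs = (1 :: real)"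
    and add: "\<And>C D. C \<in> window_sets UNIV \<Longrightarrow> D \<in> window_sets UNIV \<Longrightarrow> C \<inter> D = {} \<Longrightarrow> L (C \<union> D) = L C + L D"
  shows "\<exists>P. prob_on_configs P \<and> (\<forall>C\<in>window_sets UNIV. measure P C = L C)"
proof -
  let ?W = "window_sets (UNIV :: int set)"
  interpret algebra configs ?W by (rule window_algebra)
  have L0: "L {} = 0" using add[of "{}" "{}"] by (simp add: window_empty)
  have "\<exists>\<mu>. (\<forall>s\<in>?W. \<mu> s = ennreal (L s)) \<and> measure_space configs (sigma_sets configs ?W) \<mu>"
  proof (rule caratheodory_empty_continuous)
    show "positive ?W (\<lambda>s. ennreal (L s))" by (simp add: positive_def L0)
    show "additive ?W (\<lambda>s. ennreal (L s))"
      by (auto simp: additive_def add ennreal_plus nonneg)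
    fix A :: "nat \<Rightarrow> (int \<Rightarrow> real) set"
    assume A: "range A \<subseteq> ?W" "decseq A" "(\<Inter>i. A i) = {}"
    have "\<exists>i. A i = {}"
    proof (rule ccontr)
      assume ne: "\<not> (\<exists>i. A i = {})"
      have "configs \<inter> \<Inter> (range A) \<noteq> {}"
      proof (rule compact_imp_fip[OF compact_configs])
        fix S assume "S \<in> range A" then show "closed S" using A(1) by (auto intro: closed_window)
      next
        fix F' assume F': "finite F'" "F' \<subseteq> range A"
        obtain N where N: "finite N" "F' = A ` N"
          using finite_subset_image[OF F'] by (elim exE conjE) (rule that)
        have "A (Max (insert 0 N)) \<subseteq> A i" if "i \<in> N" for i
          by (rule decseqD[OF A(2)]) (simp add: N(1) that)
        moreover have "A (Max (insert 0 N)) \<subseteq> configs" using A(1) window_subset_Pow by blast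
        moreover obtain x where "x \<in> A (Max (insert 0 N))" using ne by blast
        ultimately have "x \<in> configs" "\<forall>S\<in>F'. x \<in> S" unfolding N(2) by blast+
        then show "configs \<inter> \<Inter> F' \<noteq> {}" by blast
      qed
      then show False using A(3) by auto
    qed
    then obtain i where "A i = {}" by blast
    then have "\<forall>\<^sub>F n in sequentially. ennreal (L (A n)) = 0"
      using A(2) L0 by (auto simp: eventually_sequentially intro!: exI[of _ i] dest!: decseqD)
    then show "(\<lambda>i. ennreal (L (A i))) \<longlonglongrightarrow> 0" by (rule tendsto_eventually)
  qed simp
  then obtain \<mu> where \<mu>: "\<And>s. s \<in> ?W \<Longrightarrow> \<mu> s = ennreal (L s)"
    "measure_space configs (sigma_sets configs ?W) \<mu>" by blast
  define P where "P = measure_of configs (sigma_sets configs ?W) \<mu>"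
  have sa: "sigma_algebra configs (sigma_sets configs ?W)"
    by (rule sigma_algebra_sigma_sets[OF window_subset_Pow])
  have em: "emeasure P C = \<mu> C" if "C \<in> sigma_sets configs ?W" for C
    unfolding P_def using \<mu>(2) that by (intro emeasure_measure_of_sigma) (auto simp: measure_space_def)
  have sp: "space P = configs" unfolding P_def
    by (rule space_measure_of) (use sigma_sets_into_sp[OF window_subset_Pow] in blast)
  have st: "sets P = sets (coord_algebra UNIV)"
    unfolding P_def sets_coord_window using sigma_algebra.sets_measure_of_eq[OF sa] .
  have emW: "emeasure P C = ennreal (L C)" if "C \<in> ?W" for C
    using em[OF sigma_sets.Basic[OF that]] \<mu>(1)[OF that] by simp
  have "prob_space P" by (rule prob_spaceI) (simp add: sp emW[OF window_configs] total)
  then have "prob_on_configs P" by (simp add: prob_on_configs_def sp st)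
  moreover have "measure P C = L C" if "C \<in> ?W" for C
    using emW[OF that] nonneg[OF that] by (simp add: measure_def)
  ultimately show ?thesis by blast
qed

lemma prob_on_configsD:
  assumes "prob_on_configs P" shows "prob_space P" "space P = configs"
  using assms by (auto simp: prob_on_configs_def)

lemma prob_on_configs_eqI:
  assumes "prob_on_configs P" "prob_on_configs Q"
    "\<And>C. C \<in> window_sets UNIV \<Longrightarrow> measure P C = measure Q C"
  shows "P = Q"
proof -
  interpret P: prob_space P using assms(1) by (simp add: prob_on_configs_def)
  interpret Q: prob_space Q using assms(2) by (simp add: prob_on_configs_def)
  show ?thesis
  proof (rule measure_eqI_generator_eq[OF Int_stable_window window_subset_Pow, where A="\<lambda>_. configs"])
    fix C :: "(int \<Rightarrow> real) set" assume "C \<in> window_sets UNIV"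
    then show "emeasure P C = emeasure Q C"
      using assms(3) by (simp add: P.emeasure_eq_measure Q.emeasure_eq_measure)
  qed (use assms(1,2) in \<open>auto simp: prob_on_configs_def sets_coord_window window_configs\<close>)
qed

section \<open>Events as functions of the past\<close>

definition unpast :: "int \<Rightarrow> (nat \<Rightarrow> real) \<Rightarrow> int \<Rightarrow> real" where
  "unpast j u = (\<lambda>i. if i \<le> j then u (nat (j - i)) else 1)"

lemma unpast_configs: "u \<in> pasts \<Longrightarrow> unpast j u \<in> configs"
  by (auto simp: unpast_def configs_iff pasts_iff)

lemma past_upto_pasts: "x \<in> configs \<Longrightarrow> past_upto j x \<in> pasts"
  by (auto simp: past_upto_def configs_iff pasts_iff)

lemma past_upto_unpast: "past_upto j (unpast j u) = u"
  by (auto simp: past_upto_def unpast_def)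

lemma unpast_past_upto: "i \<le> j \<Longrightarrow> unpast j (past_upto j x) i = x i"
  by (auto simp: past_upto_def unpast_def)

lemma past_upto_push: "past_upto j x = push (x j) (past_upto (j - 1) x)"
  by (auto simp: past_upto_def fun_eq_iff algebra_simps split: nat.split)

text \<open>An event of the coordinates up to \<open>j\<close> becomes a function of a past, to
  which \<open>T\<close> applies. The value 1 that \<open>unpast\<close> puts after time
  \<open>j\<close> cannot affect such an event.\<close>

definition on_past :: "(int \<Rightarrow> real) set \<Rightarrow> int \<Rightarrow> (nat \<Rightarrow> real) \<Rightarrow> real" where
  "on_past C j u = indicator C (unpast j u)"

lemma window_iff:
  assumes "C \<in> window_sets I" "x \<in> configs" "y \<in> configs" "\<And>i. i \<in> I \<Longrightarrow> x i = y i"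
  shows "x \<in> C \<longleftrightarrow> y \<in> C"
  by (rule coord_algebra_cong[OF window_in_coord[OF assms(1)] assms(2-4)])

lemma on_past_past_upto:
  assumes "C \<in> window_sets {..j}" "x \<in> configs"
  shows "on_past C j (past_upto j x) = indicator C x"
proof -
  have "unpast j (past_upto j x) \<in> C \<longleftrightarrow> x \<in> C"
    by (rule window_iff[OF assms(1)]) (auto intro: unpast_configs past_upto_pasts assms(2) unpast_past_upto)
  then show ?thesis by (simp add: on_past_def indicator_def)
qed

lemma on_past_shift:
  assumes "C \<in> window_sets {..j}" "u \<in> pasts" "v \<in> pasts" "\<And>i. u (i + n) = v i"
  shows "on_past C (j + int n) u = on_past C j v"
proof -
  have "unpast (j + int n) u i = unpast j v i" if "i \<in> {..j}" for i
  proof -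
    have "nat (j + int n - i) = nat (j - i) + n" using that by auto
    then show ?thesis using assms(4)[of "nat (j - i)"] that by (simp add: unpast_def)
  qed
  then have "unpast (j + int n) u \<in> C \<longleftrightarrow> unpast j v \<in> C"
    by (intro window_iff[OF assms(1)] unpast_configs assms(2,3))
  then show ?thesis by (simp add: on_past_def indicator_def)
qed

lemma on_past_local:
  assumes "C \<in> window_sets {..j}" obtains r where "local_fun r (on_past C j)"
proof -
  obtain J where "finite J" "J \<subseteq> {..j}" "depends_on C J"
    using window_setsE[OF assms] .
  note J = depends_onD(1)[OF this(3)] this(1,2) depends_onD(2)[OF this(3)]
  obtain r where r: "\<And>i. i \<in> J \<Longrightarrow> nat (j - i) < r"
    using finite_imageI[OF J(2), of "\<lambda>i. nat (j - i)"] unfolding finite_nat_set_iff_bounded by blast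
  have *: "unpast j w \<in> C" if "v \<in> pasts" "w \<in> pasts" "\<forall>i<r. v i = w i" "unpast j v \<in> C" for v w
    by (rule J(4)[OF unpast_configs unpast_configs, OF that(1,2) _ that(4)]) (use that(3) r in \<open>auto simp: unpast_def\<close>)
  have "local_fun r (on_past C j)"
    unfolding local_fun_def
  proof (intro ballI impI)
    fix v w assume vw: "v \<in> pasts" "w \<in> pasts" "\<forall>i<r. v i = w i"
    have "unpast j v \<in> C \<longleftrightarrow> unpast j w \<in> C" using *[OF vw] *[OF vw(2,1)] vw(3) by metis
    then show "on_past C j v = on_past C j w" by (simp add: on_past_def indicator_def)
  qed
  then show ?thesis by (rule that)
qed

lemma lip_bounded: "lip c f \<Longrightarrow> v \<in> pasts \<Longrightarrow> \<bar>f v\<bar> \<le> \<bar>f (\<lambda>_. 1)\<bar> + suminf c"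
  using lip_osc[OF _ _ pasts_ne, of c f v] by linarith

text \<open>Replacing the far past by plus signs produces a function of \<open>r\<close> symbols; by
  \<open>lip_trunc\<close> the error is a tail of the weights, uniformly over pasts.\<close>

definition trunc :: "nat \<Rightarrow> (nat \<Rightarrow> real) \<Rightarrow> nat \<Rightarrow> real" where
  "trunc r v = (\<lambda>i. if i < r then v i else 1)"

lemma trunc_pasts: "v \<in> pasts \<Longrightarrow> trunc r v \<in> pasts"
  by (auto simp: trunc_def pasts_iff)

lemma finite_trunc: "finite (trunc r ` pasts)"
proof -
  have "trunc r ` pasts \<subseteq> (\<lambda>y i. if i < r then y i else 1) ` PiE {..<r} (\<lambda>_. spins)"
  proof
    fix z assume "z \<in> trunc r ` pasts"
    then obtain v where v: "v \<in> pasts" "z = trunc r v" by auto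
    then have "z = (\<lambda>y i. if i < r then y i else 1) (restrict v {..<r})" by (auto simp: trunc_def)
    moreover have "restrict v {..<r} \<in> PiE {..<r} (\<lambda>_. spins)" using v(1) by (auto simp: pasts_def)
    ultimately show "z \<in> (\<lambda>y i. if i < r then y i else 1) ` PiE {..<r} (\<lambda>_. spins)" by blast
  qed
  moreover have "finite (PiE {..<r} (\<lambda>_. spins))" by (intro finite_PiE) (auto simp: spins_def)
  ultimately show ?thesis by (meson finite_imageI finite_subset)
qed

lemma local_trunc: "local_fun r F \<Longrightarrow> v \<in> pasts \<Longrightarrow> F (trunc r v) = F v"
  using trunc_pasts[of v r] unfolding local_fun_def by (metis trunc_def)

lemma local_fun_trunc: "local_fun r (\<lambda>v. F (trunc r v))"
proof -
  have "trunc r v = trunc r w" if "\<forall>i<r. v i = w i" for v w using that by (auto simp: trunc_def)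
  then show ?thesis unfolding local_fun_def by metis
qed

lemma local_finite_range: "local_fun r F \<Longrightarrow> finite (F ` pasts)"
proof -
  assume "local_fun r F"
  then have "F ` pasts = F ` trunc r ` pasts" using local_trunc[of r F] by (force simp: image_image)
  then show ?thesis using finite_trunc by simp
qed

lemma lip_trunc:
  assumes "lip c F" "v \<in> pasts"
  shows "\<bar>F v - F (trunc r v)\<bar> \<le> (\<Sum>n. c (n + r))"
proof -
  note c = lipD(1,2)[OF assms(1)]
  have s: "summable (\<lambda>n. c n * differ v (trunc r v) n)" by (rule summable_mult_differ[OF c])
  have "\<bar>F v - F (trunc r v)\<bar> \<le> (\<Sum>n. c n * differ v (trunc r v) n)"
    by (rule lipD(3)[OF assms trunc_pasts[OF assms(2)]])
  also have "\<dots> = (\<Sum>n. c (n + r) * differ v (trunc r v) (n + r)) + (\<Sum>n<r. c n * differ v (trunc r v) n)"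
    by (rule suminf_split_initial_segment[OF s])
  also have "(\<Sum>n<r. c n * differ v (trunc r v) n) = 0" by (simp add: differ_def trunc_def)
  also have "(\<Sum>n. c (n + r) * differ v (trunc r v) (n + r)) \<le> (\<Sum>n. c (n + r))"
    using c(1) differ_bounds
    by (intro suminf_le summable_ignore_initial_segment[OF s] summable_ignore_initial_segment[OF c(2)])
      (auto intro: mult_left_le)
  finally show ?thesis by simp
qed

lemma window_of_local:
  assumes "local_fun r F" shows "{x \<in> configs. F (past_upto j x) \<in> Y} \<in> window_sets {..j}"
proof (rule window_setsI[of _ "{j - int r<..j}"])
  fix x y assume x: "x \<in> configs" and y: "y \<in> configs" and eq: "\<And>i. i \<in> {j - int r<..j} \<Longrightarrow> x i = y i"
    and "x \<in> {x \<in> configs. F (past_upto j x) \<in> Y}"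
  moreover have "\<forall>i<r. past_upto j x i = past_upto j y i" using eq by (auto simp: past_upto_def)
  then have "F (past_upto j x) = F (past_upto j y)"
    using assms past_upto_pasts[OF x] past_upto_pasts[OF y] unfolding local_fun_def by blast
  ultimately show "y \<in> {x \<in> configs. F (past_upto j x) \<in> Y}" by simp
qed auto

lemma local_measurable:
  assumes "local_fun r F" shows "(\<lambda>x. F (past_upto j x)) \<in> borel_measurable (coord_algebra {..j})"
proof (rule measurableI)
  fix Y :: "real set" assume "Y \<in> sets borel"
  have "(\<lambda>x. F (past_upto j x)) -` Y \<inter> space (coord_algebra {..j}) = {x \<in> configs. F (past_upto j x) \<in> Y}" by auto
  then show "(\<lambda>x. F (past_upto j x)) -` Y \<inter> space (coord_algebra {..j}) \<in> sets (coord_algebra {..j})"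
    using window_in_coord[OF window_of_local[OF assms]] by simp
qed simp

text \<open>Summable weights make the function the pointwise limit of its truncations, each of which
  reads finitely many symbols.\<close>

lemma lip_measurable:
  assumes "lip c F" shows "(\<lambda>x. F (past_upto j x)) \<in> borel_measurable (coord_algebra {..j})"
proof (rule borel_measurable_LIMSEQ_real)
  fix x assume "x \<in> space (coord_algebra {..j})"
  then have x: "past_upto j x \<in> pasts" by (simp add: past_upto_pasts)
  have "(\<lambda>r. F (trunc r (past_upto j x)) - F (past_upto j x)) \<longlonglongrightarrow> 0"
    by (rule Lim_null_comparison[OF always_eventually tail_tendsto_0[OF lipD(2)[OF assms]]])
      (use lip_trunc[OF assms x] in \<open>simp add: abs_minus_commute\<close>)
  then show "(\<lambda>r. F (trunc r (past_upto j x))) \<longlonglongrightarrow> F (past_upto j x)" by (simp add: LIM_zero_iff)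
qed (rule local_measurable[OF local_fun_trunc])

lemma lip_measurable_P:
  assumes "prob_on_configs P" "lip c F"
  shows "(\<lambda>x. F (past_upto j x)) \<in> borel_measurable P"
  using measurable_from_subalg[OF subalgebra_coord[OF assms(1)] lip_measurable[OF assms(2)]] .

lemma lip_integrable:
  assumes "prob_on_configs P" "lip c F"
  shows "integrable P (\<lambda>x. F (past_upto j x))"
proof -
  interpret prob_space P using assms(1) by (simp add: prob_on_configs_def)
  show ?thesis
    using assms(1) lip_bounded[OF assms(2)]
    by (intro integrable_const_bound[of _ "\<bar>F (\<lambda>_. 1)\<bar> + suminf c"] lip_measurable_P[OF assms] AE_I2)
      (auto simp: prob_on_configs_def past_upto_pasts)
qed

lemma indicator_lip_integrable:
  assumes "prob_on_configs P" "lip c F" "A \<in> sets (coord_algebra I)"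
  shows "integrable P (\<lambda>x. indicator A x * F (past_upto j x))"
proof -
  have "A \<in> sets P" using subalgebra_coord[OF assms(1), of I] assms(3) by (auto simp: subalgebra_def)
  from integrable_mult_indicator[OF this lip_integrable[OF assms(1,2), of j]] show ?thesis by simp
qed

section \<open>Measures as limits of iterated averages\<close>

context ising begin

lemma Tn_cmult: "(T ^^ n) (\<lambda>u. y * f u) v = y * (T ^^ n) f v"
proof (induction n arbitrary: v)
  case (Suc n)
  have "(T ^^ n) (\<lambda>u. y * f u) = (\<lambda>u. y * (T ^^ n) f u)" using Suc by auto
  then show ?case by (simp add: T_cmult)
qed simp

lemma Tn_sum: "finite V \<Longrightarrow> (T ^^ n) (\<lambda>u. \<Sum>y\<in>V. F y u) v = (\<Sum>y\<in>V. (T ^^ n) (F y) v)"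
  by (induction V rule: finite_induct) (auto simp: Tn_const Tn_add)

lemma lip_phi: "a = 1 \<or> a = -1 \<Longrightarrow> lip b (\<lambda>v. logistic_phi (a * field v))"
proof -
  assume a: "a = 1 \<or> a = -1"
  have "\<bar>logistic_phi (a * field v) - logistic_phi (a * field w)\<bar> \<le> (\<Sum>n. b n * differ v w n)"
    if "v \<in> pasts" "w \<in> pasts" for v w
  proof -
    have "\<bar>a * field v - a * field w\<bar> = \<bar>field v - field w\<bar>" using a by auto
    then have "\<bar>logistic_phi (a * field v) - logistic_phi (a * field w)\<bar> \<le> \<bar>field v - field w\<bar> / 2"
      using logistic_phi_diff[of "a * field v" "a * field w"] by (simp only:)
    also have "\<dots> \<le> (\<Sum>n. b n * differ v w n)" using field_diff[OF that] by simp
    finally show ?thesis .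
  qed
  then show ?thesis by (simp add: lip_def b_nonneg b_summable)
qed

text \<open>
  For the process started from \<open>w\<close> the number \<open>k N\<close> of steps before time \<open>j\<close> does not depend on \<open>N\<close>;
  the \<open>g\<close>-measure is the limit of processes started ever earlier, with \<open>k N = N\<close>.
\<close>

definition represents :: "(int \<Rightarrow> real) measure \<Rightarrow> int \<Rightarrow> (nat \<Rightarrow> nat) \<Rightarrow> (nat \<Rightarrow> real) \<Rightarrow> bool" where
  "represents P j k w \<longleftrightarrow> (\<forall>C\<in>window_sets {..j}. (\<lambda>N. (T ^^ k N) (on_past C j) w) \<longlonglongrightarrow> measure P C)"

text \<open>A local function takes finitely many values, so it is a finite combination of indicators
  of window events, for which the limit is known.\<close>

lemma local_represents:
  assumes P: "prob_on_configs P" and rep: "represents P j k w" and w: "w \<in> pasts" and F: "local_fun r F"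
  shows "(\<lambda>N. (T ^^ k N) F w) \<longlonglongrightarrow> (\<integral>x. F (past_upto j x) \<partial>P)"
proof -
  interpret prob_space P by (rule prob_on_configsD[OF P])
  define V where "V = F ` pasts"
  have V: "finite V" unfolding V_def by (rule local_finite_range[OF F])
  define C where "C y = {x \<in> configs. F (past_upto j x) \<in> {y}}" for y
  have C: "C y \<in> window_sets {..j}" for y unfolding C_def by (rule window_of_local[OF F])
  have C': "C y \<in> sets P" for y
    using window_in_coord[OF C] subalgebra_coord[OF P, of "{..j}"] by (auto simp: subalgebra_def)
  have dec: "F u = (\<Sum>y\<in>V. y * on_past (C y) j u)" if u: "u \<in> pasts" for u
  proof -
    have "on_past (C y) j u = of_bool (F u = y)" for y
      using unpast_configs[OF u, of j] by (simp add: on_past_def C_def past_upto_unpast indicator_def)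
    then have "(\<Sum>y\<in>V. y * on_past (C y) j u) = (\<Sum>y\<in>V. if y = F u then y else 0)"
      by (auto intro!: sum.cong)
    also have "\<dots> = F u" using V u by (simp add: V_def)
    finally show ?thesis by simp
  qed
  have "(T ^^ n) F w = (\<Sum>y\<in>V. y * (T ^^ n) (on_past (C y) j) w)" for n
    using Tn_cong[OF w, of F "\<lambda>u. \<Sum>y\<in>V. y * on_past (C y) j u" n] dec
    by (simp add: Tn_sum[OF V] Tn_cmult)
  moreover have "(\<lambda>N. \<Sum>y\<in>V. y * (T ^^ k N) (on_past (C y) j) w) \<longlonglongrightarrow> (\<Sum>y\<in>V. y * prob (C y))"
    using rep C unfolding represents_def by (intro tendsto_sum tendsto_mult tendsto_const) auto
  moreover have "(\<integral>x. F (past_upto j x) \<partial>P) = (\<Sum>y\<in>V. y * prob (C y))"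
  proof -
    have "(\<integral>x. F (past_upto j x) \<partial>P) = (\<integral>x. (\<Sum>y\<in>V. y * indicator (C y) x) \<partial>P)"
    proof (rule Bochner_Integration.integral_cong[OF refl])
      fix x assume "x \<in> space P"
      then have x: "x \<in> configs" using P by (simp add: prob_on_configs_def)
      show "F (past_upto j x) = (\<Sum>y\<in>V. y * indicator (C y) x)"
        using dec[OF past_upto_pasts[OF x]] by (simp add: on_past_past_upto[OF C x])
    qed
    also have "\<dots> = (\<Sum>y\<in>V. y * prob (C y))"
      using C' by (subst Bochner_Integration.integral_sum)
        (auto intro!: integrable_mult_right integrable_real_indicator simp: emeasure_eq_measure)
    finally show ?thesis .
  qed
  ultimately show ?thesis by simp
qed

text \<open>The truncation error is uniform over pasts and \<open>T ^^ n\<close> is an average, so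
  the error stays uniform in \<open>n\<close> and the case of local functions extends.\<close>

lemma lip_represents:
  assumes P: "prob_on_configs P" and rep: "represents P j k w" and w: "w \<in> pasts" and F: "lip c F"
  shows "(\<lambda>N. (T ^^ k N) F w) \<longlonglongrightarrow> (\<integral>x. F (past_upto j x) \<partial>P)"
proof (rule LIMSEQ_I)
  fix e :: real assume e: "0 < e"
  interpret prob_space P by (rule prob_on_configsD[OF P])
  have "\<forall>\<^sub>F r in sequentially. (\<Sum>n. c (n + r)) < e / 3"
    using e by (intro order_tendstoD(2)[OF tail_tendsto_0[OF lipD(2)[OF F]]]) auto
  then obtain r where r: "(\<Sum>n. c (n + r)) < e / 3" by (auto simp: eventually_sequentially)
  let ?G = "\<lambda>v. F (trunc r v)"
  have close: "\<bar>F v - ?G v\<bar> < e / 3" if "v \<in> pasts" for v using lip_trunc[OF F that, of r] r by linarith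
  have close': "F v - ?G v \<le> e / 3" "- (e / 3) \<le> F v - ?G v" if "v \<in> pasts" for v
    using close[OF that] by linarith+
  have 1: "\<bar>(T ^^ n) F w - (T ^^ n) ?G w\<bar> \<le> e / 3" for n
  proof -
    have "(T ^^ n) (\<lambda>v. F v - ?G v) w \<le> e / 3"
      by (rule Tn_le[OF w]) (rule close')
    moreover have "- (e / 3) \<le> (T ^^ n) (\<lambda>v. F v - ?G v) w"
      by (rule Tn_ge[OF w]) (rule close')
    ultimately show ?thesis unfolding Tn_diff by (intro abs_leI) linarith+
  qed
  have int: "integrable P (\<lambda>x. ?G (past_upto j x))"
  proof (rule integrable_const_bound[of _ "\<bar>F (\<lambda>_. 1)\<bar> + suminf c"])
    show "(\<lambda>x. ?G (past_upto j x)) \<in> borel_measurable P"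
      using measurable_from_subalg[OF subalgebra_coord[OF P] local_measurable[OF local_fun_trunc]] .
    show "AE x in P. norm (?G (past_upto j x)) \<le> \<bar>F (\<lambda>_. 1)\<bar> + suminf c"
      using P lip_bounded[OF F] by (intro AE_I2) (simp add: prob_on_configs_def past_upto_pasts trunc_pasts)
  qed
  have 2: "\<bar>(\<integral>x. F (past_upto j x) \<partial>P) - (\<integral>x. ?G (past_upto j x) \<partial>P)\<bar> \<le> e / 3"
  proof -
    have "(\<integral>x. F (past_upto j x) \<partial>P) - (\<integral>x. ?G (past_upto j x) \<partial>P) = (\<integral>x. F (past_upto j x) - ?G (past_upto j x) \<partial>P)"
      by (rule Bochner_Integration.integral_diff[symmetric, OF lip_integrable[OF P F] int])
    also have "\<bar>\<dots>\<bar> \<le> (\<integral>x. \<bar>F (past_upto j x) - ?G (past_upto j x)\<bar> \<partial>P)" by (rule integral_abs_bound)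
    also have "\<dots> \<le> (\<integral>x. e / 3 \<partial>P)"
    proof (intro integral_mono integrable_abs Bochner_Integration.integrable_diff lip_integrable[OF P F] int integrable_const)
      fix x assume "x \<in> space P"
      then have "past_upto j x \<in> pasts" using P by (simp add: prob_on_configs_def past_upto_pasts)
      then show "\<bar>F (past_upto j x) - ?G (past_upto j x)\<bar> \<le> e / 3" using close by fastforce
    qed
    finally show ?thesis by (simp add: prob_space)
  qed
  have three_eps: "\<bar>p - q\<bar> \<le> e / 3 \<Longrightarrow> \<bar>s - t\<bar> \<le> e / 3 \<Longrightarrow> \<bar>q - t\<bar> < e / 3 \<Longrightarrow> \<bar>p - s\<bar> < e" for p q s t :: real
    by linarith
  obtain N0 where N0: "\<And>N. N \<ge> N0 \<Longrightarrow> \<bar>(T ^^ k N) ?G w - (\<integral>x. ?G (past_upto j x) \<partial>P)\<bar> < e / 3"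
    using LIMSEQ_D[OF local_represents[OF P rep w local_fun_trunc], of "e / 3"] e by fastforce
  have "norm ((T ^^ k N) F w - (\<integral>x. F (past_upto j x) \<partial>P)) < e" if "N \<ge> N0" for N
    unfolding real_norm_def by (rule three_eps[OF 1 2]) (rule N0[OF that])
  then show "\<exists>N0. \<forall>N\<ge>N0. norm ((T ^^ k N) F w - (\<integral>x. F (past_upto j x) \<partial>P)) < e" by blast
qed

lemma ex_represented:
  assumes "w \<in> pasts"
    and conv: "\<And>C. C \<in> window_sets UNIV \<Longrightarrow> convergent (\<lambda>N. (T ^^ k N) (on_past C (j N)) w)"
  shows "\<exists>P. prob_on_configs P \<and> (\<forall>C\<in>window_sets UNIV. (\<lambda>N. (T ^^ k N) (on_past C (j N)) w) \<longlonglongrightarrow> measure P C)"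
proof -
  define L where "L C = lim (\<lambda>N. (T ^^ k N) (on_past C (j N)) w)" for C
  have L: "(\<lambda>N. (T ^^ k N) (on_past C (j N)) w) \<longlonglongrightarrow> L C" if "C \<in> window_sets UNIV" for C
    using conv[OF that] unfolding L_def convergent_LIMSEQ_iff .
  obtain P where P: "prob_on_configs P" "\<And>C. C \<in> window_sets UNIV \<Longrightarrow> measure P C = L C"
  proof -
  have "\<exists>P. prob_on_configs P \<and> (\<forall>C\<in>window_sets UNIV. measure P C = L C)"
  proof (rule ex_measure_on_windows)
    fix C assume C: "C \<in> window_sets (UNIV :: int set)"
    show "0 \<le> L C"
      by (rule LIMSEQ_le_const[OF L[OF C]]) (intro exI[of _ 0] allI impI Tn_ge assms(1), simp add: on_past_def)
    fix D assume D: "D \<in> window_sets (UNIV :: int set)" and "C \<inter> D = {}"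
    then have "on_past (C \<union> D) i = (\<lambda>u. on_past C i u + on_past D i u)" for i
      by (auto simp: on_past_def indicator_def fun_eq_iff)
    then have "(\<lambda>N. (T ^^ k N) (on_past (C \<union> D) (j N)) w) \<longlonglongrightarrow> L C + L D"
      using tendsto_add[OF L[OF C] L[OF D]] by (simp add: Tn_add)
    then show "L (C \<union> D) = L C + L D"
      using L[OF window_Un[OF C D]] LIMSEQ_unique by blast
  next
    have "(T ^^ k N) (on_past configs (j N)) w = 1" for N
      by (rule Tn_unique_shift[OF assms(1)]) (simp add: on_past_def unpast_configs)
    then show "L configs = 1" using L[OF window_configs] by (simp add: LIMSEQ_const_iff)
  qed
  then show ?thesis using that by blast
  qed
  show ?thesis using P L by (intro exI[of _ P]) simp
qed


section \<open>Conditional probabilities as integral identities\<close>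

abbreviation g :: "(nat \<Rightarrow> real) \<Rightarrow> real" where "g \<equiv> ising_kernel \<beta> \<delta>"

text \<open>Both sides are countably additive in \<open>A\<close>, so equality on the
  intersection-stable window events passes to the sigma-algebra that they generate.\<close>

lemma set_integral_eq_windowI:
  fixes f h :: "(int \<Rightarrow> real) \<Rightarrow> real"
  assumes P: "prob_on_configs P" and f: "integrable P f" and h: "integrable P h"
    and eq: "\<And>C. C \<in> window_sets I \<Longrightarrow> (\<integral>x. indicator C x * f x \<partial>P) = (\<integral>x. indicator C x * h x \<partial>P)"
    and A: "A \<in> sets (coord_algebra I)"
  shows "(\<integral>x. indicator A x * f x \<partial>P) = (\<integral>x. indicator A x * h x \<partial>P)"
proof -
  have sub: "sets (coord_algebra I) \<subseteq> sets P" and sp: "space P = configs"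
    using subalgebra_coord[OF P, of I] P by (auto simp: subalgebra_def prob_on_configs_def)
  have A': "A \<in> sigma_sets configs (window_sets I)" using A by (simp add: sets_coord_window)
  have int: "integrable P (\<lambda>x. indicator A x * k x)" if "integrable P k" "A \<in> sigma_sets configs (window_sets I)"
    for A and k :: "(int \<Rightarrow> real) \<Rightarrow> real"
    using integrable_mult_indicator[OF _ that(1), of A] that(2) sub by (auto simp: sets_coord_window)
  show ?thesis
    using A'
  proof (induction A rule: sigma_sets_induct_disjoint[OF Int_stable_window window_subset_Pow, consumes 1, case_names basic empty compl union])
    case (basic A) then show ?case by (rule eq)
  next
    case empty then show ?case by simp
  next
    case (compl A)
    have "(\<integral>x. indicator (configs - A) x * k x \<partial>P) = (\<integral>x. indicator configs x * k x \<partial>P) - (\<integral>x. indicator A x * k x \<partial>P)"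
      if k: "integrable P k" for k :: "(int \<Rightarrow> real) \<Rightarrow> real"
    proof -
      have "A \<subseteq> configs" using sigma_sets_into_sp[OF window_subset_Pow compl(1)] .
      then have "indicator (configs - A) x * k x = indicator configs x * k x - indicator A x * k x" for x
        by (auto simp: indicator_def)
      then show ?thesis
        using Bochner_Integration.integral_diff[OF int[OF k sigma_sets_top] int[OF k compl(1)]] by simp
    qed
    then show ?case using f h compl eq[OF window_configs] by simp
  next
    case (union A)
    have "(\<integral>x. indicator (\<Union>i. A i) x * k x \<partial>P) = (\<Sum>i. \<integral>x. indicator (A i) x * k x \<partial>P)"
      if k: "integrable P k" for k :: "(int \<Rightarrow> real) \<Rightarrow> real"
    proof -
      have m: "A i \<in> sets P" for i using union(2) sub by (auto simp: sets_coord_window)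
      have "set_integrable P (\<Union>i. A i) k"
        unfolding set_integrable_def using m k by (intro integrable_mult_indicator) auto
      from lebesgue_integral_countable_add[OF m _ this] union(1)
      show ?thesis by (simp add: set_lebesgue_integral_def disjoint_family_on_def)
    qed
    then show ?case using f h union by simp
  qed
qed

lemma spin_event: "{y \<in> configs. y j = a} \<in> window_sets {..j}"
  using cylinder_window[of "{j}" "{..j}" "\<lambda>_ z. z = a"] by simp

lemma spin_event_in_P: "prob_on_configs P \<Longrightarrow> {y \<in> configs. y j = a} \<in> sets P"
  using window_in_coord[OF spin_event] subalgebra_coord[of P "{..j}"] by (auto simp: subalgebra_def)

lemma window_in_P: "prob_on_configs P \<Longrightarrow> C \<in> window_sets I \<Longrightarrow> C \<in> sets P"
  using window_in_coord[of C I] subalgebra_coord[of P I] by (auto simp: subalgebra_def)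

lemma lip_mult_local:
  assumes "lip c F" "local_fun r h" "\<And>v. v \<in> pasts \<Longrightarrow> 0 \<le> F v" "\<And>v. v \<in> pasts \<Longrightarrow> F v \<le> 1"
    "\<And>v. h v = 0 \<or> h v = (1::real)"
  shows "lip (\<lambda>n. c n + block r n) (\<lambda>v. F v * h v)"
proof -
  have "0 \<le> h v" "h v \<le> 1" for v using assms(5)[of v] by auto
  then have "lip (block r) h" by (intro lip_local assms(2))
  note 1 = lipD[OF assms(1)] and 2 = lipD[OF this]
  have "\<bar>F v * h v - F w * h w\<bar> \<le> (\<Sum>n. (c n + block r n) * differ v w n)" if vw: "v \<in> pasts" "w \<in> pasts" for v w
  proof -
    have "F v * h v - F w * h w = (F v - F w) * h v + F w * (h v - h w)" by (simp add: algebra_simps)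
    also have "\<bar>\<dots>\<bar> \<le> \<bar>F v - F w\<bar> * 1 + 1 * \<bar>h v - h w\<bar>"
      using assms(3,4)[OF vw(2)] assms(5)[of v]
      by (intro order_trans[OF abs_triangle_ineq] add_mono) (auto simp: abs_mult intro!: mult_left_le_one_le)
    also have "\<dots> \<le> (\<Sum>n. c n * differ v w n) + (\<Sum>n. block r n * differ v w n)"
      using 1(3)[OF vw] 2(3)[OF vw] by simp
    also have "\<dots> = (\<Sum>n. (c n + block r n) * differ v w n)"
      unfolding distrib_right
      by (rule suminf_add[OF summable_mult_differ[OF 1(1,2)] summable_mult_differ[OF 2(1,2)]])
    finally show ?thesis .
  qed
  then show ?thesis using 1(1,2) 2(1,2) by (auto simp: lip_def intro: summable_add add_nonneg_nonneg)
qed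

text \<open>One step of \<open>T\<close> turns the event \<open>C\<close> together with value
  \<open>a\<close> at time \<open>j\<close> into the probability of \<open>a\<close> times the
  indicator of \<open>C\<close>, exactly at each finite stage. The identity survives the limit
  because the kernel has summable weights.\<close>

lemma has_cond_prob_represented:
  assumes P: "prob_on_configs P" and w: "w \<in> pasts"
    and rep: "represents P (j - 1) k w" "represents P j (\<lambda>N. Suc (k N)) w"
  shows "has_cond_prob g P j"
  unfolding has_cond_prob_def
proof
  interpret prob_space P by (rule prob_on_configsD[OF P])
  interpret fs: finite_measure_subalgebra P "coord_algebra {..j - 1}"
    by unfold_locales (rule subalgebra_coord[OF P])
  note sp = prob_on_configsD(2)[OF P]
  fix a :: real assume "a \<in> spins"
  then have a: "a = 1 \<or> a = -1" by (auto simp: spins_def)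
  let ?E = "{y \<in> configs. y j = a}"
  define F where "F v = logistic_phi (a * field v)" for v
  have F: "lip b F" unfolding F_def by (rule lip_phi[OF a])
  have E: "?E \<in> sets P" by (rule spin_event_in_P[OF P])
  have intE: "integrable P (indicator ?E :: _ \<Rightarrow> real)" using E by (simp add: emeasure_eq_measure)
  have win: "(\<integral>x. indicator C x * indicator ?E x \<partial>P) = (\<integral>x. indicator C x * F (past_upto (j - 1) x) \<partial>P)"
    if C: "C \<in> window_sets {..j - 1}" for C
  proof -
    have CE: "C \<inter> ?E \<in> window_sets {..j}"
      using C spin_event window_sets_mono[of "{..j - 1}" "{..j}"] by (intro window_Int) auto
    obtain r where r: "local_fun r (on_past C (j - 1))" using on_past_local[OF C] .
    have step: "T (on_past (C \<inter> ?E) j) v = F v * on_past C (j - 1) v" if v: "v \<in> pasts" for v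
    proof -
      have "on_past (C \<inter> ?E) j (push s v) = of_bool (s = a) * on_past C (j - 1) v" if s: "s = 1 \<or> s = -1" for s
      proof -
        have cf: "unpast j (push s v) \<in> configs" "unpast (j - 1) v \<in> configs"
          using v s by (auto intro!: unpast_configs push_in_pasts)
        have "unpast j (push s v) \<in> C \<longleftrightarrow> unpast (j - 1) v \<in> C"
        proof (rule window_iff[OF C cf])
          fix i assume "i \<in> {..j - 1}"
          then have "nat (j - i) = Suc (nat (j - 1 - i))" by auto
          then show "unpast j (push s v) i = unpast (j - 1) v i" using \<open>i \<in> {..j - 1}\<close> by (simp add: unpast_def)
        qed
        moreover have "unpast j (push s v) j = s" by (simp add: unpast_def)
        ultimately show ?thesis using cf by (auto simp: on_past_def indicator_def)
      qed
      from this[of 1] this[of "-1"] show ?thesis using a by (auto simp: T_def F_def)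
    qed
    have "(\<lambda>N. (T ^^ k N) (\<lambda>v. F v * on_past C (j - 1) v) w) \<longlonglongrightarrow> (\<integral>x. F (past_upto (j - 1) x) * on_past C (j - 1) (past_upto (j - 1) x) \<partial>P)"
      by (rule lip_represents[OF P rep(1) w lip_mult_local[OF F r]])
        (auto simp: F_def on_past_def indicator_def less_imp_le[OF logistic_phi_pos] less_imp_le[OF logistic_phi_lt_1])
    moreover have "(T ^^ Suc (k N)) (on_past (C \<inter> ?E) j) w = (T ^^ k N) (\<lambda>v. F v * on_past C (j - 1) v) w" for N
      unfolding funpow_Suc_right o_apply by (rule Tn_cong[OF w step])
    moreover have "(\<lambda>N. (T ^^ Suc (k N)) (on_past (C \<inter> ?E) j) w) \<longlonglongrightarrow> prob (C \<inter> ?E)"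
      using rep(2) CE unfolding represents_def by blast
    ultimately have "prob (C \<inter> ?E) = (\<integral>x. F (past_upto (j - 1) x) * on_past C (j - 1) (past_upto (j - 1) x) \<partial>P)"
      using LIMSEQ_unique by simp
    also have "\<dots> = (\<integral>x. indicator C x * F (past_upto (j - 1) x) \<partial>P)"
      by (rule Bochner_Integration.integral_cong[OF refl]) (simp add: sp on_past_past_upto[OF C])
    finally show ?thesis
      using window_in_P[OF P CE] by (simp add: indicator_inter_arith[symmetric])
  qed
  have "AE x in P. real_cond_exp P (coord_algebra {..j - 1}) (indicator ?E) x = F (past_upto (j - 1) x)"
  proof (rule fs.real_cond_exp_charact)
    fix A assume A: "A \<in> sets (coord_algebra {..j - 1})"
    show "set_lebesgue_integral P A (indicator ?E) = (\<integral>x\<in>A. F (past_upto (j - 1) x) \<partial>P)"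
      using set_integral_eq_windowI[OF P intE lip_integrable[OF P F] win A]
      by (simp add: set_lebesgue_integral_def)
  qed (use intE lip_integrable[OF P F] lip_measurable[OF F] in auto)
  then show "AE x in P. real_cond_exp P (coord_algebra {..j - 1}) (indicator ?E) x = g (push a (past_upto (j - 1) x))"
    by (simp add: kernel_push F_def)
qed

text \<open>Integrated form of saying that \<open>T f\<close> is the conditional mean of
  \<open>f\<close> given the coordinates before \<open>j\<close>. In this form the step can be
  iterated.\<close>

definition cond_int :: "(int \<Rightarrow> real) measure \<Rightarrow> int \<Rightarrow> bool" where
  "cond_int P j \<longleftrightarrow> (\<forall>c f A. lip c f \<longrightarrow> A \<in> sets (coord_algebra {..j - 1}) \<longrightarrow>
     (\<integral>x. indicator A x * f (past_upto j x) \<partial>P) = (\<integral>x. indicator A x * T f (past_upto (j - 1) x) \<partial>P))"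

text \<open>The bounded test function \<open>h\<close> serves twice: built from \<open>f\<close> it
  yields \<open>cond_int\<close>, and with the martingale in its place it yields the orthogonality
  of increments.\<close>

lemma spin_integral:
  assumes P: "prob_on_configs P" and cp: "has_cond_prob g P j" and a: "a = 1 \<or> a = -1"
    and h: "h \<in> borel_measurable (coord_algebra {..j - 1})" "\<And>x. x \<in> configs \<Longrightarrow> \<bar>h x\<bar> \<le> M"
  defines "p \<equiv> \<lambda>x. logistic_phi (a * field (past_upto (j - 1) x))"
  shows "integrable P (\<lambda>x. h x * indicator {y \<in> configs. y j = a} x)" "integrable P (\<lambda>x. h x * p x)"
    "(\<integral>x. h x * indicator {y \<in> configs. y j = a} x \<partial>P) = (\<integral>x. h x * p x \<partial>P)"
proof -
  interpret prob_space P by (rule prob_on_configsD[OF P])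
  interpret fs: finite_measure_subalgebra P "coord_algebra {..j - 1}"
    by unfold_locales (rule subalgebra_coord[OF P])
  note sp = prob_on_configsD(2)[OF P]
  let ?E = "{y \<in> configs. y j = a}"
  have E: "indicator ?E \<in> borel_measurable P" using spin_event_in_P[OF P, of j a] by measurable
  have hP: "h \<in> borel_measurable P" using measurable_from_subalg[OF subalgebra_coord[OF P] h(1)] .
  have pP: "p \<in> borel_measurable P" unfolding p_def by (rule lip_measurable_P[OF P lip_phi[OF a]])
  have M: "0 \<le> M" using h(2)[of "\<lambda>_. 1"] by (simp add: configs_iff)
  show hE: "integrable P (\<lambda>x. h x * indicator ?E x)"
    using h(2) M by (intro integrable_const_bound[of _ M] AE_I2 borel_measurable_times hP E)
      (auto simp: sp abs_mult indicator_def)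
  show "integrable P (\<lambda>x. h x * p x)"
  proof (intro integrable_const_bound[of _ M] AE_I2 borel_measurable_times hP pP)
    fix x assume "x \<in> space P"
    then have "\<bar>h x\<bar> * \<bar>p x\<bar> \<le> M * 1"
      unfolding p_def using h(2) M logistic_phi_pos logistic_phi_lt_1
      by (intro mult_mono) (auto simp: sp less_imp_le abs_of_pos)
    then show "norm (h x * p x) \<le> M" by (simp add: abs_mult)
  qed
  have "AE x in P. real_cond_exp P (coord_algebra {..j - 1}) (indicator ?E) x = p x"
    using cp a by (auto simp: has_cond_prob_def spins_def kernel_push p_def)
  then have ae: "AE x in P. h x * real_cond_exp P (coord_algebra {..j - 1}) (indicator ?E) x = h x * p x"
    by eventually_elim simp
  have "(\<integral>x. h x * indicator ?E x \<partial>P) = (\<integral>x. h x * real_cond_exp P (coord_algebra {..j - 1}) (indicator ?E) x \<partial>P)"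
    by (rule fs.real_cond_exp_intg(2)[OF hE h(1) E, symmetric])
  also have "\<dots> = (\<integral>x. h x * p x \<partial>P)"
    by (rule integral_cong_AE[OF _ _ ae]) (use hP pP in \<open>auto intro!: borel_measurable_times\<close>)
  finally show "(\<integral>x. h x * indicator ?E x \<partial>P) = (\<integral>x. h x * p x \<partial>P)" .
qed

text \<open>Splitting by the value at time \<open>j\<close> leaves functions of earlier coordinates
  only, which \<open>spin_integral\<close> accepts as test functions.\<close>

lemma has_cond_prob_imp_cond_int:
  assumes P: "prob_on_configs P" and cp: "has_cond_prob g P j"
  shows "cond_int P j"
  unfolding cond_int_def
proof (intro allI impI)
  note sp = prob_on_configsD(2)[OF P]
  fix c f A assume f: "lip c f" and A: "A \<in> sets (coord_algebra {..j - 1})"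
  define E where "E a = {y \<in> configs. y j = a}" for a :: real
  define h where "h a x = indicator A x * f (push a (past_upto (j - 1) x))" for a x
  define p where "p a x = logistic_phi (a * field (past_upto (j - 1) x))" for a x
  have h_bound: "\<bar>h a x\<bar> \<le> \<bar>f (\<lambda>_. 1)\<bar> + suminf c" if "a = 1 \<or> a = -1" "x \<in> configs" for a x
  proof -
    have "\<bar>h a x\<bar> \<le> \<bar>f (push a (past_upto (j - 1) x))\<bar>" by (simp add: h_def indicator_def)
    also have "\<dots> \<le> \<bar>f (\<lambda>_. 1)\<bar> + suminf c"
      by (intro lip_bounded[OF f] push_in_pasts past_upto_pasts that)
    finally show ?thesis .
  qed
  have hm: "h a \<in> borel_measurable (coord_algebra {..j - 1})" if "a = 1 \<or> a = -1" for a
    unfolding h_def using A lip_measurable[OF lip_push[OF f that], of "j - 1"] by measurable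
  have one: "integrable P (\<lambda>x. h a x * indicator (E a) x)" "integrable P (\<lambda>x. h a x * p a x)"
    "(\<integral>x. h a x * indicator (E a) x \<partial>P) = (\<integral>x. h a x * p a x \<partial>P)" if a: "a = 1 \<or> a = -1" for a
    unfolding E_def p_def using spin_integral[OF P cp a hm[OF a] h_bound[OF a]] by blast+
  have "(\<integral>x. indicator A x * f (past_upto j x) \<partial>P) = (\<integral>x. h 1 x * indicator (E 1) x + h (-1) x * indicator (E (-1)) x \<partial>P)"
  proof (rule Bochner_Integration.integral_cong[OF refl])
    fix x assume "x \<in> space P"
    then have x: "x \<in> configs" by (simp add: sp)
    then have "x j = 1 \<or> x j = -1" by (simp add: configs_iff)
    then show "indicator A x * f (past_upto j x) = h 1 x * indicator (E 1) x + h (-1) x * indicator (E (-1)) x"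
      using x by (subst past_upto_push) (auto simp: h_def E_def)
  qed
  also have "\<dots> = (\<integral>x. h 1 x * p 1 x \<partial>P) + (\<integral>x. h (-1) x * p (-1) x \<partial>P)" using one by simp
  also have "\<dots> = (\<integral>x. h 1 x * p 1 x + h (-1) x * p (-1) x \<partial>P)" using one by simp
  also have "\<dots> = (\<integral>x. indicator A x * T f (past_upto (j - 1) x) \<partial>P)"
    by (simp add: h_def p_def T_def algebra_simps)
  finally show "(\<integral>x. indicator A x * f (past_upto j x) \<partial>P) = (\<integral>x. indicator A x * T f (past_upto (j - 1) x) \<partial>P)" .
qed

lemma cond_int_iter:
  assumes "\<And>i. i < n \<Longrightarrow> cond_int P (j + int i)" "lip c f" "A \<in> sets (coord_algebra {..j - 1})"
  shows "(\<integral>x. indicator A x * f (past_upto (j + int n - 1) x) \<partial>P)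
    = (\<integral>x. indicator A x * (T ^^ n) f (past_upto (j - 1) x) \<partial>P)"
  using assms(1,2)
proof (induction n arbitrary: c f)
  case (Suc n)
  have A: "A \<in> sets (coord_algebra {..j + int n - 1})"
    using assms(3) coord_algebra_mono[of "{..j - 1}" "{..j + int n - 1}"] by auto
  have "(\<integral>x. indicator A x * f (past_upto (j + int n) x) \<partial>P) = (\<integral>x. indicator A x * T f (past_upto (j + int n - 1) x) \<partial>P)"
    using Suc.prems(1)[of n] Suc.prems(2) A unfolding cond_int_def by blast
  also have "\<dots> = (\<integral>x. indicator A x * (T ^^ n) (T f) (past_upto (j - 1) x) \<partial>P)"
    by (rule Suc.IH[OF _ lip_T[OF Suc.prems(2)]]) (use Suc.prems(1) in auto)
  finally show ?case by (simp only: funpow_Suc_right o_apply) (simp add: algebra_simps)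
qed simp

end

section \<open>Started processes and the \<open>g\<close>-measure\<close>

lemma window_bounded:
  assumes "C \<in> window_sets UNIV" obtains m :: nat where "C \<in> window_sets {..int m - 1}"
proof -
  obtain J where "finite J" "J \<subseteq> UNIV" "depends_on C J"
    using window_setsE[OF assms] .
  note J = depends_onD(1)[OF this(3)] this(1,2) depends_onD(2)[OF this(3)]
  obtain m where m: "\<And>i. i \<in> J \<Longrightarrow> nat i < m"
    using finite_imageI[OF J(2), of nat] unfolding finite_nat_set_iff_bounded by blast
  have "C \<in> window_sets {..int m - 1}"
  proof (rule window_setsI[OF J(1,2)])
    show "J \<subseteq> {..int m - 1}" using m by force
  qed (rule J(4))
  then show ?thesis by (rule that)
qed

lemma shift_measurable:
  "(\<lambda>x i. x (i + d)) \<in> measurable (coord_algebra ((\<lambda>i. i + d) ` I)) (coord_algebra I)"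
  unfolding coord_algebra_def[of I]
proof (rule measurable_measure_of)
  fix Y assume "Y \<in> {{x \<in> configs. x i \<in> B} |i B. i \<in> I \<and> B \<subseteq> spins}"
  then obtain i B where Y: "Y = {x \<in> configs. x i \<in> B}" "i \<in> I" "B \<subseteq> spins" by blast
  have "(\<lambda>x i. x (i + d)) -` Y \<inter> space (coord_algebra ((\<lambda>i. i + d) ` I)) = {x \<in> configs. x (i + d) \<in> B}"
    using Y by (auto simp: configs_iff)
  also have "\<dots> \<in> sets (coord_algebra ((\<lambda>i. i + d) ` I))"
    unfolding sets_coord_algebra using Y by (intro sigma_sets.Basic) blast
  finally show "(\<lambda>x i. x (i + d)) -` Y \<inter> space (coord_algebra ((\<lambda>i. i + d) ` I)) \<in> sets (coord_algebra ((\<lambda>i. i + d) ` I))" .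
qed (auto simp: configs_iff)

lemma shift_measurable_P:
  assumes "prob_on_configs P" shows "(\<lambda>x i. x (i + d)) \<in> measurable P P"
proof -
  have surj: "range (\<lambda>i :: int. i + d) = UNIV" by (rule surjI[of _ "\<lambda>i. i - d"]) simp
  show ?thesis
    using shift_measurable[of d UNIV] assms measurable_cong_sets[of P "coord_algebra UNIV" P "coord_algebra UNIV"]
    unfolding surj by (simp add: prob_on_configs_def)
qed

lemma g_measureD:
  assumes "g_measure k P" shows "stationary P" "prob_on_configs P"
  using assms by (auto simp: g_measure_def stationary_def)

lemma stationary_integral:
  fixes f :: "(int \<Rightarrow> real) \<Rightarrow> real"
  assumes "stationary P" "f \<in> borel_measurable P"
  shows "(\<integral>x. f (\<lambda>i. x (i + 1)) \<partial>P) = (\<integral>x. f x \<partial>P)"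
proof -
  have "prob_on_configs P" using assms(1) by (simp add: stationary_def)
  from integral_distr[OF shift_measurable_P[OF this, of 1] assms(2)] show ?thesis
    using assms(1) by (simp add: stationary_def)
qed

context ising begin

lemma window_lip:
  assumes "C \<in> window_sets {..j}" obtains c where "lip c (on_past C j)"
proof -
  obtain r where "local_fun r (on_past C j)" using on_past_local[OF assms] .
  then have "lip (block r) (on_past C j)" by (rule lip_local) (auto simp: on_past_def indicator_def)
  then show ?thesis by (rule that)
qed

text \<open>Symbols drawn after time \<open>j\<close> do not affect an event of the times up to
  \<open>j\<close>, so the corresponding \<open>d\<close> steps average a constant.\<close>

lemma Tn_on_past_shift:
  assumes "C \<in> window_sets {..j}" "v \<in> pasts"
  shows "(T ^^ (m + d)) (on_past C (j + int d)) v = (T ^^ m) (on_past C j) v"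
  unfolding funpow_add o_apply
  by (rule Tn_cong[OF assms(2) Tn_unique_shift]) (auto intro: on_past_shift[OF assms(1)])

definition starts :: "(int \<Rightarrow> real) measure \<Rightarrow> (nat \<Rightarrow> real) \<Rightarrow> bool" where
  "starts P w \<longleftrightarrow> prob_on_configs P \<and> (AE x in P. past_upto (-1) x = w) \<and> (\<forall>j\<ge>0. has_cond_prob g P j)"

text \<open>Iterating the conditional law forces the window probabilities to be values of
  \<open>T ^^ m\<close> at \<open>w\<close>; uniqueness of the started process follows.\<close>

lemma starts_window:
  assumes "starts P w" "w \<in> pasts" "C \<in> window_sets {..int m - 1}"
  shows "measure P C = (T ^^ m) (on_past C (int m - 1)) w"
proof -
  have P: "prob_on_configs P" using assms(1) by (simp add: starts_def)
  interpret prob_space P by (rule prob_on_configsD[OF P])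
  note sp = prob_on_configsD(2)[OF P]
  have ae: "AE x in P. past_upto (-1) x = w" using assms(1) by (simp add: starts_def)
  obtain c where lip: "lip c (on_past C (int m - 1))" using window_lip[OF assms(3)] .
  have top: "configs \<in> sets (coord_algebra {..0 - 1})" using sets.top[of "coord_algebra {..0 - 1}"] by simp
  have "(\<integral>x. indicator configs x * on_past C (int m - 1) (past_upto (int m - 1) x) \<partial>P)
      = (\<integral>x. indicator configs x * (T ^^ m) (on_past C (int m - 1)) (past_upto (-1) x) \<partial>P)"
    using cond_int_iter[OF has_cond_prob_imp_cond_int[OF P] lip top, of m] assms(1)
    by (simp add: starts_def)
  also have "\<dots> = (\<integral>x. (T ^^ m) (on_past C (int m - 1)) w \<partial>P)"
  proof (rule integral_cong_AE)
    show "AE x in P. indicator configs x * (T ^^ m) (on_past C (int m - 1)) (past_upto (-1) x) = (T ^^ m) (on_past C (int m - 1)) w"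
      using ae AE_space by eventually_elim (simp add: sp)
    show "(\<lambda>x. indicator configs x * (T ^^ m) (on_past C (int m - 1)) (past_upto (-1) x)) \<in> borel_measurable P"
      using indicator_lip_integrable[OF P lip_Tn[OF lip] top] by blast
  qed simp
  also have "(\<integral>x. indicator configs x * on_past C (int m - 1) (past_upto (int m - 1) x) \<partial>P) = (\<integral>x. indicator C x \<partial>P)"
    by (rule Bochner_Integration.integral_cong[OF refl]) (simp add: sp on_past_past_upto[OF assms(3)])
  finally show ?thesis using window_in_P[OF P assms(3)] by (simp add: prob_space)
qed

text \<open>For an event of the times before \<open>m\<close> the approximating values are constant
  from \<open>N = m\<close> on, so the limits that \<open>ex_represented\<close> asks for exist
  trivially.\<close>

lemma ex_starts:
  assumes w: "w \<in> pasts" shows "\<exists>P. starts P w"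
proof -
  have const: "(T ^^ N) (on_past C (int N - 1)) w = (T ^^ m) (on_past C (int m - 1)) w"
    if "C \<in> window_sets {..int m - 1}" "m \<le> N" for C m N
    using Tn_on_past_shift[OF that(1) w, of m "N - m"] that(2) by (simp add: of_nat_diff)
  have lim: "(\<lambda>N. (T ^^ N) (on_past C (int N - 1)) w) \<longlonglongrightarrow> (T ^^ m) (on_past C (int m - 1)) w"
    if "C \<in> window_sets {..int m - 1}" for C m
    by (rule tendsto_eventually, unfold eventually_sequentially) (use const[OF that] in blast)
  have "\<exists>P. prob_on_configs P \<and> (\<forall>C\<in>window_sets UNIV. (\<lambda>N. (T ^^ N) (on_past C (int N - 1)) w) \<longlonglongrightarrow> measure P C)"
  proof (rule ex_represented[OF w])
    fix C assume "C \<in> window_sets (UNIV :: int set)"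
    then obtain m where "C \<in> window_sets {..int m - 1}" by (rule window_bounded)
    then show "convergent (\<lambda>N. (T ^^ N) (on_past C (int N - 1)) w)" using lim convergentI by blast
  qed
  then obtain P where P: "prob_on_configs P"
    "\<And>C. C \<in> window_sets UNIV \<Longrightarrow> (\<lambda>N. (T ^^ N) (on_past C (int N - 1)) w) \<longlonglongrightarrow> measure P C" by blast
  interpret prob_space P by (rule prob_on_configsD[OF P(1)])
  have meas: "measure P C = (T ^^ m) (on_past C (int m - 1)) w" if "C \<in> window_sets {..int m - 1}" for C m
    using LIMSEQ_unique[OF P(2) lim[OF that]] that window_sets_mono[of "{..int m - 1}" UNIV] by auto
  have rep: "represents P (int m - 1) (\<lambda>_. m) w" for m
    unfolding represents_def using meas by simp
  have "has_cond_prob g P j" if "j \<ge> 0" for j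
    using that rep[of "nat j"] rep[of "Suc (nat j)"] by (intro has_cond_prob_represented[OF P(1) w]) simp_all
  moreover have "AE x in P. past_upto (-1) x = w"
  proof -
    have "AE x in P. past_upto (-1) x i = w i" for i
    proof -
      let ?C = "{x \<in> configs. x (- 1 - int i) = w i}"
      have C: "?C \<in> window_sets {..- 1}"
        using cylinder_window[of "{- 1 - int i}" "{..-1}" "\<lambda>_ z. z = w i"] by simp
      \<comment> \<open>Here \<open>m = 0\<close>: coordinates before time 0 are read from
        \<open>w\<close>, with no symbol drawn.\<close>
      have "prob ?C = on_past ?C (-1) w" using meas[of ?C 0] C by simp
      also have "\<dots> = 1" using unpast_configs[OF w] by (simp add: on_past_def unpast_def)
      finally have "AE x in P. x \<in> ?C" using prob_eq_1[OF window_in_P[OF P(1) C]] by simp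
      then show ?thesis by eventually_elim (simp add: past_upto_def)
    qed
    then have "AE x in P. \<forall>i. past_upto (-1) x i = w i" by (simp add: AE_all_countable)
    then show ?thesis by eventually_elim auto
  qed
  ultimately show ?thesis using P(1) unfolding starts_def by blast
qed

lemma starts_unique:
  assumes "starts P w" "starts Q w" "w \<in> pasts" shows "P = Q"
proof (rule prob_on_configs_eqI)
  fix C assume "C \<in> window_sets (UNIV :: int set)"
  then obtain m where "C \<in> window_sets {..int m - 1}" by (rule window_bounded)
  then show "measure P C = measure Q C" using starts_window assms by simp
qed (use assms in \<open>auto simp: starts_def\<close>)

text \<open>Existence and uniqueness give the definite description in \<open>started_from\<close>
  its meaning.\<close>

lemma starts_started_from: "w \<in> pasts \<Longrightarrow> starts (started_from g w) w"
proof -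
  assume w: "w \<in> pasts"
  have "\<exists>!P. starts P w" using ex_starts[OF w] starts_unique[OF _ _ w] by blast
  then have "starts (THE P. starts P w) w" by (rule theI')
  then show ?thesis by (simp add: started_from_def starts_def[abs_def])
qed

section \<open>Existence and uniqueness of the \<open>g\<close>-measure\<close>

lemma Tn_convergent:
  assumes f: "lip c f" and w: "w \<in> pasts" shows "convergent (\<lambda>N. (T ^^ N) f w)"
proof (rule Cauchy_convergent, rule CauchyI)
  fix e :: real assume "0 < e"
  then obtain N0 where N0: "\<And>N. N \<ge> N0 \<Longrightarrow> suminf ((step ^^ N) c) < e / 2"
    using order_tendstoD(2)[OF mass_tendsto_0[OF lip_weights[OF f]], of "e / 2"] by (auto simp: eventually_sequentially)
  let ?s = "suminf ((step ^^ N0) c)"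
  \<comment> \<open>Steps beyond \<open>N0\<close> only average \<open>(T ^^ N0) f\<close>, whose
    oscillation over all pasts is at most \<open>?s\<close>.\<close>
  have near: "\<bar>(T ^^ N) f w - (T ^^ N0) f w\<bar> \<le> ?s" if "N0 \<le> N" for N
  proof -
    have "\<bar>(T ^^ N0) f u - (T ^^ N0) f w\<bar> \<le> ?s" if "u \<in> pasts" for u by (rule Tn_osc[OF f that w])
    then have "(T ^^ N0) f u \<le> (T ^^ N0) f w + ?s" "(T ^^ N0) f w - ?s \<le> (T ^^ N0) f u" if "u \<in> pasts" for u
      using that abs_le_D1 abs_le_D2 by (fastforce simp: algebra_simps)+
    then have "(T ^^ (N - N0)) ((T ^^ N0) f) w \<le> (T ^^ N0) f w + ?s" "(T ^^ N0) f w - ?s \<le> (T ^^ (N - N0)) ((T ^^ N0) f) w"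
      by (blast intro: Tn_le[OF w] Tn_ge[OF w])+
    moreover have "(T ^^ (N - N0)) ((T ^^ N0) f) = (T ^^ N) f"
      using that funpow_add[of "N - N0" N0 T] by (simp add: o_def fun_eq_iff)
    ultimately show ?thesis by (intro abs_leI) simp_all
  qed
  have tri: "\<bar>p - q\<bar> < e" if "\<bar>p - s\<bar> \<le> ?s" "\<bar>q - s\<bar> \<le> ?s" for p q s
    using that N0[of N0] by linarith
  have "norm ((T ^^ m) f w - (T ^^ n) f w) < e" if "m \<ge> N0" "n \<ge> N0" for m n
    unfolding real_norm_def by (rule tri[OF near[OF that(1)] near[OF that(2)]])
  then show "\<exists>M. \<forall>m\<ge>M. \<forall>n\<ge>M. norm ((T ^^ m) f w - (T ^^ n) f w) < e" by blast
qed

lemma ex_g_measure: "\<exists>P. g_measure g P"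
proof -
  define w :: "nat \<Rightarrow> real" where "w = (\<lambda>_. 1)"
  have w: "w \<in> pasts" by (simp add: w_def pasts_iff)
  have conv: "convergent (\<lambda>N. (T ^^ N) (on_past C j) w)" if "C \<in> window_sets {..j}" for C j
    using window_lip[OF that] Tn_convergent[OF _ w] by metis
  \<comment> \<open>\<open>N + N\<close> steps ending at time \<open>N\<close> amount to a start
    from \<open>w\<close> occupying the times up to \<open>- N\<close>. For an event up to time
    \<open>j\<close> only \<open>N + j\<close> of the steps matter, so one sequence serves all
    \<open>j\<close>.\<close>
  have red: "(T ^^ (N + N)) (on_past C (int N)) w = (T ^^ nat (int N + j)) (on_past C j) w"
    if C: "C \<in> window_sets {..j}" and N: "nat \<bar>j\<bar> \<le> N" for C j N
  proof -
    have "int N = j + int (nat (int N - j))" "N + N = nat (int N + j) + nat (int N - j)" using N by auto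
    then show ?thesis using Tn_on_past_shift[OF C w, of "nat (int N + j)" "nat (int N - j)"] by metis
  qed
  have lim: "(\<lambda>N. (T ^^ (N + N)) (on_past C (int N)) w) \<longlonglongrightarrow> lim (\<lambda>N. (T ^^ N) (on_past C j) w)"
    if C: "C \<in> window_sets {..j}" for C j
  proof -
    have "(\<lambda>N. (T ^^ N) (on_past C j) w) \<longlonglongrightarrow> lim (\<lambda>N. (T ^^ N) (on_past C j) w)"
      using conv[OF C] by (simp add: convergent_LIMSEQ_iff)
    moreover have "filterlim (\<lambda>N. nat (int N + j)) at_top sequentially"
      unfolding filterlim_at_top
    proof
      fix Z show "\<forall>\<^sub>F N in sequentially. Z \<le> nat (int N + j)"
        unfolding eventually_sequentially by (rule exI[of _ "Z + nat \<bar>j\<bar>"]) auto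
    qed
    ultimately have "(\<lambda>N. (T ^^ nat (int N + j)) (on_past C j) w) \<longlonglongrightarrow> lim (\<lambda>N. (T ^^ N) (on_past C j) w)"
      by (rule filterlim_compose)
    then show ?thesis
      by (rule Lim_transform_eventually) (use red[OF C] in \<open>auto simp: eventually_sequentially intro!: exI[of _ "nat \<bar>j\<bar>"]\<close>)
  qed
  have "\<exists>P. prob_on_configs P \<and> (\<forall>C\<in>window_sets UNIV. (\<lambda>N. (T ^^ (N + N)) (on_past C (int N)) w) \<longlonglongrightarrow> measure P C)"
  proof (rule ex_represented[OF w])
    fix C assume "C \<in> window_sets (UNIV :: int set)"
    then obtain m where "C \<in> window_sets {..int m - 1}" by (rule window_bounded)
    then show "convergent (\<lambda>N. (T ^^ (N + N)) (on_past C (int N)) w)" using lim convergentI by blast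
  qed
  then obtain P where P: "prob_on_configs P"
    "\<And>C. C \<in> window_sets UNIV \<Longrightarrow> (\<lambda>N. (T ^^ (N + N)) (on_past C (int N)) w) \<longlonglongrightarrow> measure P C" by blast
  have rep: "represents P j (\<lambda>N. N) w" for j
    unfolding represents_def
  proof
    fix C assume C: "C \<in> window_sets {..j}"
    then have "measure P C = lim (\<lambda>N. (T ^^ N) (on_past C j) w)"
      using LIMSEQ_unique[OF P(2) lim[OF C]] window_sets_mono[of "{..j}" UNIV] by auto
    then show "(\<lambda>N. (T ^^ N) (on_past C j) w) \<longlonglongrightarrow> measure P C"
      using conv[OF C] by (simp add: convergent_LIMSEQ_iff)
  qed
  \<comment> \<open>\<open>has_cond_prob_represented\<close> wants one more step at time
    \<open>j\<close> than at time \<open>j - 1\<close>; the shifted sequence has the same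
    limit.\<close>
  have repS: "represents P j (\<lambda>N. Suc N) w" for j
    using rep[of j] unfolding represents_def by (auto intro: LIMSEQ_Suc simp del: funpow.simps)
  have "has_cond_prob g P 0" by (rule has_cond_prob_represented[OF P(1) w rep repS])
  moreover have "stationary P"
    unfolding stationary_def
  proof (intro conjI P(1) prob_on_configs_eqI)
    let ?s = "\<lambda>x i. x (i + 1)" and ?D = "distr P P (\<lambda>x i. x (i + 1 :: int))"
    have m: "?s \<in> measurable P P" by (rule shift_measurable_P[OF P(1)])
    interpret prob_space P by (rule prob_on_configsD[OF P(1)])
    show "prob_on_configs ?D" using P(1) prob_space_distr[OF m] by (simp add: prob_on_configs_def)
    fix C assume "C \<in> window_sets (UNIV :: int set)"
    then obtain k where C: "C \<in> window_sets {..int k - 1}" by (rule window_bounded)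
    define j where "j = int k - 1"
    obtain J where "finite J" "J \<subseteq> {..j}" "depends_on C J"
      using window_setsE[OF C] unfolding j_def .
    note J = depends_onD(1)[OF this(3)] this(1,2) depends_onD(2)[OF this(3)]
    define C' where "C' = {x \<in> configs. ?s x \<in> C}"
    have s: "?s x \<in> configs" if "x \<in> configs" for x using that by (simp add: configs_iff)
    have C': "C' \<in> window_sets {..j + 1}"
    proof (rule window_setsI[of _ "(\<lambda>i. i + 1) ` J"])
      fix x y assume "x \<in> configs" "y \<in> configs" "\<And>i. i \<in> (\<lambda>i. i + 1) ` J \<Longrightarrow> x i = y i" "x \<in> C'"
      then show "y \<in> C'" using J(4)[OF s s, of x y] by (auto simp: C'_def)
    qed (use J in \<open>auto simp: C'_def\<close>)
    \<comment> \<open>Shifting an event together with its reference time leaves the function of the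
      past unchanged, and \<open>rep\<close> uses the same number of steps at every time. Hence the
      limit is shift invariant.\<close>
    have "on_past C' (j + 1) u = on_past C j u" if u: "u \<in> pasts" for u
    proof -
      have "?s (unpast (j + 1) u) = unpast j u" by (auto simp: unpast_def algebra_simps)
      then show ?thesis using unpast_configs[OF u, of "j + 1"] by (simp add: on_past_def C'_def indicator_def)
    qed
    then have eq: "(T ^^ N) (on_past C' (j + 1)) w = (T ^^ N) (on_past C j) w" for N by (intro Tn_cong[OF w])
    have "(\<lambda>N. (T ^^ N) (on_past C' (j + 1)) w) \<longlonglongrightarrow> measure P C'"
      using rep[of "j + 1"] C' unfolding represents_def by blast
    then have "(\<lambda>N. (T ^^ N) (on_past C j) w) \<longlonglongrightarrow> measure P C'" unfolding eq .
    moreover have "(\<lambda>N. (T ^^ N) (on_past C j) w) \<longlonglongrightarrow> measure P C"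
      using rep[of j] C unfolding represents_def j_def by blast
    ultimately have "measure P C' = measure P C" by (rule LIMSEQ_unique)
    moreover have "measure ?D C = measure P C'"
      using P(1) window_in_P[OF P(1) C]
      by (subst measure_distr[OF m]) (auto simp: C'_def prob_on_configs_def intro!: arg_cong[where f="measure P"])
    ultimately show "measure ?D C = measure P C" by simp
  qed
  ultimately show ?thesis unfolding g_measure_def by blast
qed

text \<open>The definition of a \<open>g\<close>-measure speaks of time 0 only; stationarity carries
  the conditional law to later times.\<close>

lemma g_measure_cond_int:
  assumes "g_measure g P" shows "cond_int P (int n)"
proof (induction n)
  case 0
  show ?case using assms has_cond_prob_imp_cond_int by (auto simp: g_measure_def stationary_def)
next
  case (Suc n)
  note st = g_measureD(1)[OF assms] and P = g_measureD(2)[OF assms]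
  note sp = prob_on_configsD(2)[OF P]
  let ?s = "\<lambda>x i. x (i + 1 :: int)"
  show ?case
    unfolding cond_int_def
  proof (intro allI impI)
    fix c f A assume f: "lip c f" and A: "A \<in> sets (coord_algebra {..int (Suc n) - 1})"
    \<comment> \<open>Chosen so that the shifted configuration lies in \<open>A'\<close> when the
      original one lies in \<open>A\<close>, while the coordinates involved now end at
      \<open>n - 1\<close>.\<close>
    define A' where "A' = {y \<in> configs. (\<lambda>i. y (i + (-1))) \<in> A}"
    have "(\<lambda>i. i + (-1 :: int)) ` {..int n} = {..int n - 1}"
    proof (intro set_eqI iffI)
      fix i assume "i \<in> {..int n - 1}"
      then show "i \<in> (\<lambda>i. i + (-1 :: int)) ` {..int n}" by (intro image_eqI[of _ _ "i + 1"]) auto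
    qed auto
    then have A': "A' \<in> sets (coord_algebra {..int n - 1})"
      using measurable_sets[OF shift_measurable[of "-1" "{..int n}"], of A] A
      by (simp add: A'_def vimage_def Int_def conj_commute)
    have key: "(\<integral>x. indicator A x * h (past_upto (k + 1) x) \<partial>P) = (\<integral>x. indicator A' x * h (past_upto k x) \<partial>P)"
      if h: "lip d h" for h d k
    proof -
      have "(\<integral>x. indicator A x * h (past_upto (k + 1) x) \<partial>P) = (\<integral>x. indicator A' (?s x) * h (past_upto k (?s x)) \<partial>P)"
      proof (rule Bochner_Integration.integral_cong[OF refl])
        fix x assume "x \<in> space P"
        then have "?s x \<in> configs" by (simp add: sp configs_iff)
        then have "indicator A' (?s x) = (indicator A x :: real)" by (simp add: A'_def indicator_def)
        moreover have "past_upto k (?s x) = past_upto (k + 1) x" by (auto simp: past_upto_def algebra_simps)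
        ultimately show "indicator A x * h (past_upto (k + 1) x) = indicator A' (?s x) * h (past_upto k (?s x))" by simp
      qed
      also have "\<dots> = (\<integral>x. indicator A' x * h (past_upto k x) \<partial>P)"
        using indicator_lip_integrable[OF P h A', of k] by (intro stationary_integral[OF st]) blast
      finally show ?thesis .
    qed
    have "(\<integral>x. indicator A' x * f (past_upto (int n) x) \<partial>P) = (\<integral>x. indicator A' x * T f (past_upto (int n - 1) x) \<partial>P)"
      using Suc f A' unfolding cond_int_def by blast
    then show "(\<integral>x. indicator A x * f (past_upto (int (Suc n)) x) \<partial>P) = (\<integral>x. indicator A x * T f (past_upto (int (Suc n) - 1) x) \<partial>P)"
      using key[OF f, of "int n"] key[OF lip_T[OF f], of "int n - 1"] by (simp add: add.commute)
  qed
qed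

lemma g_measure_shift:
  assumes "g_measure g P" "lip c f"
  shows "(\<integral>x. f (past_upto (j + int n) x) \<partial>P) = (\<integral>x. f (past_upto j x) \<partial>P)"
proof (induction n)
  case (Suc n)
  note st = g_measureD(1)[OF assms(1)] and P = g_measureD(2)[OF assms(1)]
  have "past_upto (j + int n) (\<lambda>i. x (i + 1)) = past_upto (j + int (Suc n)) x" for x
    by (auto simp: past_upto_def algebra_simps)
  then show ?case
    using stationary_integral[OF st lip_measurable_P[OF P assms(2)], of "j + int n"] Suc by simp
qed simp

lemma g_measure_iter:
  assumes "g_measure g P" "lip c f" "A \<in> sets (coord_algebra {..-1})"
  shows "(\<integral>x. indicator A x * f (past_upto (int n - 1) x) \<partial>P) = (\<integral>x. indicator A x * (T ^^ n) f (past_upto (-1) x) \<partial>P)"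
  using cond_int_iter[of n P 0 c f A] g_measure_cond_int[OF assms(1)] assms(2,3) by simp

lemma g_measure_Tn:
  assumes "g_measure g P" "lip c f"
  shows "(\<integral>x. (T ^^ n) f (past_upto (-1) x) \<partial>P) = (\<integral>x. f (past_upto (-1) x) \<partial>P)"
proof -
  have sp: "space P = configs" using assms(1) by (simp add: g_measure_def stationary_def prob_on_configs_def)
  have eq: "(\<integral>x. indicator configs x * h x \<partial>P) = (\<integral>x. h x \<partial>P)" for h :: "_ \<Rightarrow> real"
    by (rule Bochner_Integration.integral_cong[OF refl]) (simp add: sp)
  have "configs \<in> sets (coord_algebra {..-1})" using sets.top[of "coord_algebra {..-1}"] by simp
  from g_measure_iter[OF assms this, of n] show ?thesis
    unfolding eq using g_measure_shift[OF assms, of "-1" n] by (simp add: algebra_simps)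
qed

text \<open>Invariance replaces \<open>f\<close> by \<open>(T ^^ n) f\<close> under the integral,
  and that function is constant up to the remaining weight.\<close>

lemma g_measure_limit:
  assumes P: "g_measure g P" and f: "lip c f" and w: "w \<in> pasts"
  shows "\<bar>(\<integral>x. f (past_upto (-1) x) \<partial>P) - (T ^^ n) f w\<bar> \<le> suminf ((step ^^ n) c)"
proof -
  note P' = g_measureD(2)[OF P]
  interpret prob_space P by (rule prob_on_configsD[OF P'])
  have int: "integrable P (\<lambda>x. (T ^^ n) f (past_upto (-1) x))" by (rule lip_integrable[OF P' lip_Tn[OF f]])
  have eq: "(\<integral>x. f (past_upto (-1) x) \<partial>P) - (T ^^ n) f w = (\<integral>x. (T ^^ n) f (past_upto (-1) x) - (T ^^ n) f w \<partial>P)"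
    using g_measure_Tn[OF P f, of n] int by (simp add: prob_space)
  have "\<bar>(\<integral>x. f (past_upto (-1) x) \<partial>P) - (T ^^ n) f w\<bar> \<le> (\<integral>x. \<bar>(T ^^ n) f (past_upto (-1) x) - (T ^^ n) f w\<bar> \<partial>P)"
    unfolding eq by (rule integral_abs_bound)
  also have "\<dots> \<le> (\<integral>x. suminf ((step ^^ n) c) \<partial>P)"
    using P' int by (intro integral_mono) (auto simp: prob_on_configs_def intro!: Tn_osc[OF f _ w] past_upto_pasts)
  finally show ?thesis by (simp add: prob_space)
qed

lemma g_measure_unique:
  assumes "g_measure g P" "g_measure g Q" shows "P = Q"
proof -
  define w :: "nat \<Rightarrow> real" where "w = (\<lambda>_. 1)"
  have w: "w \<in> pasts" by (simp add: w_def pasts_iff)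
  have lim: "(\<lambda>n. (T ^^ n) (on_past C j) w) \<longlonglongrightarrow> measure R C"
    if R: "g_measure g R" and C: "C \<in> window_sets {..j}" and j: "j \<ge> -1" for R C j
  proof -
    note R' = g_measureD(2)[OF R]
    interpret prob_space R by (rule prob_on_configsD[OF R'])
    obtain c where f: "lip c (on_past C j)" using window_lip[OF C] .
    have "measure R C = (\<integral>x. indicator C x \<partial>R)" using window_in_P[OF R' C] by simp
    also have "\<dots> = (\<integral>x. on_past C j (past_upto j x) \<partial>R)"
      using R' by (intro Bochner_Integration.integral_cong[OF refl])
        (simp add: prob_on_configs_def on_past_past_upto[OF C])
    also have "\<dots> = (\<integral>x. on_past C j (past_upto (-1) x) \<partial>R)"
      using g_measure_shift[OF R f, of "-1" "nat (j + 1)"] j by simp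
    finally have eq: "measure R C = (\<integral>x. on_past C j (past_upto (-1) x) \<partial>R)" .
    have "(\<lambda>n. (T ^^ n) (on_past C j) w - measure R C) \<longlonglongrightarrow> 0"
      by (rule Lim_null_comparison[OF always_eventually mass_tendsto_0[OF lip_weights[OF f]]])
        (use g_measure_limit[OF R f w] in \<open>simp add: eq abs_minus_commute\<close>)
    then show ?thesis by (simp add: LIM_zero_iff)
  qed
  show ?thesis
  proof (rule prob_on_configs_eqI)
    fix C assume "C \<in> window_sets (UNIV :: int set)"
    then obtain m where "C \<in> window_sets {..int m - 1}" by (rule window_bounded)
    from LIMSEQ_unique[OF lim[OF assms(1) this] lim[OF assms(2) this]]
    show "measure P C = measure Q C" by simp
  qed (use assms in \<open>auto simp: g_measure_def stationary_def\<close>)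
qed

end

section \<open>Weak Bernoulli property\<close>

text \<open>Each set of the generated sigma-algebra is close in symmetric difference to one of the
  algebra, for \<open>M\<close> and \<open>N\<close> simultaneously because closeness is measured by
  their sum \<open>s\<close>.\<close>

lemma algebra_approx:
  assumes alg: "algebra \<Omega> W" and M: "finite_measure M" "space M = \<Omega>" "sets M = sigma_sets \<Omega> W"
    and N: "finite_measure N" "space N = \<Omega>" "sets N = sigma_sets \<Omega> W"
    and d: "\<And>C. C \<in> W \<Longrightarrow> \<bar>measure M C - measure N C\<bar> \<le> d"
    and A: "A \<in> sigma_sets \<Omega> W"
  shows "\<bar>measure M A - measure N A\<bar> \<le> d"
proof -
  interpret algebra \<Omega> W by (rule alg)
  interpret M: finite_measure M by (rule M)
  interpret N: finite_measure N by (rule N)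
  define s where "s X = measure M X + measure N X" for X
  let ?S = "sigma_sets \<Omega> W"
  note sM = M(3) and sN = N(3)
  have WS: "C \<in> W \<Longrightarrow> C \<in> ?S" for C by (rule sigma_sets.Basic)
  have DS: "X - Y \<in> ?S" if "X \<in> ?S" "Y \<in> ?S" for X Y using sets.Diff[of X M Y] that sM by simp
  have US: "X \<union> Y \<in> ?S" if "X \<in> ?S" "Y \<in> ?S" for X Y using sets.Un[of X M Y] that sM by simp
  have s_mono: "s X \<le> s Y" if "X \<subseteq> Y" "Y \<in> ?S" for X Y
    unfolding s_def using that sM sN by (intro add_mono M.finite_measure_mono N.finite_measure_mono) auto
  have s_sub: "s (X \<union> Y) \<le> s X + s Y" if "X \<in> ?S" "Y \<in> ?S" for X Y
    unfolding s_def using measure_Un_le[of X M Y] measure_Un_le[of X N Y] that sM sN by simp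
  have s_sum: "s (\<Union>i<n. X i) \<le> (\<Sum>i<n. s (X i))" if "\<And>i. X i \<in> ?S" for X :: "nat \<Rightarrow> 'a set" and n
  proof -
    show ?thesis
      unfolding s_def sum.distrib using that sM sN by (intro add_mono measure_UNION_le) auto
  qed
  have approx: "\<forall>e>0. \<exists>C\<in>W. s ((A - C) \<union> (C - A)) < e"
    using A
  proof (induction A rule: sigma_sets.induct)
    case (Basic a)
    then show ?case by (auto intro!: bexI[of _ a] simp: s_def)
  next
    case Empty
    show ?case by (auto intro!: bexI[of _ "{}"] simp: s_def)
  next
    case (Compl a)
    show ?case
    proof (intro allI impI)
      fix e :: real assume "0 < e"
      then obtain C where C: "C \<in> W" "s ((a - C) \<union> (C - a)) < e" using Compl.IH by blast
      have "a \<subseteq> \<Omega>" "C \<subseteq> \<Omega>" using sigma_sets_into_sp[OF space_closed Compl.hyps] C(1) space_closed by auto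
      then have "((\<Omega> - a) - (\<Omega> - C)) \<union> ((\<Omega> - C) - (\<Omega> - a)) = (a - C) \<union> (C - a)" by blast
      then show "\<exists>C\<in>W. s ((\<Omega> - a - C) \<union> (C - (\<Omega> - a))) < e" using C by (intro bexI[of _ "\<Omega> - C"]) auto
    qed
  next
    case (Union a)
    let ?U = "\<Union>i. a i"
    have Us: "?U \<in> ?S" using Union.hyps by (rule sigma_sets.Union)
    have part: "(\<Union>i<n. a i) \<in> ?S" for n
      using sets.finite_UN[of "{..<n}" a M] Union.hyps sM by auto
    have lim: "(\<lambda>n. s (\<Union>i<n. a i)) \<longlonglongrightarrow> s ?U"
    proof -
      have inc: "incseq (\<lambda>n. \<Union>i<n. a i)" by (force simp: incseq_def)
      have un: "(\<Union>n. \<Union>i<n. a i) = ?U" by auto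
      have "(\<lambda>n. measure M (\<Union>i<n. a i)) \<longlonglongrightarrow> measure M ?U"
        using M.finite_Lim_measure_incseq[OF _ inc] part sM un by auto
      moreover have "(\<lambda>n. measure N (\<Union>i<n. a i)) \<longlonglongrightarrow> measure N ?U"
        using N.finite_Lim_measure_incseq[OF _ inc] part sN un by auto
      ultimately show ?thesis unfolding s_def by (rule tendsto_add)
    qed
    show ?case
    proof (intro allI impI)
      fix e :: real assume e: "0 < e"
      have "\<forall>\<^sub>F n in sequentially. s ?U - e / 2 < s (\<Union>i<n. a i)"
        using e by (intro order_tendstoD(1)[OF lim]) auto
      then obtain n where n: "s ?U - e / 2 < s (\<Union>i<n. a i)" by (auto simp: eventually_sequentially)
      have rest: "s (?U - (\<Union>i<n. a i)) < e / 2"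
      proof -
        have "(\<Union>i<n. a i) \<subseteq> ?U" by blast
        then have "s (?U - (\<Union>i<n. a i)) = s ?U - s (\<Union>i<n. a i)"
          unfolding s_def using M.finite_measure_Diff[of ?U "\<Union>i<n. a i"] N.finite_measure_Diff[of ?U "\<Union>i<n. a i"]
            Us part sM sN by simp
        then show ?thesis using n by simp
      qed
      \<comment> \<open>\<open>n\<close> errors of this size cost at most \<open>e / 2\<close>; the
        summand 1 keeps the denominator positive for \<open>n = 0\<close>.\<close>
      have "\<exists>C\<in>W. s ((a i - C) \<union> (C - a i)) < e / (2 * (real n + 1))" for i using Union.IH[of i] e by simp
      then obtain C where C: "\<And>i. C i \<in> W" "\<And>i. s ((a i - C i) \<union> (C i - a i)) < e / (2 * (real n + 1))" by metis
      let ?C = "\<Union>i<n. C i" and ?D = "\<lambda>i. (a i - C i) \<union> (C i - a i)"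
      have D: "?D i \<in> ?S" for i
        by (rule US[OF DS[OF Union.hyps WS[OF C(1)]] DS[OF WS[OF C(1)] Union.hyps]])
      have Dn: "(\<Union>i<n. ?D i) \<in> ?S" using sets.finite_UN[of "{..<n}" ?D M] D sM by auto
      have "s ((?U - ?C) \<union> (?C - ?U)) \<le> s ((?U - (\<Union>i<n. a i)) \<union> (\<Union>i<n. ?D i))"
      proof (rule s_mono[OF _ US[OF DS[OF Us part] Dn]])
        show "(?U - ?C) \<union> (?C - ?U) \<subseteq> (?U - (\<Union>i<n. a i)) \<union> (\<Union>i<n. ?D i)" by blast
      qed
      also have "\<dots> \<le> s (?U - (\<Union>i<n. a i)) + s (\<Union>i<n. ?D i)"
        by (rule s_sub[OF DS[OF Us part] Dn])
      also have "s (\<Union>i<n. ?D i) \<le> (\<Sum>i<n. s (?D i))" by (rule s_sum[OF D])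
      also have "\<dots> \<le> (\<Sum>i<n. e / (2 * (real n + 1)))" by (intro sum_mono less_imp_le C(2))
      also have "\<dots> \<le> e / 2" using e by (simp add: field_simps)
      finally have "s ((?U - ?C) \<union> (?C - ?U)) < e" using rest by linarith
      moreover have "?C \<in> W" using C(1) by (intro finite_UN) auto
      ultimately show "\<exists>C\<in>W. s ((?U - C) \<union> (C - ?U)) < e" by blast
    qed
  qed
  have diff: "\<bar>measure Q A - measure Q C\<bar> \<le> measure Q ((A - C) \<union> (C - A))"
    if Q: "finite_measure Q" "sets Q = ?S" and C: "C \<in> ?S" for Q C
  proof -
    interpret Q: finite_measure Q by (rule Q)
    let ?X = "(A - C) \<union> (C - A)"
    have "?X \<in> ?S" by (rule US[OF DS[OF A C] DS[OF C A]])
    then have X: "?X \<in> sets Q" "A \<in> sets Q" "C \<in> sets Q" using Q A C by auto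
    have "measure Q A \<le> measure Q (C \<union> ?X)" "measure Q C \<le> measure Q (A \<union> ?X)"
      using X by (intro Q.finite_measure_mono sets.Un; auto)+
    moreover have "measure Q (C \<union> ?X) \<le> measure Q C + measure Q ?X" "measure Q (A \<union> ?X) \<le> measure Q A + measure Q ?X"
      using X by (intro measure_Un_le; simp)+
    ultimately show ?thesis by linarith
  qed
  show ?thesis
  proof (rule field_le_epsilon)
    fix e :: real assume "0 < e"
    then obtain C where C: "C \<in> W" "s ((A - C) \<union> (C - A)) < e" using approx by blast
    have "\<bar>measure M A - measure M C\<bar> + \<bar>measure N A - measure N C\<bar> < e"
      using diff[OF M(1,3) WS[OF C(1)]] diff[OF N(1,3) WS[OF C(1)]] C(2) unfolding s_def by linarith
    then show "\<bar>measure M A - measure N A\<bar> \<le> d + e" using d[OF C(1)] by linarith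
  qed
qed

context ising begin

section \<open>Fluctuations of the contribution of a typical past\<close>

definition S :: "nat \<Rightarrow> (nat \<Rightarrow> real) \<Rightarrow> real" where
  "S j v = (\<Sum>n. b (n + j) * v n)"

text \<open>The sum of the squared coefficients of \<open>S j\<close>, which governs typical pasts;
  the square of their sum, \<open>(t j)^2\<close> below, governs the extreme ones.\<close>

definition q :: "nat \<Rightarrow> real" where "q j = (\<Sum>n. (b (n + j))\<^sup>2)"

lemma b_le_1: "b n \<le> 1"
  using sum_le_suminf[OF b_summable, of "{n}"] b_nonneg B_lt_1 by (simp add: B_def)

lemma summable_b_sq: "summable (\<lambda>n. (b (n + j))\<^sup>2)"
  by (rule summable_comparison_test'[OF summable_ignore_initial_segment[OF b_summable, of j], of 0])
    (simp add: power2_eq_square mult_left_le b_nonneg b_le_1)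

lemma q_nonneg: "0 \<le> q j"
  unfolding q_def by (intro suminf_nonneg summable_b_sq) simp

lemma b_antimono: "i \<le> j \<Longrightarrow> b j \<le> b i"
  by (rule lift_Suc_antimono_le[of b]) (rule b_Suc_le)

text \<open>By monotonicity one factor \<open>b (n + j)\<close> is at most \<open>b j\<close> and
  the other at most \<open>b n\<close>, which leaves the summable bound
  \<open>B * b j\<close>.\<close>

lemma summable_q: "summable q"
proof (rule summable_comparison_test'[OF summable_mult[OF b_summable, of B], of 0])
  fix j
  have "q j \<le> (\<Sum>n. b j * b n)"
    unfolding q_def power2_eq_square
    by (intro suminf_le summable_mult b_summable mult_mono b_antimono b_nonneg) (use summable_b_sq in \<open>auto simp: power2_eq_square\<close>)
  also have "\<dots> = B * b j" unfolding B_def suminf_mult[OF b_summable] by (rule mult.commute)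
  finally show "norm (q j) \<le> B * b j" using q_nonneg by simp
qed

lemma gap_S: "u \<in> pasts \<Longrightarrow> w \<in> pasts \<Longrightarrow> gap j u w = S j u - S j w"
  unfolding gap_def S_def
  using suminf_diff[OF summable_b_mult[of u j] summable_b_mult[of w j]] by (simp add: right_diff_distrib)

lemma lip_S: "lip (\<lambda>n. 2 * b (n + j)) (S j)"
proof -
  note s = summable_ignore_initial_segment[OF b_summable, of j]
  have "\<bar>S j v - S j w\<bar> \<le> (\<Sum>n. 2 * b (n + j) * differ v w n)" if vw: "v \<in> pasts" "w \<in> pasts" for v w
  proof -
    have "norm (b (n + j) * (v n - w n)) \<le> 2 * b (n + j) * differ v w n" for n
      using vw b_nonneg[of "n + j"] by (auto simp: pasts_iff differ_def abs_mult dest!: spec[of _ n])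
    from norm_suminf_le[OF this summable_mult_differ] show ?thesis
      unfolding gap_S[OF vw, symmetric] gap_def using s b_nonneg by (simp add: summable_mult)
  qed
  then show ?thesis using s by (auto simp: lip_def b_nonneg summable_mult)
qed

lemma S_bound: "v \<in> pasts \<Longrightarrow> \<bar>S j v\<bar> \<le> 1"
proof -
  assume v: "v \<in> pasts"
  note s = summable_ignore_initial_segment[OF b_summable, of j]
  have "norm (b (n + j) * v n) \<le> b (n + j)" for n
    using v b_nonneg[of "n + j"] by (auto simp: pasts_iff abs_mult dest: spec[of _ n])
  from norm_suminf_le[OF this s] have "\<bar>S j v\<bar> \<le> (\<Sum>n. b (n + j))" by (simp add: S_def)
  also have "\<dots> \<le> B"
    using suminf_split_initial_segment[OF b_summable, of j] sum_nonneg[of "{..<j}" b] b_nonneg by (simp add: B_def)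
  finally show ?thesis using B_lt_1 by simp
qed

lemma lip_square:
  assumes "lip c F" "\<And>v. v \<in> pasts \<Longrightarrow> \<bar>F v\<bar> \<le> M"
  shows "lip (\<lambda>n. 2 * M * c n) (\<lambda>v. (F v)\<^sup>2)"
proof -
  have M: "0 \<le> M" using assms(2)[OF pasts_ne] by linarith
  note c = lipD(1,2)[OF assms(1)]
  have "\<bar>(F v)\<^sup>2 - (F w)\<^sup>2\<bar> \<le> (\<Sum>n. 2 * M * c n * differ v w n)" if vw: "v \<in> pasts" "w \<in> pasts" for v w
  proof -
    have "\<bar>(F v)\<^sup>2 - (F w)\<^sup>2\<bar> = \<bar>F v + F w\<bar> * \<bar>F v - F w\<bar>"
      by (simp add: power2_eq_square abs_mult[symmetric] algebra_simps)
    also have "\<dots> \<le> (2 * M) * (\<Sum>n. c n * differ v w n)"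
      using assms(2)[OF vw(1)] assms(2)[OF vw(2)] M lipD(3)[OF assms(1) vw] by (intro mult_mono) auto
    also have "\<dots> = (\<Sum>n. 2 * M * c n * differ v w n)"
      using suminf_mult[OF summable_mult_differ[OF c], of "2 * M"] by (simp add: mult.assoc)
    finally show ?thesis .
  qed
  then show ?thesis using c M by (auto simp: lip_def summable_mult)
qed

lemma lip_diff_const: "lip c F \<Longrightarrow> lip c (\<lambda>v. F v - m)"
  by (simp add: lip_def)

text \<open>By invariance the variance may be computed after \<open>N\<close> further steps. The
  spread inherited from the initial past is at most the remaining weight and vanishes as
  \<open>N\<close> grows; the spread created by the draws is bounded by the energy.\<close>

lemma g_measure_variance:
  fixes j :: nat
  assumes P: "g_measure g P"
  defines "m \<equiv> (\<integral>x. S j (past_upto (-1) x) \<partial>P)"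
  shows "(\<integral>x. (S j (past_upto (-1) x) - m)\<^sup>2 \<partial>P) \<le> q j / (1 - B)\<^sup>2"
proof -
  note P' = g_measureD(2)[OF P]
  interpret prob_space P by (rule prob_on_configsD[OF P'])
  note sp = prob_on_configsD(2)[OF P']
  let ?c = "\<lambda>n. 2 * b (n + j)" and ?F = "\<lambda>v. S j v - m"
  have F: "lip ?c ?F" by (rule lip_diff_const[OF lip_S])
  have int0: "(\<integral>x. ?F (past_upto (-1) x) \<partial>P) = 0"
    using lip_integrable[OF P' lip_S] by (simp add: m_def prob_space)
  have F_bound: "\<bar>?F v\<bar> \<le> 1 + \<bar>m\<bar>" if "v \<in> pasts" for v
    using S_bound[OF that, of j] by linarith
  note F2 = lip_square[OF F F_bound]
  have "(\<integral>x. (?F (past_upto (-1) x))\<^sup>2 \<partial>P) \<le> (suminf ((step ^^ N) ?c))\<^sup>2 + q j / (1 - B)\<^sup>2" for N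
  proof -
    have "(\<integral>x. (?F (past_upto (-1) x))\<^sup>2 \<partial>P) = (\<integral>x. (T ^^ N) (\<lambda>v. (?F v)\<^sup>2) (past_upto (-1) x) \<partial>P)"
      using g_measure_Tn[OF P F2, of N] by simp
    also have "\<dots> \<le> (\<integral>x. (suminf ((step ^^ N) ?c))\<^sup>2 + q j / (1 - B)\<^sup>2 \<partial>P)"
    proof (intro integral_mono lip_integrable[OF P' lip_Tn[OF F2]])
      fix x assume "x \<in> space P"
      then have x: "past_upto (-1) x \<in> pasts" (is "?v \<in> _") by (simp add: sp past_upto_pasts)
      have "(T ^^ N) (\<lambda>v. (?F v)\<^sup>2) ?v \<le> ((T ^^ N) ?F ?v)\<^sup>2 + (\<Sum>i<N. ((step ^^ i) ?c 0)\<^sup>2) / 4"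
        using Tn_variance[OF F x, of N] by simp
      also have "((T ^^ N) ?F ?v)\<^sup>2 \<le> (suminf ((step ^^ N) ?c))\<^sup>2"
        using g_measure_limit[OF P F x, of N] unfolding int0
        by (intro power2_le_iff_abs_le[THEN iffD2]) auto
      also have "(\<Sum>i<N. ((step ^^ i) ?c 0)\<^sup>2) / 4 \<le> q j / (1 - B)\<^sup>2"
      proof -
        have "(1 - B)\<^sup>2 * (\<Sum>i<N. ((step ^^ i) ?c 0)\<^sup>2) \<le> (\<Sum>i<N. (?c i)\<^sup>2)" by (rule energy_bound)
        \<comment> \<open>The weights of \<open>S j\<close> are \<open>2 * b (n + j)\<close>; the
          resulting 4 cancels the quarter in \<open>Tn_variance\<close>.\<close>
        also have "\<dots> = 4 * (\<Sum>i<N. (b (i + j))\<^sup>2)" by (simp add: power_mult_distrib sum_distrib_left)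
        also have "\<dots> \<le> 4 * q j"
          unfolding q_def by (intro mult_left_mono sum_le_suminf summable_b_sq) auto
        finally have "(\<Sum>i<N. ((step ^^ i) ?c 0)\<^sup>2) \<le> 4 * q j / (1 - B)\<^sup>2"
          using B_lt_1 by (simp add: pos_le_divide_eq mult.commute)
        then show ?thesis by (simp add: mult.commute)
      qed
      finally show "(T ^^ N) (\<lambda>v. (?F v)\<^sup>2) ?v \<le> (suminf ((step ^^ N) ?c))\<^sup>2 + q j / (1 - B)\<^sup>2" by simp
    qed (assumption | rule integrable_const)+
    finally show ?thesis by (simp add: prob_space)
  qed
  moreover have "(\<lambda>N. (suminf ((step ^^ N) ?c))\<^sup>2 + q j / (1 - B)\<^sup>2) \<longlonglongrightarrow> 0\<^sup>2 + q j / (1 - B)\<^sup>2"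
    by (intro tendsto_intros mass_tendsto_0 lip_weights[OF F])
  ultimately show ?thesis using LIMSEQ_le_const by fastforce
qed

text \<open>The errors of Young's inequality, of the first \<open>k\<close> symbols and of the
  chi-square bound. First \<open>\<eta>\<close> is fixed, then \<open>k\<close> makes the tail of
  \<open>q\<close> small despite the division by \<open>\<eta>\<close>, then \<open>N\<close>
  removes \<open>real k * \<tau> N\<close>. The 4 comes from squaring a sum of two deviations and
  from the two pasts.\<close>

definition mixing_rate :: "real \<Rightarrow> nat \<Rightarrow> nat \<Rightarrow> real" where
  "mixing_rate \<eta> k N = \<eta> / 2 + real k * \<tau> N + 4 * K / (\<eta> * (1 - B)\<^sup>2) * (\<Sum>j. q (j + k))"

text \<open>The bound involves neither the number of disjoint past events \<open>C y\<close> nor the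
  window length \<open>r\<close>, so it passes to total variation.\<close>

lemma rectangle_mixing:
  assumes P: "g_measure g P" and \<eta>: "0 < \<eta>" "\<eta> \<le> 1"
    and Y: "finite Y" "\<And>y. y \<in> Y \<Longrightarrow> C y \<in> sets (coord_algebra {..-1})" "disjoint_family_on C Y"
    and D: "\<And>y. y \<in> Y \<Longrightarrow> D y \<in> window_sets {int (k + N)..<int (k + N + r)}"
  shows "\<bar>(\<Sum>y\<in>Y. measure P (C y \<inter> D y)) - (\<Sum>y\<in>Y. measure P (C y) * measure P (D y))\<bar> \<le> mixing_rate \<eta> k N"
proof -
  note P' = g_measureD(2)[OF P]
  interpret prob_space P by (rule prob_on_configsD[OF P'])
  note sp = prob_on_configsD(2)[OF P']
  define L where "L = int (k + N + r) - 1"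
  define m where "m j = (\<integral>x. S j (past_upto (-1) x) \<partial>P)" for j
  define dev where "dev v = (\<Sum>j<r + N. (S (j + k) v - m (j + k))\<^sup>2)" for v
  \<comment> \<open>The bound for two pasts is written as \<open>G v + G w\<close>: averaging over
    an independent copy then gives twice one integral, and disjointness of the \<open>C y\<close>
    can be used under that integral.\<close>
  define G where "G v = (\<eta> / 2 + real k * \<tau> N) / 2 + 2 * K / \<eta> * dev v" for v
  let ?past = "past_upto (-1)"
  have past: "?past x \<in> pasts" if "x \<in> space P" for x using that by (simp add: sp past_upto_pasts)
  have dev_i: "integrable P (\<lambda>x. (S (j + k) (?past x) - m (j + k))\<^sup>2)" for j
  proof (rule lip_integrable[OF P' lip_square[OF lip_diff_const[OF lip_S]]])
    fix v assume "v \<in> pasts"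
    then show "\<bar>S (j + k) v - m (j + k)\<bar> \<le> 1 + \<bar>m (j + k)\<bar>" using S_bound[of v "j + k"] by linarith
  qed
  have G_i: "integrable P (\<lambda>x. G (?past x))"
    unfolding G_def dev_def by (intro Bochner_Integration.integrable_add integrable_const integrable_mult_right Bochner_Integration.integrable_sum dev_i)
  have G_nn: "0 \<le> G v" for v
    unfolding G_def dev_def using \<eta> K_pos \<tau>_nonneg[of N]
    by (intro add_nonneg_nonneg mult_nonneg_nonneg divide_nonneg_nonneg sum_nonneg) auto
  have EG: "2 * (\<integral>x. G (?past x) \<partial>P) \<le> mixing_rate \<eta> k N"
  proof -
    have "(\<integral>x. dev (?past x) \<partial>P) = (\<Sum>j<r + N. \<integral>x. (S (j + k) (?past x) - m (j + k))\<^sup>2 \<partial>P)"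
      unfolding dev_def by (rule Bochner_Integration.integral_sum) (rule dev_i)
    also have "\<dots> \<le> (\<Sum>j<r + N. q (j + k) / (1 - B)\<^sup>2)"
      unfolding m_def by (intro sum_mono g_measure_variance P)
    also have "\<dots> = (\<Sum>j<r + N. q (j + k)) / (1 - B)\<^sup>2" by (rule sum_divide_distrib[symmetric])
    also have "\<dots> \<le> (\<Sum>j. q (j + k)) / (1 - B)\<^sup>2"
      by (intro divide_right_mono sum_le_suminf summable_ignore_initial_segment summable_q) (auto simp: q_nonneg)
    finally have 1: "(\<integral>x. dev (?past x) \<partial>P) \<le> (\<Sum>j. q (j + k)) / (1 - B)\<^sup>2" .
    have dev_int: "integrable P (\<lambda>x. dev (?past x))"
      unfolding dev_def by (intro Bochner_Integration.integrable_sum dev_i)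
    have "(\<integral>x. G (?past x) \<partial>P) = (\<eta> / 2 + real k * \<tau> N) / 2 + 2 * K / \<eta> * (\<integral>x. dev (?past x) \<partial>P)"
      unfolding G_def using dev_int by (simp add: prob_space)
    also have "2 * K / \<eta> * (\<integral>x. dev (?past x) \<partial>P) \<le> 2 * K / \<eta> * ((\<Sum>j. q (j + k)) / (1 - B)\<^sup>2)"
      using 1 \<eta> K_pos by (intro mult_left_mono) auto
    finally show ?thesis by (simp add: mixing_rate_def field_simps)
  qed
  have one: "\<bar>prob (C y \<inter> D y) - prob (C y) * prob (D y)\<bar>
      \<le> (\<integral>x. indicator (C y) x * (G (?past x) + (\<integral>x. G (?past x) \<partial>P)) \<partial>P)" if y: "y \<in> Y" for y
  proof -
    let ?f = "on_past (D y) L" and ?n = "k + (r + N)"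
    let ?F = "(T ^^ ?n) ?f"
    have n: "int ?n - 1 = L" by (simp add: L_def)
    have Dy: "D y \<in> window_sets {..L}"
    proof -
      have "{int (k + N)..<int (k + N + r)} \<subseteq> {..L}" by (auto simp: L_def)
      then show ?thesis using D[OF y] window_sets_mono by blast
    qed
    have loc: "local_fun r ?f"
      unfolding local_fun_def
    proof (intro ballI impI)
      fix v w assume vw: "v \<in> pasts" "w \<in> pasts" and eq: "\<forall>i<r. v i = w i"
      have "unpast L v \<in> D y \<longleftrightarrow> unpast L w \<in> D y"
      proof (rule window_iff[OF D[OF y] unpast_configs[OF vw(1)] unpast_configs[OF vw(2)]])
        fix i assume "i \<in> {int (k + N)..<int (k + N + r)}"
        then have "nat (L - i) < r" "i \<le> L" by (auto simp: L_def)
        then show "unpast L v i = unpast L w i" using eq by (simp add: unpast_def)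
      qed
      then show "?f v = ?f w" by (simp add: on_past_def indicator_def)
    qed
    have f01: "0 \<le> ?f v" "?f v \<le> 1" for v by (auto simp: on_past_def indicator_def)
    have lipf: "lip (block r) ?f" by (rule lip_local[OF loc f01])
    have lipF: "lip ((step ^^ ?n) (block r)) ?F" by (rule lip_Tn[OF lipf])
    have Fi: "integrable P (\<lambda>x. ?F (?past x))" by (rule lip_integrable[OF P' lipF])
    have FG: "\<bar>?F v - ?F w\<bar> \<le> G v + G w" if vw: "v \<in> pasts" "w \<in> pasts" for v w
    proof -
      \<comment> \<open>The mean \<open>m (j + k)\<close> cancels in the gap, so it may be
        subtracted from both contributions.\<close>
      have "(gap (j + k) v w)\<^sup>2 \<le> 2 * (S (j + k) v - m (j + k))\<^sup>2 + 2 * (S (j + k) w - m (j + k))\<^sup>2" for j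
      proof -
        have "0 \<le> ((S (j + k) v - m (j + k)) + (S (j + k) w - m (j + k)))\<^sup>2" by simp
        then show ?thesis unfolding gap_S[OF vw] by (simp add: power2_eq_square algebra_simps)
      qed
      then have "(\<Sum>j<r + N. (gap (j + k) v w)\<^sup>2) \<le> (\<Sum>j<r + N. 2 * (S (j + k) v - m (j + k))\<^sup>2 + 2 * (S (j + k) w - m (j + k))\<^sup>2)"
        by (intro sum_mono)
      also have "\<dots> = 2 * dev v + 2 * dev w" by (simp add: dev_def sum.distrib sum_distrib_left)
      finally have "K * (\<Sum>j<r + N. (gap (j + k) v w)\<^sup>2) / \<eta> \<le> K * (2 * dev v + 2 * dev w) / \<eta>"
        using K_pos \<eta> by (intro divide_right_mono mult_left_mono) auto
      moreover have "\<eta> / 2 + K * (2 * dev v + 2 * dev w) / \<eta> + real k * \<tau> N = G v + G w"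
        using \<eta> by (simp add: G_def field_simps)
      moreover have "\<bar>?F v - ?F w\<bar> \<le> \<eta> / 2 + K * (\<Sum>j<r + N. (gap (j + k) v w)\<^sup>2) / \<eta> + real k * \<tau> N"
        by (rule mixing_bound[OF loc f01 vw \<eta>])
      ultimately show ?thesis by linarith
    qed
    have ind: "indicator (C y \<inter> D y) x = indicator (C y) x * (indicator (D y) x :: real)" for x
      by (simp add: indicator_def)
    have Cs: "C y \<in> sets P" using Y(2)[OF y] subalgebra_coord[OF P', of "{..-1}"] by (auto simp: subalgebra_def)
    have Ds: "D y \<in> sets P" by (rule window_in_P[OF P' D[OF y]])
    have CD: "prob (C y \<inter> D y) = (\<integral>x. indicator (C y) x * ?F (?past x) \<partial>P)"
    proof -
      have "prob (C y \<inter> D y) = (\<integral>x. indicator (C y) x * indicator (D y) x \<partial>P)"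
        using Cs Ds by (simp flip: ind)
      also have "\<dots> = (\<integral>x. indicator (C y) x * ?f (past_upto L x) \<partial>P)"
        by (intro Bochner_Integration.integral_cong refl) (simp add: sp on_past_past_upto[OF Dy])
      also have "\<dots> = (\<integral>x. indicator (C y) x * ?F (?past x) \<partial>P)"
        using g_measure_iter[OF P lipf Y(2)[OF y], of ?n] unfolding n .
      finally show ?thesis .
    qed
    have Dp: "prob (D y) = (\<integral>x. ?F (?past x) \<partial>P)"
    proof -
      have "prob (D y) = (\<integral>x. indicator (D y) x \<partial>P)" using Ds by simp
      also have "\<dots> = (\<integral>x. ?f (past_upto L x) \<partial>P)"
        by (intro Bochner_Integration.integral_cong refl) (simp add: sp on_past_past_upto[OF Dy])
      also have "\<dots> = (\<integral>x. ?f (?past x) \<partial>P)"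
        using g_measure_shift[OF P lipf, of "-1" ?n] n by simp
      finally show ?thesis using g_measure_Tn[OF P lipf, of ?n] by simp
    qed
    have near: "\<bar>?F (?past x) - prob (D y)\<bar> \<le> G (?past x) + (\<integral>x. G (?past x) \<partial>P)" if x: "x \<in> space P" for x
    proof -
      \<comment> \<open>By invariance \<open>prob (D y)\<close> is the mean of \<open>?F\<close>
        over an independent copy \<open>z\<close> of the configuration.\<close>
      have "?F (?past x) - prob (D y) = (\<integral>z. ?F (?past x) - ?F (?past z) \<partial>P)"
        using Fi Dp by (simp add: prob_space)
      then have "\<bar>?F (?past x) - prob (D y)\<bar> \<le> (\<integral>z. \<bar>?F (?past x) - ?F (?past z)\<bar> \<partial>P)"
        by (simp only: integral_abs_bound)
      also have "\<dots> \<le> (\<integral>z. G (?past x) + G (?past z) \<partial>P)"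
        using Fi G_i by (intro integral_mono FG past x) auto
      also have "\<dots> = G (?past x) + (\<integral>z. G (?past z) \<partial>P)" using G_i by (simp add: prob_space)
      finally show ?thesis .
    qed
    have CFi: "integrable P (\<lambda>x. indicator (C y) x * ?F (?past x))"
      by (rule indicator_lip_integrable[OF P' lipF Y(2)[OF y]])
    have "prob (C y) * prob (D y) = (\<integral>x. indicator (C y) x * prob (D y) \<partial>P)" using Cs by simp
    then have "prob (C y \<inter> D y) - prob (C y) * prob (D y)
        = (\<integral>x. indicator (C y) x * ?F (?past x) - indicator (C y) x * prob (D y) \<partial>P)"
      using Cs CFi unfolding CD by (subst Bochner_Integration.integral_diff) (auto simp: emeasure_eq_measure)
    then have "\<bar>prob (C y \<inter> D y) - prob (C y) * prob (D y)\<bar>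
        \<le> (\<integral>x. \<bar>indicator (C y) x * ?F (?past x) - indicator (C y) x * prob (D y)\<bar> \<partial>P)"
      by (simp only: integral_abs_bound)
    also have "\<dots> \<le> (\<integral>x. indicator (C y) x * (G (?past x) + (\<integral>x. G (?past x) \<partial>P)) \<partial>P)"
    proof (rule integral_mono)
      show "integrable P (\<lambda>x. indicator (C y) x * (G (?past x) + (\<integral>x. G (?past x) \<partial>P)))"
        using integrable_mult_indicator[OF Cs, of "\<lambda>x. G (?past x) + (\<integral>x. G (?past x) \<partial>P)"] G_i by simp
      show "integrable P (\<lambda>x. \<bar>indicator (C y) x * ?F (?past x) - indicator (C y) x * prob (D y)\<bar>)"
        using CFi Cs by (intro integrable_abs Bochner_Integration.integrable_diff) (auto simp: emeasure_eq_measure)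
    qed (use near in \<open>auto simp: indicator_def\<close>)
    finally show ?thesis .
  qed
  let ?H = "\<lambda>x. G (?past x) + (\<integral>x. G (?past x) \<partial>P)"
  have IG: "0 \<le> (\<integral>x. G (?past x) \<partial>P)" using G_nn by (intro integral_nonneg_AE) auto
  have Hi: "integrable P ?H" using G_i by simp
  have CHi: "integrable P (\<lambda>x. indicator (C y) x * ?H x)" if "y \<in> Y" for y
  proof -
    have "C y \<in> sets P" using Y(2)[OF that] subalgebra_coord[OF P', of "{..-1}"] by (auto simp: subalgebra_def)
    from integrable_mult_indicator[OF this Hi] show ?thesis by simp
  qed
  have "\<bar>(\<Sum>y\<in>Y. prob (C y \<inter> D y)) - (\<Sum>y\<in>Y. prob (C y) * prob (D y))\<bar>
      \<le> (\<Sum>y\<in>Y. \<bar>prob (C y \<inter> D y) - prob (C y) * prob (D y)\<bar>)"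
    unfolding sum_subtractf[symmetric] by (rule sum_abs)
  also have "\<dots> \<le> (\<Sum>y\<in>Y. \<integral>x. indicator (C y) x * ?H x \<partial>P)" by (intro sum_mono one)
  also have "\<dots> = (\<integral>x. (\<Sum>y\<in>Y. indicator (C y) x * ?H x) \<partial>P)"
    by (rule Bochner_Integration.integral_sum[symmetric]) (rule CHi)
  also have "\<dots> \<le> (\<integral>x. ?H x \<partial>P)"
  proof (rule integral_mono[OF _ Hi])
    show "integrable P (\<lambda>x. \<Sum>y\<in>Y. indicator (C y) x * ?H x)"
      by (rule Bochner_Integration.integrable_sum) (rule CHi)
    fix x
    have "(\<Sum>y\<in>Y. indicator (C y) x * ?H x) = (\<Sum>y\<in>Y. indicator (C y) x) * ?H x" by (rule sum_distrib_right[symmetric])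
    also have "(\<Sum>y\<in>Y. indicator (C y) x) = (indicator (\<Union>y\<in>Y. C y) x :: real)"
      by (rule indicator_UN_disjoint[OF Y(1,3), symmetric])
    also have "\<dots> * ?H x \<le> 1 * ?H x" using G_nn IG by (intro mult_right_mono add_nonneg_nonneg) (auto simp: indicator_def)
    finally show "(\<Sum>y\<in>Y. indicator (C y) x * ?H x) \<le> ?H x" by simp
  qed
  also have "\<dots> = 2 * (\<integral>x. G (?past x) \<partial>P)" using G_i by (simp add: prob_space)
  finally show ?thesis using EG by linarith
qed

end

text \<open>The finitely many patterns \<open>y\<close> before time 0 partition the configurations,
  and \<open>D y\<close> is the section of \<open>A\<close> over the pattern
  \<open>y\<close>.\<close>

lemma window_rect_decomp:
  assumes A: "A \<in> window_sets ({..-1} \<union> {n..})" and n: "0 \<le> n"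
  obtains Y :: "(int \<Rightarrow> real) set" and C D r where "finite Y" "\<And>y. y \<in> Y \<Longrightarrow> C y \<in> window_sets {..-1}"
    "disjoint_family_on C Y" "\<And>y. y \<in> Y \<Longrightarrow> D y \<in> window_sets {n..<n + int r}" "A = (\<Union>y\<in>Y. C y \<inter> D y)"
proof -
  obtain J where "finite J" "J \<subseteq> {..-1} \<union> {n..}" "depends_on A J"
    using window_setsE[OF A] .
  note J = depends_onD(1)[OF this(3)] this(1,2) depends_onD(2)[OF this(3)]
  define J1 where "J1 = J \<inter> {..-1}"
  \<comment> \<open>The value 1 off \<open>J1\<close> makes \<open>Y\<close> finite and forces
    distinct elements of \<open>Y\<close> to differ on \<open>J1\<close>, so their sets
    \<open>C\<close> are disjoint.\<close>
  define fill where "fill x = (\<lambda>i. if i \<in> J1 then x i else 1)" for x :: "int \<Rightarrow> real"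
  define join where "join y x = (\<lambda>i. if i < 0 then y i else x i)" for x y :: "int \<Rightarrow> real"
  define Y where "Y = fill ` configs"
  define C where "C y = {x \<in> configs. \<forall>i\<in>J1. x i = y i}" for y
  define D where "D y = {x \<in> configs. join y x \<in> A}" for y
  have J1: "finite J1" "J1 \<subseteq> {..-1}" using J(2) by (auto simp: J1_def)
  have fill: "fill x \<in> configs" if "x \<in> configs" for x using that by (auto simp: fill_def configs_iff)
  have join: "join y x \<in> configs" if "y \<in> configs" "x \<in> configs" for x y using that by (auto simp: join_def configs_iff)
  have Yc: "y \<in> configs" if "y \<in> Y" for y using that fill by (auto simp: Y_def)
  have "fill x = fill (restrict x J1)" for x by (auto simp: fill_def)
  then have "Y = fill ` (\<lambda>x. restrict x J1) ` configs" unfolding Y_def image_image by (metis (no_types, lifting))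
  then have Y: "finite Y" using finite_restrict_configs[OF J1(1)] by simp
  obtain r where r: "\<And>i. i \<in> J \<Longrightarrow> nat (i - n) < r"
    using finite_imageI[OF J(2), of "\<lambda>i. nat (i - n)"] unfolding finite_nat_set_iff_bounded by blast
  have Cw: "C y \<in> window_sets {..-1}" for y
    unfolding C_def by (rule cylinder_window[OF J1, of "\<lambda>i z. z = y i"])
  have disj: "disjoint_family_on C Y"
    unfolding disjoint_family_on_def
  proof (intro ballI impI equals0I)
    fix y z x assume yz: "y \<in> Y" "z \<in> Y" "y \<noteq> z" and x: "x \<in> C y \<inter> C z"
    have "y i = z i" for i
    proof (cases "i \<in> J1")
      case True
      then have "x i = y i" "x i = z i" using x by (auto simp: C_def)
      then show ?thesis by simp
    next
      case False
      then show ?thesis using yz by (auto simp: Y_def fill_def)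
    qed
    then show False using yz(3) by auto
  qed
  have Dw: "D y \<in> window_sets {n..<n + int r}" if y: "y \<in> Y" for y
  proof (rule window_setsI[of _ "J \<inter> {n..}"])
    show "J \<inter> {n..} \<subseteq> {n..<n + int r}" using r by force
    fix x x' assume x: "x \<in> configs" "x' \<in> configs" "\<And>i. i \<in> J \<inter> {n..} \<Longrightarrow> x i = x' i" "x \<in> D y"
    have "join y x' \<in> A"
    proof (rule J(4)[OF join[OF Yc[OF y] x(1)] join[OF Yc[OF y] x(2)]])
      show "join y x \<in> A" using x(4) by (simp add: D_def)
      fix i assume i: "i \<in> J"
      show "join y x i = join y x' i"
      proof (cases "i < 0")
        case False
        then have "i \<in> J \<inter> {n..}" using i J(3) by auto
        then show ?thesis using x(3) by (simp add: join_def)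
      qed (simp add: join_def)
    qed
    then show "x' \<in> D y" using x(2) by (simp add: D_def)
  qed (use J(2) in \<open>auto simp: D_def\<close>)
  have swap: "x \<in> A \<longleftrightarrow> join y x \<in> A" if "y \<in> configs" "x \<in> C y" for x y
  proof -
    have x: "x \<in> configs" using that(2) by (simp add: C_def)
    have eq: "x i = join y x i" if "i \<in> J" for i
      using \<open>x \<in> C y\<close> that J(3) n by (auto simp: C_def J1_def join_def)
    show ?thesis
      using J(4)[OF x join[OF that(1) x] eq] J(4)[OF join[OF that(1) x] x eq[symmetric]] by blast
  qed
  have "A = (\<Union>y\<in>Y. C y \<inter> D y)"
  proof (intro set_eqI iffI)
    fix x assume x: "x \<in> A"
    then have xc: "x \<in> configs" using J(1) by blast
    have xC: "x \<in> C (fill x)" using xc by (auto simp: C_def fill_def)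
    have "x \<in> D (fill x)" using swap[OF fill[OF xc] xC] x xc by (simp add: D_def)
    then show "x \<in> (\<Union>y\<in>Y. C y \<inter> D y)" using xC xc by (auto simp: Y_def)
  next
    fix x assume "x \<in> (\<Union>y\<in>Y. C y \<inter> D y)"
    then obtain y where y: "y \<in> Y" "x \<in> C y" "x \<in> D y" by blast
    then show "x \<in> A" using swap[OF Yc[OF y(1)] y(2)] by (simp add: D_def)
  qed
  from that[OF Y Cw disj Dw this] show ?thesis .
qed

lemma rect_subalgebra:
  assumes "prob_on_configs P" shows "subalgebra P (rect_algebra n)"
proof -
  have "space (rect_algebra n) = configs"
    using sets_eq_imp_space_eq[OF sets_rect_algebra[of n]] by simp
  then show ?thesis using subalgebra_coord[OF assms, of "{..-1} \<union> {n..}"]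
    by (simp add: subalgebra_def sets_rect_algebra)
qed

context ising begin

text \<open>On a window event both measures are finite sums over disjoint rectangles, where
  \<open>rectangle_mixing\<close> applies; \<open>algebra_approx\<close> extends the bound to all
  measurable sets without loss.\<close>

lemma tv_dist_le_mixing_rate:
  assumes P: "g_measure g P" and \<eta>: "0 < \<eta>" "\<eta> \<le> 1"
  shows "tv_dist (prod_restr P (int (k + N))) (restr_to_subalg P (rect_algebra (int (k + N)))) \<le> 2 * mixing_rate \<eta> k N"
    and "0 \<le> tv_dist (prod_restr P (int (k + N))) (restr_to_subalg P (rect_algebra (int (k + N))))"
proof -
  define n where "n = int (k + N)"
  have n0: "0 \<le> n" by (simp add: n_def)
  let ?W = "window_sets ({..-1} \<union> {n..})"
  let ?M = "prod_restr P n" and ?N = "restr_to_subalg P (rect_algebra n)"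
  note P' = g_measureD(2)[OF P]
  interpret prob_space P by (rule prob_on_configsD[OF P'])
  have sub: "subalgebra P (rect_algebra n)" by (rule rect_subalgebra[OF P'])
  have setsR: "sets (rect_algebra n) = sigma_sets configs ?W" by (simp add: sets_rect_algebra sets_coord_window)
  have spR: "space (rect_algebra n) = configs"
    using sets_eq_imp_space_eq[OF sets_rect_algebra[of n]] by simp
  have setsM: "sets ?M = sigma_sets configs ?W" "space ?M = configs"
    by (simp_all add: prod_restr_def setsR spR)
  have setsN: "sets ?N = sigma_sets configs ?W" "space ?N = configs"
    using P' by (simp_all add: sets_restr_to_subalg[OF sub] setsR space_restr_to_subalg prob_on_configs_def)
  have top: "configs \<in> sets (coord_algebra I)" for I using sets.top[of "coord_algebra I"] by simp
  have "emeasure ?M (space ?M) = 1"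
    using emeasure_prod_restr[OF P' n0 top top] emeasure_space_1 P' by (simp add: setsM prob_on_configs_def)
  then interpret M: prob_space ?M by (rule prob_spaceI)
  interpret N: prob_space ?N by (rule prob_space_restr_to_subalg[OF sub prob_space_axioms])
  have win: "\<bar>measure ?M A - measure ?N A\<bar> \<le> mixing_rate \<eta> k N" if A: "A \<in> ?W" for A
  proof -
    obtain Y :: "(int \<Rightarrow> real) set" and C D r where Y: "finite Y" and C: "\<And>y. y \<in> Y \<Longrightarrow> C y \<in> window_sets {..-1}"
      and disj: "disjoint_family_on C Y" and D: "\<And>y. y \<in> Y \<Longrightarrow> D y \<in> window_sets {n..<n + int r}"
      and AY: "A = (\<Union>y\<in>Y. C y \<inter> D y)"
      by (rule window_rect_decomp[OF A n0]) (rule that)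
    have Dr: "D y \<in> window_sets {int (k + N)..<int (k + N + r)}" if "y \<in> Y" for y
      using D[OF that] by (simp add: n_def)
    have C': "C y \<in> sets (coord_algebra {..-1})" if "y \<in> Y" for y by (rule window_in_coord[OF C[OF that]])
    have D': "D y \<in> sets (coord_algebra {n..})" if "y \<in> Y" for y
      by (rule subsetD[OF coord_algebra_mono window_in_coord[OF D[OF that]]]) auto
    have CDW: "C y \<inter> D y \<in> ?W" if "y \<in> Y" for y
    proof (rule window_Int)
      show "C y \<in> ?W" using C[OF that] window_sets_mono[of "{..-1}" "{..-1} \<union> {n..}"] by blast
      have "{n..<n + int r} \<subseteq> {..-1} \<union> {n..}" by auto
      then show "D y \<in> ?W" using D[OF that] window_sets_mono by blast
    qed
    have CDP: "C y \<inter> D y \<in> sets P" if "y \<in> Y" for y by (rule window_in_P[OF P' CDW[OF that]])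
    have disj': "disjoint_family_on (\<lambda>y. C y \<inter> D y) Y" using disj by (auto simp: disjoint_family_on_def)
    have "measure ?N A = prob A"
      unfolding measure_def using A setsR by (subst emeasure_restr_to_subalg[OF sub]) (auto intro: sigma_sets.Basic)
    also have "\<dots> = (\<Sum>y\<in>Y. prob (C y \<inter> D y))"
      unfolding AY by (rule finite_measure_finite_Union[OF Y _ disj']) (use CDP in auto)
    finally have 1: "measure ?N A = (\<Sum>y\<in>Y. prob (C y \<inter> D y))" .
    have "measure ?M A = (\<Sum>y\<in>Y. measure ?M (C y \<inter> D y))"
      unfolding AY by (rule M.finite_measure_finite_Union[OF Y _ disj']) (use CDW setsM in auto)
    also have "\<dots> = (\<Sum>y\<in>Y. prob (C y) * prob (D y))"
    proof (rule sum.cong[OF refl])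
      fix y assume y: "y \<in> Y"
      show "measure ?M (C y \<inter> D y) = prob (C y) * prob (D y)"
        unfolding measure_def emeasure_prod_restr[OF P' n0 C'[OF y] D'[OF y]] by (rule enn2real_mult)
    qed
    finally show ?thesis
      using rectangle_mixing[OF P \<eta> Y C' disj Dr] 1 by (simp add: abs_minus_commute)
  qed
  have all: "\<bar>measure ?M A - measure ?N A\<bar> \<le> mixing_rate \<eta> k N" if "A \<in> sets ?M" for A
    by (rule algebra_approx[OF window_algebra M.finite_measure_axioms setsM(2,1)
          N.finite_measure_axioms setsN(2,1) win that[unfolded setsM(1)]])
  have ne: "sets ?M \<noteq> {}" using sets.empty_sets[of ?M] by blast
  have bdd: "bdd_above ((\<lambda>A. \<bar>measure ?M A - measure ?N A\<bar>) ` sets ?M)"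
    using all by (intro bdd_aboveI2) blast
  have "(SUP A\<in>sets ?M. \<bar>measure ?M A - measure ?N A\<bar>) \<le> mixing_rate \<eta> k N"
    using ne all by (rule cSUP_least)
  then show "tv_dist (prod_restr P (int (k + N))) (restr_to_subalg P (rect_algebra (int (k + N)))) \<le> 2 * mixing_rate \<eta> k N"
    unfolding tv_dist_def n_def by linarith
  have "\<bar>measure ?M {} - measure ?N {}\<bar> \<le> (SUP A\<in>sets ?M. \<bar>measure ?M A - measure ?N A\<bar>)"
    by (rule cSUP_upper[OF _ bdd]) simp
  then show "0 \<le> tv_dist (prod_restr P (int (k + N))) (restr_to_subalg P (rect_algebra (int (k + N))))"
    unfolding tv_dist_def n_def by linarith
qed

lemma g_measure_weak_bernoulli:
  assumes P: "g_measure g P"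
  shows "weak_bernoulli P"
  unfolding weak_bernoulli_def
proof (intro conjI)
  show "stationary P" using P by (simp add: g_measure_def)
  let ?tv = "\<lambda>n. tv_dist (prod_restr P (int n)) (restr_to_subalg P (rect_algebra (int n)))"
  show "?tv \<longlonglongrightarrow> 0"
  proof (rule LIMSEQ_I)
    fix e :: real assume e: "0 < e"
    \<comment> \<open>Each of the three terms of \<open>mixing_rate\<close> gets
      \<open>e / 6\<close>; the factor 2 in front of the rate turns \<open>e / 2\<close> into
      \<open>e\<close>.\<close>
    define \<eta> where "\<eta> = min 1 (e / 3)"
    have \<eta>: "0 < \<eta>" "\<eta> \<le> 1" "\<eta> \<le> e / 3" using e by (auto simp: \<eta>_def)
    have "(\<lambda>k. 4 * K / (\<eta> * (1 - B)\<^sup>2) * (\<Sum>j. q (j + k))) \<longlonglongrightarrow> 4 * K / (\<eta> * (1 - B)\<^sup>2) * 0"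
      by (intro tendsto_intros tail_tendsto_0 summable_q)
    then have "\<forall>\<^sub>F k in sequentially. 4 * K / (\<eta> * (1 - B)\<^sup>2) * (\<Sum>j. q (j + k)) < e / 6"
      using e by (intro order_tendstoD(2)) auto
    then obtain k where k: "4 * K / (\<eta> * (1 - B)\<^sup>2) * (\<Sum>j. q (j + k)) < e / 6"
      by (auto simp: eventually_sequentially)
    have "(\<lambda>N. real k * \<tau> N) \<longlonglongrightarrow> real k * 0" by (intro tendsto_intros \<tau>_tendsto)
    then have "\<forall>\<^sub>F N in sequentially. real k * \<tau> N < e / 6" using e by (intro order_tendstoD(2)) auto
    then obtain N0 where N0: "\<And>N. N \<ge> N0 \<Longrightarrow> real k * \<tau> N < e / 6" by (auto simp: eventually_sequentially)
    have "norm (?tv n - 0) < e" if n: "n \<ge> k + N0" for n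
    proof -
      define N where "N = n - k"
      have N: "n = k + N" "N \<ge> N0" using n by (auto simp: N_def)
      have "mixing_rate \<eta> k N < e / 2"
        using N0[OF N(2)] k \<eta>(3) e unfolding mixing_rate_def by linarith
      then have "?tv n < e" "0 \<le> ?tv n"
        using tv_dist_le_mixing_rate[OF P \<eta>(1,2), of k N] unfolding N(1) by linarith+
      then show ?thesis by simp
    qed
    then show "\<exists>n0. \<forall>n\<ge>n0. norm (?tv n - 0) < e" by blast
  qed
qed

end

section \<open>Phase transition\<close>

text \<open>
  Under \<open>forget 0\<close> every conditional mean is predicted from the all-plus past, whatever the true
  past is; under \<open>forget m\<close> the statistic depends on the coordinates from \<open>m\<close> on only.
\<close>

definition forget :: "nat \<Rightarrow> (int \<Rightarrow> real) \<Rightarrow> int \<Rightarrow> real" where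
  "forget m x = (\<lambda>i. if i < int m then 1 else x i)"

lemma forget_configs: "x \<in> configs \<Longrightarrow> forget m x \<in> configs"
  by (auto simp: forget_def configs_iff)

lemma coordinate_measurable: "i \<in> I \<Longrightarrow> (\<lambda>x. x i) \<in> borel_measurable (coord_algebra I)"
proof (rule measurableI)
  fix Y :: "real set" assume "i \<in> I"
  then have "{x \<in> configs. x i \<in> Y} \<in> window_sets I"
    using cylinder_window[of "{i}" I "\<lambda>_ z. z \<in> Y"] by simp
  moreover have "(\<lambda>x. x i) -` Y \<inter> space (coord_algebra I) = {x \<in> configs. x i \<in> Y}" by auto
  ultimately show "(\<lambda>x. x i) -` Y \<inter> space (coord_algebra I) \<in> sets (coord_algebra I)"
    using window_in_coord by simp
qed simp

lemma coord_map_measurable: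
  assumes "\<And>x. x \<in> configs \<Longrightarrow> F x \<in> configs"
    and "\<And>i. (\<exists>j\<in>I. \<forall>x. F x i = x j) \<or> (\<exists>s. \<forall>x. F x i = s)"
  shows "F \<in> measurable (coord_algebra I) (coord_algebra UNIV)"
  unfolding coord_algebra_def[of UNIV]
proof (rule measurable_measure_of)
  fix Y assume "Y \<in> {{x \<in> configs. x i \<in> B} |i B. i \<in> UNIV \<and> B \<subseteq> spins}"
  then obtain i B where Y: "Y = {x \<in> configs. x i \<in> B}" by blast
  have eq: "F -` Y \<inter> space (coord_algebra I) = {x \<in> configs. F x i \<in> B}"
    using assms(1) by (auto simp: Y)
  from assms(2)[of i] have "{x \<in> configs. F x i \<in> B} \<in> window_sets I"
  proof
    assume "\<exists>j\<in>I. \<forall>x. F x i = x j"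
    then obtain j where "j \<in> I" "\<And>x. F x i = x j" by blast
    then show ?thesis using cylinder_window[of "{j}" I "\<lambda>_ z. z \<in> B"] by simp
  next
    assume "\<exists>s. \<forall>x. F x i = s"
    then obtain s where "\<And>x. F x i = s" by blast
    then show ?thesis by (cases "s \<in> B") (simp_all add: window_empty window_configs)
  qed
  then show "F -` Y \<inter> space (coord_algebra I) \<in> sets (coord_algebra I)"
    unfolding eq by (rule window_in_coord)
qed (use assms(1) in auto)

lemma forget_measurable: "forget m \<in> measurable (coord_algebra {int m..}) (coord_algebra UNIV)"
proof (rule coord_map_measurable)
  fix i show "(\<exists>j\<in>{int m..}. \<forall>x. forget m x i = x j) \<or> (\<exists>s. \<forall>x. forget m x i = s)"
    by (cases "i < int m") (auto simp: forget_def)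
qed (rule forget_configs)

context ising begin

section \<open>A martingale statistic\<close>

definition drift :: "(nat \<Rightarrow> real) \<Rightarrow> real" where
  "drift v = 2 * logistic_phi (field v) - 1"

definition t :: "nat \<Rightarrow> real" where "t j = (\<Sum>n. b (n + j))"

definition V :: "nat \<Rightarrow> real" where "V N = (\<Sum>j<N. (t j)\<^sup>2)"

text \<open>The increments are centred by the mean predicted from the past contained in
  \<open>x\<close> itself; the statistic of the tail event is its value at
  \<open>forget m x\<close>. The weights \<open>t j\<close> match the shift of the conditional means
  to be detected: the shift adds up to order \<open>V N\<close>, while the variance is at most
  \<open>4 * V N\<close>.\<close>

definition martingale :: "nat \<Rightarrow> (int \<Rightarrow> real) \<Rightarrow> real" where
  "martingale N x = (\<Sum>j<N. t j * (x (int j) - drift (past_upto (int j - 1) x)))"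

lemma t_nonneg: "0 \<le> t j"
  unfolding t_def by (intro suminf_nonneg summable_ignore_initial_segment b_summable b_nonneg)

lemma drift_bound: "\<bar>drift v\<bar> \<le> 1"
  using logistic_phi_pos[of "field v"] logistic_phi_lt_1[of "field v"] by (simp add: drift_def abs_le_iff)

lemma drift_measurable: "(\<lambda>x. drift (past_upto j x)) \<in> borel_measurable (coord_algebra {..j})"
  using lip_measurable[OF lip_phi[of 1], of j] unfolding drift_def by simp

lemma coord_measurable_mono:
  "I \<subseteq> J \<Longrightarrow> f \<in> borel_measurable (coord_algebra I) \<Longrightarrow> f \<in> borel_measurable (coord_algebra J)"
  by (rule measurable_from_subalg) (auto simp: subalgebra_def intro: subsetD[OF coord_algebra_mono])

lemma martingale_measurable: "martingale N \<in> borel_measurable (coord_algebra {..int N - 1})"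
  unfolding martingale_def[abs_def]
proof (intro borel_measurable_sum borel_measurable_times borel_measurable_diff borel_measurable_const)
  fix j assume j: "j \<in> {..<N}"
  then show "(\<lambda>x. x (int j)) \<in> borel_measurable (coord_algebra {..int N - 1})"
    by (intro coordinate_measurable) auto
  show "(\<lambda>x. drift (past_upto (int j - 1) x)) \<in> borel_measurable (coord_algebra {..int N - 1})"
    using j by (intro coord_measurable_mono[OF _ drift_measurable]) auto
qed

lemma increment_bound: "x \<in> configs \<Longrightarrow> \<bar>x i - drift v\<bar> \<le> 2"
  using drift_bound[of v] by (auto simp: configs_iff abs_le_iff dest: spec[of _ i])

lemma martingale_bound: "x \<in> configs \<Longrightarrow> \<bar>martingale N x\<bar> \<le> 2 * (\<Sum>j<N. t j)"
  unfolding martingale_def sum_distrib_left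
proof (rule order_trans[OF sum_abs sum_mono])
  fix j assume "x \<in> configs"
  then show "\<bar>t j * (x (int j) - drift (past_upto (int j - 1) x))\<bar> \<le> 2 * t j"
    using mult_left_mono[OF increment_bound t_nonneg] by (simp add: abs_mult t_nonneg mult.commute)
qed

lemma increment_orthogonal:
  assumes P: "prob_on_configs P" and cp: "has_cond_prob g P j"
    and h: "h \<in> borel_measurable (coord_algebra {..j - 1})" "\<And>x. x \<in> configs \<Longrightarrow> \<bar>h x\<bar> \<le> M"
  shows "(\<integral>x. h x * (x j - drift (past_upto (j - 1) x)) \<partial>P) = 0"
proof -
  let ?E = "{y \<in> configs. y j = 1}"
  let ?p = "\<lambda>x. logistic_phi (1 * field (past_upto (j - 1) x))"
  note I = spin_integral[OF P cp disjI1[OF refl] h]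
  have "(\<integral>x. h x * (x j - drift (past_upto (j - 1) x)) \<partial>P) = (\<integral>x. 2 * (h x * indicator ?E x) - 2 * (h x * ?p x) \<partial>P)"
  proof (rule Bochner_Integration.integral_cong[OF refl])
    fix x assume "x \<in> space P"
    then have "x \<in> configs" "x j = 1 \<or> x j = -1" by (auto simp: prob_on_configsD(2)[OF P] configs_iff)
    then show "h x * (x j - drift (past_upto (j - 1) x)) = 2 * (h x * indicator ?E x) - 2 * (h x * ?p x)"
      by (auto simp: drift_def algebra_simps)
  qed
  also have "\<dots> = 2 * (\<integral>x. h x * indicator ?E x \<partial>P) - 2 * (\<integral>x. h x * ?p x \<partial>P)" using I(1,2) by simp
  also have "\<dots> = 0" using I(3) by simp
  finally show ?thesis .
qed

text \<open>Increments are orthogonal to functions of the past, and each is at most 2 in absolute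
  value before weighting, hence the factor 4.\<close>

lemma martingale_variance:
  assumes P: "prob_on_configs P" and cp: "\<And>j. j \<ge> 0 \<Longrightarrow> has_cond_prob g P j"
  shows "integrable P (\<lambda>x. (martingale N x)\<^sup>2)" "(\<integral>x. (martingale N x)\<^sup>2 \<partial>P) \<le> 4 * V N"
proof -
  interpret prob_space P by (rule prob_on_configsD[OF P])
  note sp = prob_on_configsD(2)[OF P]
  have mP: "martingale N \<in> borel_measurable P" for N
    using measurable_from_subalg[OF subalgebra_coord[OF P] martingale_measurable] .
  have int: "integrable P (\<lambda>x. (martingale N x)\<^sup>2)" for N
  proof (rule integrable_const_bound[of _ "(2 * (\<Sum>j<N. t j))\<^sup>2"])
    show "AE x in P. norm ((martingale N x)\<^sup>2) \<le> (2 * (\<Sum>j<N. t j))\<^sup>2"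
    proof (rule AE_I2)
      fix x assume "x \<in> space P"
      then have "(martingale N x)\<^sup>2 \<le> (2 * (\<Sum>j<N. t j))\<^sup>2"
        using martingale_bound[of x N] sum_nonneg[of "{..<N}" t] t_nonneg
        by (intro power2_le_iff_abs_le[THEN iffD2]) (auto simp: sp)
      then show "norm ((martingale N x)\<^sup>2) \<le> (2 * (\<Sum>j<N. t j))\<^sup>2" by simp
    qed
  qed (intro borel_measurable_power mP)
  then show "integrable P (\<lambda>x. (martingale N x)\<^sup>2)" .
  show "(\<integral>x. (martingale N x)\<^sup>2 \<partial>P) \<le> 4 * V N"
  proof (induction N)
    case 0 then show ?case by (simp add: martingale_def V_def)
  next
    case (Suc N)
    let ?D = "\<lambda>x. x (int N) - drift (past_upto (int N - 1) x)"
    have step: "martingale (Suc N) x = martingale N x + t N * ?D x" for x by (simp add: martingale_def)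
    have sq: "(m + s * d)\<^sup>2 = m\<^sup>2 + 2 * s * (m * d) + s\<^sup>2 * d\<^sup>2" for m s d :: real
      by (simp add: power2_eq_square algebra_simps)
    have DP: "?D \<in> borel_measurable P"
    proof (rule measurable_from_subalg[OF subalgebra_coord[OF P, of "{..int N}"]], rule borel_measurable_diff)
      show "(\<lambda>x. x (int N)) \<in> borel_measurable (coord_algebra {..int N})" by (rule coordinate_measurable) simp
      show "(\<lambda>x. drift (past_upto (int N - 1) x)) \<in> borel_measurable (coord_algebra {..int N})"
        by (rule coord_measurable_mono[OF _ drift_measurable]) simp
    qed
    have cross: "integrable P (\<lambda>x. martingale N x * ?D x)"
    proof (rule integrable_const_bound[of _ "(2 * (\<Sum>j<N. t j)) * 2"])
      show "AE x in P. norm (martingale N x * ?D x) \<le> (2 * (\<Sum>j<N. t j)) * 2"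
        unfolding real_norm_def abs_mult
        by (intro AE_I2 mult_mono martingale_bound increment_bound) (auto simp: sp t_nonneg sum_nonneg)
    qed (intro borel_measurable_times mP DP)
    have cross0: "(\<integral>x. martingale N x * ?D x \<partial>P) = 0"
      by (rule increment_orthogonal[OF P cp martingale_measurable martingale_bound]) auto
    have "(\<integral>x. (martingale (Suc N) x)\<^sup>2 \<partial>P) \<le> (\<integral>x. (martingale N x)\<^sup>2 + 2 * t N * (martingale N x * ?D x) + 4 * (t N)\<^sup>2 \<partial>P)"
    proof (rule integral_mono[OF int])
      show "integrable P (\<lambda>x. (martingale N x)\<^sup>2 + 2 * t N * (martingale N x * ?D x) + 4 * (t N)\<^sup>2)"
        by (intro Bochner_Integration.integrable_add int integrable_mult_right cross integrable_const)
      fix x assume "x \<in> space P"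
      then have "\<bar>?D x\<bar> \<le> 2" by (intro increment_bound) (simp add: sp)
      then have "(?D x)\<^sup>2 \<le> 2\<^sup>2" by (intro power2_le_iff_abs_le[THEN iffD2]) auto
      then have "(t N)\<^sup>2 * (?D x)\<^sup>2 \<le> (t N)\<^sup>2 * 4" by (intro mult_left_mono) auto
      then show "(martingale (Suc N) x)\<^sup>2 \<le> (martingale N x)\<^sup>2 + 2 * t N * (martingale N x * ?D x) + 4 * (t N)\<^sup>2"
        unfolding step sq by linarith
    qed
    also have "\<dots> = (\<integral>x. (martingale N x)\<^sup>2 \<partial>P) + 4 * (t N)\<^sup>2"
      using int cross cross0 by (simp add: prob_space)
    also have "\<dots> \<le> 4 * V (Suc N)" using Suc by (simp add: V_def)
    finally show ?case .
  qed
qed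

text \<open>Along such a subsequence the second moments of the normalised martingale are at most
  \<open>4 / 2^k\<close>, so the sum of its squares has finite mean and is almost surely
  finite.\<close>

lemma martingale_AE:
  assumes P: "prob_on_configs P" and cp: "\<And>j. j \<ge> 0 \<Longrightarrow> has_cond_prob g P j"
    and V: "\<And>k. 2 ^ k \<le> V (N k)"
  shows "AE x in P. (\<lambda>k. martingale (N k) x / V (N k)) \<longlonglongrightarrow> 0"
proof -
  interpret prob_space P by (rule prob_on_configsD[OF P])
  let ?R = "\<lambda>k x. (martingale (N k) x / V (N k))\<^sup>2"
  have Vpos: "0 < V (N k)" for k by (rule less_le_trans[OF _ V[of k]]) simp
  have mP: "martingale n \<in> borel_measurable P" for n
    using measurable_from_subalg[OF subalgebra_coord[OF P] martingale_measurable] .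
  have Rint: "integrable P (?R k)" for k
    unfolding power_divide by (intro integrable_divide martingale_variance[OF P cp])
  have RE: "(\<integral>x. ?R k x \<partial>P) \<le> 4 * (1 / 2) ^ k" for k
  proof -
    have "(\<integral>x. ?R k x \<partial>P) = (\<integral>x. (martingale (N k) x)\<^sup>2 \<partial>P) / (V (N k))\<^sup>2"
      unfolding power_divide by simp
    also have "\<dots> \<le> 4 * V (N k) / (V (N k))\<^sup>2"
      by (intro divide_right_mono martingale_variance[OF P cp]) auto
    also have "\<dots> = 4 * (1 / V (N k))" using Vpos[of k] by (simp add: power2_eq_square)
    also have "\<dots> \<le> 4 * (1 / 2 ^ k)" using V[of k] Vpos[of k] by (intro mult_left_mono divide_left_mono) auto
    finally show ?thesis by (simp add: power_one_over)
  qed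
  have "(\<integral>\<^sup>+x. (\<Sum>k. ennreal (?R k x)) \<partial>P) = (\<Sum>k. \<integral>\<^sup>+x. ennreal (?R k x) \<partial>P)"
    by (rule nn_integral_suminf) (use mP in measurable)
  also have "\<dots> = (\<Sum>k. ennreal (\<integral>x. ?R k x \<partial>P))"
    by (intro suminf_cong nn_integral_eq_integral Rint) simp
  also have "\<dots> \<le> (\<Sum>k. ennreal (4 * (1 / 2) ^ k))"
    by (intro suminf_le ennreal_leI RE) auto
  also have "\<dots> = ennreal (\<Sum>k. 4 * (1 / 2) ^ k)"
    by (intro suminf_ennreal2 summable_mult summable_geometric) auto
  also have "\<dots> < \<infinity>" by simp
  finally have "AE x in P. (\<Sum>k. ennreal (?R k x)) \<noteq> \<infinity>"
    by (intro nn_integral_noteq_infinite) (use mP in \<open>auto intro!: borel_measurable_suminf_order measurable_compose[OF _ measurable_ennreal] borel_measurable_power borel_measurable_divide\<close>)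
  then show ?thesis
  proof eventually_elim
    case (elim x)
    have "summable (\<lambda>k. ?R k x)"
      by (rule summable_suminf_not_top) (use elim in \<open>auto simp: infinity_ennreal_def\<close>)
    then have "(\<lambda>k. sqrt (?R k x)) \<longlonglongrightarrow> sqrt 0"
      by (intro tendsto_real_sqrt summable_LIMSEQ_zero)
    then have "(\<lambda>k. \<bar>martingale (N k) x / V (N k)\<bar>) \<longlonglongrightarrow> 0" by (simp only: real_sqrt_abs real_sqrt_zero)
    then show ?case by (rule tendsto_rabs_zero_cancel)
  qed
qed

section \<open>Effect of replacing symbols by plus signs\<close>

lemma t_antimono: "t j \<le> t 0"
  unfolding t_def
  by (intro suminf_le summable_ignore_initial_segment b_summable b_antimono) simp

lemma drift_tanh: "drift v = tanh (field v)"
  by (simp add: drift_def logistic_phi_tanh field_simps)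

text \<open>Each of the \<open>m\<close> altered symbols changes its own increment by at most 2 and
  the later predictions by at most \<open>2 * B\<close> altogether. The bound is free of
  \<open>N\<close>, so it is negligible against a diverging \<open>V N\<close>.\<close>

lemma forget_close:
  assumes x: "x \<in> configs"
  shows "\<bar>martingale N (forget m x) - martingale N (forget 0 x)\<bar> \<le> t 0 * (2 * real m + 2 * (real m * B))"
proof -
  let ?y = "forget m x" and ?z = "forget 0 x"
  let ?b = "\<lambda>j i. if i < j then b (j - 1 - i) else 0"
  have drift: "\<bar>drift (past_upto (int j - 1) ?y) - drift (past_upto (int j - 1) ?z)\<bar> \<le> 2 * (\<Sum>i<m. ?b j i)" for j
  proof -
    let ?u = "past_upto (int j - 1) ?y" and ?w = "past_upto (int j - 1) ?z"
    have uw: "?u \<in> pasts" "?w \<in> pasts" by (intro past_upto_pasts forget_configs x)+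
    \<comment> \<open>Entry \<open>n\<close> of the past before time \<open>j\<close> is the
      coordinate \<open>j - 1 - n\<close>, and the two configurations can differ only at coordinates
      from 0 to \<open>m - 1\<close>.\<close>
    have d0: "differ ?u ?w n \<le> of_bool (n < j \<and> j - Suc n < m)" for n
      by (cases "n < j") (auto simp: differ_def past_upto_def forget_def of_bool_def)
    have aux: "\<bar>2 * p - 1 - (2 * q - 1)\<bar> = 2 * \<bar>p - q\<bar>" for p q :: real by (cases "q \<le> p") simp_all
    have "\<bar>drift ?u - drift ?w\<bar> = 2 * \<bar>logistic_phi (field ?u) - logistic_phi (field ?w)\<bar>"
      unfolding drift_def by (rule aux)
    also have "\<dots> \<le> \<bar>field ?u - field ?w\<bar>" using logistic_phi_diff[of "field ?u" "field ?w"] by simp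
    also have "\<dots> \<le> 2 * (\<Sum>n. b n * differ ?u ?w n)" by (rule field_diff[OF uw])
    also have "(\<Sum>n. b n * differ ?u ?w n) = (\<Sum>n<j. b n * differ ?u ?w n)"
    proof (rule suminf_finite)
      fix n assume "n \<notin> {..<j}"
      then have "differ ?u ?w n \<le> 0" using d0[of n] by simp
      then have "differ ?u ?w n = 0" using differ_bounds(1)[of ?u ?w n] by simp
      then show "b n * differ ?u ?w n = 0" by simp
    qed simp
    also have "\<dots> = (\<Sum>i<j. b (j - Suc i) * differ ?u ?w (j - Suc i))"
      by (rule sum.nat_diff_reindex[symmetric])
    also have "\<dots> \<le> (\<Sum>i<j. b (j - Suc i) * of_bool (i < m))"
    proof (intro sum_mono mult_left_mono b_nonneg)
      fix i assume "i \<in> {..<j}"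
      then show "differ ?u ?w (j - Suc i) \<le> of_bool (i < m)" using d0[of "j - Suc i"] by auto
    qed
    also have "\<dots> = (\<Sum>i\<in>{..<j} \<inter> {..<m}. b (j - Suc i))"
      by (rule sum.mono_neutral_cong_right) auto
    also have "\<dots> = (\<Sum>i<m. ?b j i)"
      by (rule sum.mono_neutral_cong_left) auto
    finally show ?thesis by simp
  qed
  have val: "\<bar>?y (int j) - ?z (int j)\<bar> \<le> 2 * of_bool (j < m)" for j
    using x by (auto simp: forget_def configs_iff abs_le_iff dest: spec[of _ "int j"])
  have "martingale N ?y - martingale N ?z = (\<Sum>j<N. t j * ((?y (int j) - ?z (int j))
      - (drift (past_upto (int j - 1) ?y) - drift (past_upto (int j - 1) ?z))))"
    unfolding martingale_def sum_subtractf[symmetric] by (intro sum.cong refl) (simp add: algebra_simps)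
  then have "\<bar>martingale N ?y - martingale N ?z\<bar> \<le> (\<Sum>j<N. \<bar>t j * ((?y (int j) - ?z (int j))
      - (drift (past_upto (int j - 1) ?y) - drift (past_upto (int j - 1) ?z)))\<bar>)"
    by (simp only: sum_abs)
  also have "\<dots> \<le> (\<Sum>j<N. t 0 * (2 * of_bool (j < m) + 2 * (\<Sum>i<m. ?b j i)))"
  proof (intro sum_mono)
    fix j
    have "\<bar>(?y (int j) - ?z (int j)) - (drift (past_upto (int j - 1) ?y) - drift (past_upto (int j - 1) ?z))\<bar>
        \<le> 2 * of_bool (j < m) + 2 * (\<Sum>i<m. ?b j i)"
      by (rule order_trans[OF abs_triangle_ineq4 add_mono[OF val drift]])
    then show "\<bar>t j * ((?y (int j) - ?z (int j))
        - (drift (past_upto (int j - 1) ?y) - drift (past_upto (int j - 1) ?z)))\<bar>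
        \<le> t 0 * (2 * of_bool (j < m) + 2 * (\<Sum>i<m. ?b j i))"
      unfolding abs_mult abs_of_nonneg[OF t_nonneg] by (intro mult_mono t_antimono t_nonneg) auto
  qed
  also have "\<dots> = t 0 * (2 * (\<Sum>j<N. of_bool (j < m)) + 2 * (\<Sum>i<m. \<Sum>j<N. ?b j i))"
    unfolding sum_distrib_left[symmetric] sum.distrib by (subst sum.swap) (rule refl)
  also have "\<dots> \<le> t 0 * (2 * real m + 2 * (real m * B))"
  proof (intro mult_left_mono add_mono t_nonneg)
    have "(\<Sum>j<N. of_bool (j < m) :: real) = (\<Sum>j\<in>{..<N} \<inter> {..<m}. 1)"
      by (rule sum.mono_neutral_cong_right) auto
    also have "\<dots> \<le> real m" using card_mono[of "{..<m}" "{..<N} \<inter> {..<m}"] by simp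
    finally show "(\<Sum>j<N. of_bool (j < m) :: real) \<le> real m" .
    have "(\<Sum>i<m. \<Sum>j<N. ?b j i) \<le> (\<Sum>i<m. B)" by (intro sum_mono sum_b_le)
    then show "(\<Sum>i<m. \<Sum>j<N. ?b j i) \<le> real m * B" by simp
  qed auto
  finally show ?thesis .
qed

text \<open>Turning a minus past into plus raises the field at time \<open>j\<close> by
  \<open>2 * t j\<close>, hence the predicted mean by at least \<open>2 / K * t j\<close>. Weighted
  with \<open>t j\<close> these losses add up to \<open>2 / K * V N\<close>.\<close>

lemma forget_negative_past:
  assumes x: "x \<in> configs" and neg: "past_upto (-1) x = (\<lambda>_. -1)"
  shows "martingale N (forget 0 x) \<le> martingale N x - 2 / K * V N"
proof -
  have neg': "x i = -1" if "i < 0" for i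
    using fun_cong[OF neg, of "nat (- 1 - i)"] that by (simp add: past_upto_def)
  have drift: "2 / K * t j \<le> drift (past_upto (int j - 1) (forget 0 x)) - drift (past_upto (int j - 1) x)" for j
  proof -
    let ?u = "past_upto (int j - 1) (forget 0 x)" and ?w = "past_upto (int j - 1) x"
    have uw: "?u \<in> pasts" "?w \<in> pasts" by (intro past_upto_pasts forget_configs x)+
    note st = summable_ignore_initial_segment[OF b_summable, of j]
    have "field ?u - field ?w = (\<Sum>n. b (n + 0) * (?u n - ?w n))"
      unfolding field_gap[OF uw] gap_def ..
    also have "\<dots> = (\<Sum>n. b (n + j + 0) * (?u (n + j) - ?w (n + j))) + (\<Sum>n<j. b (n + 0) * (?u n - ?w n))"
      by (rule suminf_split_initial_segment[OF summable_gap[OF uw]])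
    also have "(\<Sum>n<j. b (n + 0) * (?u n - ?w n)) = 0"
      by (intro sum.neutral) (auto simp: past_upto_def forget_def)
    also have "(\<lambda>n. b (n + j + 0) * (?u (n + j) - ?w (n + j))) = (\<lambda>n. 2 * b (n + j))"
      by (auto simp: past_upto_def forget_def neg')
    also have "(\<Sum>n. 2 * b (n + j)) = 2 * t j" unfolding t_def by (rule suminf_mult[OF st])
    finally have fd: "field ?u - field ?w = 2 * t j" by simp
    have "(1 - (tanh (1 + \<bar>\<delta>\<bar>))\<^sup>2) * (field ?u - field ?w) \<le> tanh (field ?u) - tanh (field ?w)"
      using field_bound[OF uw(1)] field_bound[OF uw(2)] fd t_nonneg[of j] by (intro tanh_diff_ge) (auto simp: abs_le_iff)
    then show ?thesis unfolding fd drift_tanh K_def by (simp add: algebra_simps)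
  qed
  have "martingale N (forget 0 x) \<le> (\<Sum>j<N. t j * (x (int j) - drift (past_upto (int j - 1) x)) - 2 / K * (t j)\<^sup>2)"
    unfolding martingale_def
  proof (intro sum_mono)
    fix j
    have "t j * (forget 0 x (int j) - drift (past_upto (int j - 1) (forget 0 x)))
        \<le> t j * (x (int j) - drift (past_upto (int j - 1) x) - 2 / K * t j)"
      using drift[of j] by (intro mult_left_mono t_nonneg) (simp add: forget_def)
    also have "\<dots> = t j * (x (int j) - drift (past_upto (int j - 1) x)) - 2 / K * (t j)\<^sup>2"
      by (simp add: power2_eq_square right_diff_distrib)
    finally show "t j * (forget 0 x (int j) - drift (past_upto (int j - 1) (forget 0 x)))
        \<le> t j * (x (int j) - drift (past_upto (int j - 1) x)) - 2 / K * (t j)\<^sup>2" .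
  qed
  also have "\<dots> = martingale N x - 2 / K * V N"
    by (simp add: sum_subtractf martingale_def V_def sum_distrib_left)
  finally show ?thesis .
qed

lemma phase_transition:
  assumes "\<not> summable (\<lambda>j. (t j)\<^sup>2)" shows "dynamic_phase_transition g"
proof -
  have "\<exists>N. 2 ^ k \<le> V N" for k
  proof (rule ccontr)
    assume "\<nexists>N. 2 ^ k \<le> V N"
    then have "(\<Sum>j<N. (t j)\<^sup>2) \<le> 2 ^ k" for N unfolding V_def using not_le less_imp_le by blast
    then have "summable (\<lambda>j. (t j)\<^sup>2)" by (intro summableI_nonneg_bounded[of _ "2 ^ k"]) auto
    then show False using assms by simp
  qed
  then obtain n where V: "\<And>k. 2 ^ k \<le> V (n k)" by metis
  have Vpos: "0 < V (n k)" for k by (rule less_le_trans[OF _ V[of k]]) simp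
  have Vinv: "(\<lambda>k. M / V (n k)) \<longlonglongrightarrow> 0" for M
  proof (rule Lim_null_comparison[OF always_eventually])
    show "\<forall>k. norm (M / V (n k)) \<le> \<bar>M\<bar> * (1 / 2) ^ k"
    proof
      fix k
      have "\<bar>M\<bar> / V (n k) \<le> \<bar>M\<bar> / 2 ^ k" using V[of k] Vpos[of k] by (intro divide_left_mono) auto
      then show "norm (M / V (n k)) \<le> \<bar>M\<bar> * (1 / 2) ^ k" using Vpos[of k] by (simp add: power_one_over)
    qed
    show "(\<lambda>k. \<bar>M\<bar> * (1 / 2) ^ k) \<longlonglongrightarrow> 0" by (intro tendsto_mult_right_zero LIMSEQ_power_zero) simp
  qed
  let ?R = "\<lambda>m k x. martingale (n k) (forget m x) / V (n k)"
  define A where "A = {x \<in> configs. (\<lambda>k. ?R 0 k x) \<longlonglongrightarrow> 0}"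
  \<comment> \<open>Forgetting \<open>m\<close> symbols changes the statistic by a bounded amount,
    which vanishes after division by \<open>V (n k)\<close>. So \<open>A\<close> can be described by
    the coordinates from \<open>m\<close> on, for every \<open>m\<close>.\<close>
  have A_m: "A = {x \<in> configs. (\<lambda>k. ?R m k x) \<longlonglongrightarrow> 0}" for m
  proof -
    have "(\<lambda>k. ?R m k x - ?R 0 k x) \<longlonglongrightarrow> 0" if "x \<in> configs" for x
    proof (rule Lim_null_comparison[OF always_eventually Vinv])
      show "\<forall>k. norm (?R m k x - ?R 0 k x) \<le> t 0 * (2 * real m + 2 * (real m * B)) / V (n k)"
        unfolding diff_divide_distrib[symmetric] real_norm_def abs_divide abs_of_pos[OF Vpos]
        by (intro allI divide_right_mono forget_close that less_imp_le Vpos)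
    qed
    then have "(\<lambda>k. ?R m k x) \<longlonglongrightarrow> 0 \<longleftrightarrow> (\<lambda>k. ?R 0 k x) \<longlonglongrightarrow> 0" if "x \<in> configs" for x
      using that by (intro Lim_transform_eq) blast
    then show ?thesis unfolding A_def by blast
  qed
  have A_coord: "A \<in> sets (coord_algebra {int m..})" for m
  proof -
    have "martingale (n k) \<in> borel_measurable (coord_algebra UNIV)" for k
      by (rule coord_measurable_mono[OF _ martingale_measurable]) simp
    then have "(\<lambda>x. martingale (n k) (forget m x)) \<in> borel_measurable (coord_algebra {int m..})" for k
      by (rule measurable_compose[OF forget_measurable])
    then have "(\<lambda>x. ?R m k x) \<in> borel_measurable (coord_algebra {int m..})" for k by simp
    then have "Measurable.pred (coord_algebra {int m..}) (\<lambda>x. (\<lambda>k. ?R m k x) \<longlonglongrightarrow> 0)" by (rule measurable_limit)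
    then have "{x \<in> space (coord_algebra {int m..}). (\<lambda>k. ?R m k x) \<longlonglongrightarrow> 0} \<in> sets (coord_algebra {int m..})"
      by (simp add: pred_def)
    then show ?thesis unfolding A_m[of m] by simp
  qed
  have tail: "A \<in> future_tail"
    unfolding future_tail_def
  proof
    fix m :: int assume "m \<in> {1..}"
    then show "A \<in> sets (coord_algebra {m..})" using A_coord[of "nat m"] by simp
  qed
  let ?p = "\<lambda>_ :: nat. 1 :: real" and ?m = "\<lambda>_ :: nat. -1 :: real"
  have pm: "?p \<in> pasts" "?m \<in> pasts" by (simp_all add: pasts_iff)
  define P where "P = started_from g ?p"
  define Q where "Q = started_from g ?m"
  have sP: "starts P ?p" and sQ: "starts Q ?m" unfolding P_def Q_def by (rule starts_started_from pm)+
  have P: "prob_on_configs P" and Pc: "\<And>j. j \<ge> 0 \<Longrightarrow> has_cond_prob g P j" and Pae: "AE x in P. past_upto (-1) x = ?p"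
    using sP by (auto simp: starts_def)
  have Q: "prob_on_configs Q" and Qc: "\<And>j. j \<ge> 0 \<Longrightarrow> has_cond_prob g Q j" and Qae: "AE x in Q. past_upto (-1) x = ?m"
    using sQ by (auto simp: starts_def)
  interpret P: prob_space P using P by (simp add: prob_on_configs_def)
  interpret Q: prob_space Q using Q by (simp add: prob_on_configs_def)
  have sp: "space P = configs" "space Q = configs" using P Q by (auto simp: prob_on_configs_def)
  have AP: "A \<in> sets P" and AQ: "A \<in> sets Q"
    using A_coord[of 0] subalgebra_coord[OF P, of "{0..}"] subalgebra_coord[OF Q, of "{0..}"]
    by (auto simp: subalgebra_def)
  have P0: "AE x in P. (\<lambda>k. martingale (n k) x / V (n k)) \<longlonglongrightarrow> 0"
    by (rule martingale_AE[OF P _ V]) (rule Pc)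
  have Q0: "AE x in Q. (\<lambda>k. martingale (n k) x / V (n k)) \<longlonglongrightarrow> 0"
    by (rule martingale_AE[OF Q _ V]) (rule Qc)
  have "AE x in P. x \<in> A"
    using P0 Pae AE_space
  proof eventually_elim
    case (elim x)
    have "x i = 1" if "i < 0" for i
      using fun_cong[OF elim(2), of "nat (- 1 - i)"] that by (simp add: past_upto_def)
    \<comment> \<open>After the plus past the prediction from the plus past is the true one, so the
      statistic is the martingale itself.\<close>
    then have "forget 0 x = x" by (auto simp: forget_def)
    then show ?case using elim by (simp add: A_def sp)
  qed
  then have one: "measure P A = 1" using P.prob_eq_1[OF AP] by simp
  have "AE x in Q. x \<notin> A"
    using Q0 Qae AE_space
  proof eventually_elim
    case (elim x)
    show ?case
    proof
      assume "x \<in> A"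
      \<comment> \<open>Membership in \<open>A\<close> would make both the correctly centred and the
        plus-centred statistic tend to 0, yet they differ by at least \<open>2 / K\<close>.\<close>
      then have "(\<lambda>k. martingale (n k) x / V (n k) - ?R 0 k x) \<longlonglongrightarrow> 0 - 0"
        using elim(1) unfolding A_def by (intro tendsto_diff) auto
      moreover have "2 / K \<le> martingale (n k) x / V (n k) - ?R 0 k x" for k
      proof -
        have "2 / K * V (n k) \<le> martingale (n k) x - martingale (n k) (forget 0 x)"
          using forget_negative_past[OF _ elim(2), of "n k"] elim(3) by (simp add: sp)
        then have "2 / K \<le> (martingale (n k) x - martingale (n k) (forget 0 x)) / V (n k)"
          using Vpos[of k] by (simp add: pos_le_divide_eq)
        then show ?thesis by (simp add: diff_divide_distrib)
      qed
      ultimately have "2 / K \<le> 0 - 0" by (intro LIMSEQ_le_const) auto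
      then show False using K_pos by (simp add: field_simps)
    qed
  qed
  then have zero: "measure Q A = 0" using Q.prob_eq_0[OF AQ] by simp
  have "measure (started_from g ?p) A \<noteq> measure (started_from g ?m) A"
    using one zero by (simp add: P_def Q_def)
  then show ?thesis
    unfolding dynamic_phase_transition_def dynamic_uniqueness_def using tail pm by blast
qed

end

theorem corollary5:
  fixes \<delta> c \<epsilon> :: real and \<beta> :: "nat \<Rightarrow> real"
  assumes "\<delta> \<ge> 0" and "c > 0" and "0 < \<epsilon>" and "\<epsilon> < 1 / 2"
    and "\<And>j. j \<ge> 1 \<Longrightarrow> \<beta> j = c / real j powr (1 + \<epsilon>)"
    and "(\<Sum>j. \<beta> (Suc j)) < 1"
  shows "(\<exists>!P. g_measure (ising_kernel \<beta> \<delta>) P)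
    \<and> (\<forall>P. g_measure (ising_kernel \<beta> \<delta>) P \<longrightarrow> weak_bernoulli P)
    \<and> dynamic_phase_transition (ising_kernel \<beta> \<delta>)"
proof -
  have \<beta>: "\<beta> (Suc n) = c * real (Suc n) powr (- (1 + \<epsilon>))" for n
    using assms(5)[of "Suc n"] by (simp only: powr_minus_divide) simp
  have "summable (\<lambda>n. real n powr (- (1 + \<epsilon>)))"
    using assms(3) by (subst summable_real_powr_iff) simp
  then have "summable (\<lambda>n. real (Suc n) powr (- (1 + \<epsilon>)))" by (subst summable_Suc_iff)
  then have sum: "summable (\<lambda>n. \<beta> (Suc n))" unfolding \<beta> by (rule summable_mult)
  interpret ising \<beta> \<delta>
  proof
    fix n
    show "0 \<le> \<beta> (Suc n)" unfolding \<beta> using assms(2) by simp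
    show "\<beta> (Suc (Suc n)) \<le> \<beta> (Suc n)"
      unfolding \<beta> using assms(2,3) by (intro mult_left_mono powr_mono2') auto
  qed (fact sum assms(6))+
  \<comment> \<open>With \<open>N = j + 1\<close>, the first \<open>N\<close> terms of
    \<open>t j\<close> carry indices at most \<open>2 * N\<close> and so contribute at least
    \<open>N * c * (2 * N) powr (- (1 + \<epsilon>))\<close>. Since \<epsilon> is below
    \<open>1/2\<close>, the exponent may be lowered to \<open>- 3/2\<close>; squaring then gives
    \<open>c^2 / (8 * N)\<close>, with \<open>8 = 2^3\<close>.\<close>
  have lower: "c\<^sup>2 / 8 * inverse (real (Suc j)) \<le> (t j)\<^sup>2" for j
  proof -
    define N where "N = real (Suc j)"
    have N: "1 \<le> N" by (simp add: N_def)
    have "N * (c * (2 * N) powr (- (1 + \<epsilon>))) = (\<Sum>n\<in>{..<Suc j}. c * (2 * N) powr (- (1 + \<epsilon>)))" by (simp add: N_def)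
    also have "\<dots> \<le> (\<Sum>n\<in>{..<Suc j}. b (n + j))"
      unfolding b_def \<beta> N_def using assms(2,3) by (intro sum_mono mult_left_mono powr_mono2') auto
    also have "\<dots> \<le> t j"
      unfolding t_def by (intro sum_le_suminf summable_ignore_initial_segment b_summable) (auto simp: b_nonneg)
    finally have 1: "N * (c * (2 * N) powr (- (1 + \<epsilon>))) \<le> t j" .
    have "(2 * N) powr (- (3 / 2)) \<le> (2 * N) powr (- (1 + \<epsilon>))"
      using N assms(4) by (intro powr_mono) auto
    then have "N * (c * (2 * N) powr (- (3 / 2))) \<le> N * (c * (2 * N) powr (- (1 + \<epsilon>)))"
      using N assms(2) by (intro mult_left_mono) auto
    then have 2: "N * (c * (2 * N) powr (- (3 / 2))) \<le> t j" using 1 by linarith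
    have "((2 * N) powr (- (3 / 2)))\<^sup>2 = (2 * N) powr (- 3)"
      using N by (simp add: power2_eq_square flip: powr_add)
    also have "\<dots> = 1 / (2 * N) ^ 3"
      using N by (simp add: powr_minus_divide powr_numeral)
    finally have "(N * (c * (2 * N) powr (- (3 / 2))))\<^sup>2 = N\<^sup>2 * (c\<^sup>2 * (1 / (2 * N) ^ 3))"
      by (simp only: power_mult_distrib)
    also have "\<dots> = c\<^sup>2 / 8 * inverse N" using N by (simp add: field_simps power2_eq_square power3_eq_cube)
    finally have "c\<^sup>2 / 8 * inverse N = (N * (c * (2 * N) powr (- (3 / 2))))\<^sup>2" ..
    also have "\<dots> \<le> (t j)\<^sup>2" using 2 N assms(2) by (intro power_mono) auto
    finally show ?thesis by (simp add: N_def)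
  qed
  have "\<not> summable (\<lambda>j. (t j)\<^sup>2)"
  proof
    assume "summable (\<lambda>j. (t j)\<^sup>2)"
    then have "summable (\<lambda>j. c\<^sup>2 / 8 * inverse (real (Suc j)))"
      by (rule summable_comparison_test'[of _ 0]) (use lower in auto)
    then have "summable (\<lambda>j. inverse (real (Suc j)))"
      using assms(2) by (subst (asm) summable_cmult_iff) auto
    then have "summable (\<lambda>j. inverse (real j))" by (subst (asm) summable_Suc_iff)
    then show False using not_summable_harmonic[where 'a=real] by simp
  qed
  then show ?thesis
    using ex_g_measure g_measure_unique g_measure_weak_bernoulli phase_transition by blast
qed

end
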